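(* Let $\mu$ be a non-trivial probability measure on $\partial\mathbb{D}$ with absolutely continuous density $w$ and Verblunsky coefficients $\alpha=\{\alpha_k\}_{k\ge 0}$, and assume $\sum_{k\ge 0}|\alpha_k|^4<\infty$. For $q_0,q_1,\dots,q_N\in\mathbb{C}$ define $$Q(z)=\sum_{m=0}^N q_mz^m,\qquad \bar Q(S)=\sum_{m=0}^N\bar q_mS^m,$$ where $S$ is the left-shift operator on sequences. Then $$\big|Q(e^{i\theta})\big|^2\log w(\theta)\in L^1(d\theta)\quad\Longleftrightarrow\quad \{\bar Q(S)\alpha\}_k\in\ell^2.$$
   Context: $\mathbb{D}=\{|z|<1\}$. A probability measure $\mu$ on $\partial\mathbb{D}$ is non-trivial if its support is infinite. $\partial\mathbb{D}$ is identified with $[0,2\pi)$ via $\theta\mapsto e^{i\theta}$, and $d\mu=w(\theta)\frac{d\theta}{2\pi}+d\mu_{\rm sing}$ with $\mu_{\rm sing}$ singular with respect to Lebesgue measure. $\Phi_n$ ($n\ge 0$) are the monic orthogonal polynomials of $\mu$, $\Phi_n^*(z)=z^n\overline{\Phi_n(1/\bar z)}$ the reversed polynomials, and the Verblunsky coefficients $\alpha_n\in\mathbb{D}$, $n\ge0$, are defined by $\Phi_{n+1}(z)=z\Phi_n(z)-\bar\alpha_n\Phi_n^*(z)$. The left shift is $S(x_0,x_1,\dots)=(x_1,x_2,\dots)$, so $\{\bar Q(S)\alpha\}_k=\sum_{m=0}^N\bar q_m\alpha_{k+m}$ for $k\ge0$, and $\ell^2$ means square-summable over $k\ge 0$. Conventions: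 $\log 0=-\infty$ and $0\cdot(-\infty)=0$. *)

theory Defs
  imports "HOL-Probability.Probability" "HOL-Computational_Algebra.Polynomial"
begin

section \<open>Measures on the unit circle\<close>

text \<open>Measures on the unit circle are Borel measures on the complex plane for which the
  complement of the circle is a null set.\<close>

definition circle_prob_measure :: "complex measure \<Rightarrow> bool" where
  "circle_prob_measure \<mu> \<longleftrightarrow>
     prob_space \<mu> \<and> sets \<mu> = sets borel \<and> emeasure \<mu> (- sphere 0 1) = 0"

definition measure_support :: "complex measure \<Rightarrow> complex set" where
  "measure_support \<mu> = {z. \<forall>U. open U \<and> z \<in> U \<longrightarrow> emeasure \<mu> U > 0}"

definition nontrivial_circle_measure :: "complex measure \<Rightarrow> bool" where
  "nontrivial_circle_measure \<mu> \<longleftrightarrow> circle_prob_measure \<mu> \<and> infinite (measure_support \<mu>)"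

abbreviation d\<theta> :: "real measure" where
  "d\<theta> \<equiv> lebesgue_on {0..<2 * pi}"

text \<open>The measure \<open>w(\<theta>) d\<theta>/2\<pi>\<close>, transported to the circle by \<open>\<theta> \<mapsto> exp(i\<theta>)\<close>.\<close>

definition ac_circle_measure :: "(real \<Rightarrow> real) \<Rightarrow> complex measure" where
  "ac_circle_measure w = distr (density d\<theta> (\<lambda>\<theta>. ennreal (w \<theta> / (2 * pi)))) borel cis"

definition singular_circle_measure :: "complex measure \<Rightarrow> bool" where
  "singular_circle_measure \<nu> \<longleftrightarrow>
     sets \<nu> = sets borel \<and>
     (\<exists>A \<in> sets borel. emeasure \<nu> (- A) = 0 \<and> emeasure d\<theta> {\<theta> \<in> {0..<2 * pi}. cis \<theta> \<in> A} = 0)"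

text \<open>The density is determined by \<open>\<mu>\<close> only almost everywhere, hence a relation:
  \<open>w\<close> is any version of the density in the Lebesgue decomposition
  \<open>d\<mu> = w d\<theta>/2\<pi> + d\<mu>\<^sub>s\<^sub>i\<^sub>n\<^sub>g\<close>.\<close>

definition ac_density :: "complex measure \<Rightarrow> (real \<Rightarrow> real) \<Rightarrow> bool" where
  "ac_density \<mu> w \<longleftrightarrow>
     w \<in> borel_measurable d\<theta> \<and> (\<forall>\<theta>\<in>{0..<2 * pi}. 0 \<le> w \<theta>) \<and>
     (\<exists>\<mu>sing. singular_circle_measure \<mu>sing \<and>
        (\<forall>A \<in> sets borel. emeasure \<mu> A = emeasure (ac_circle_measure w) A + emeasure \<mu>sing A))"

section \<open>Orthogonal polynomials and Verblunsky coefficients\<close>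

text \<open>For a non-trivial measure the monic orthogonal polynomials exist and are unique.\<close>

definition monic_OP :: "complex measure \<Rightarrow> nat \<Rightarrow> complex poly" where
  "monic_OP \<mu> n =
     (THE p. degree p = n \<and> lead_coeff p = 1 \<and>
        (\<forall>k<n. (\<integral>z. cnj (z ^ k) * poly p z \<partial>\<mu>) = 0))"

text \<open>\<open>z\<^sup>n * cnj (p (1 / cnj z))\<close> written as a polynomial: the coefficients of \<open>p\<close>, a
  polynomial of degree at most \<open>n\<close>, are conjugated and reversed.\<close>

definition reversed_poly :: "nat \<Rightarrow> complex poly \<Rightarrow> complex poly" where
  "reversed_poly n p = (\<Sum>i\<le>n. monom (cnj (coeff p i)) (n - i))"

lemma poly_reversed_poly:
  assumes "degree p \<le> n" "z \<noteq> 0"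
  shows "poly (reversed_poly n p) z = z ^ n * cnj (poly p (1 / cnj z))"
proof -
  have "poly p x = (\<Sum>i\<le>n. coeff p i * x ^ i)" for x
    unfolding poly_altdef using assms(1)
    by (intro sum.mono_neutral_left) (auto simp: coeff_eq_0)
  then have "z ^ n * cnj (poly p (1 / cnj z)) = (\<Sum>i\<le>n. z ^ n * (cnj (coeff p i) * (1 / z) ^ i))"
    by (simp add: sum_distrib_left)
  also have "\<dots> = (\<Sum>i\<le>n. cnj (coeff p i) * z ^ (n - i))"
    using assms(2) by (intro sum.cong) (simp_all add: power_diff power_one_over field_simps)
  finally show ?thesis
    by (simp add: reversed_poly_def poly_sum poly_monom)
qed

definition verblunsky :: "complex measure \<Rightarrow> nat \<Rightarrow> complex" where
  "verblunsky \<mu> n =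
     (THE a. \<forall>z. poly (monic_OP \<mu> (Suc n)) z =
        z * poly (monic_OP \<mu> n) z - cnj a * poly (reversed_poly n (monic_OP \<mu> n)) z)"

section \<open>Shift operator, extended logarithm, integrability\<close>

definition left_shift :: "(nat \<Rightarrow> complex) \<Rightarrow> nat \<Rightarrow> complex" where
  "left_shift x = (\<lambda>k. x (Suc k))"

text \<open>\<open>shift_poly N c\<close> is the operator \<open>\<Sum>m\<le>N. c m S\<^sup>m\<close>, where \<open>S\<close> is the left shift.\<close>

definition shift_poly :: "nat \<Rightarrow> (nat \<Rightarrow> complex) \<Rightarrow> (nat \<Rightarrow> complex) \<Rightarrow> nat \<Rightarrow> complex" where
  "shift_poly N c x = (\<lambda>k. \<Sum>m\<le>N. c m * (left_shift ^^ m) x k)"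

lemma shift_poly_eq: "shift_poly N c x k = (\<Sum>m\<le>N. c m * x (k + m))"
proof -
  have "(left_shift ^^ m) x k = x (k + m)" for m
    by (induction m arbitrary: k) (simp_all add: left_shift_def)
  then show ?thesis by (simp add: shift_poly_def)
qed

definition square_summable :: "(nat \<Rightarrow> complex) \<Rightarrow> bool" where
  "square_summable x \<longleftrightarrow> summable (\<lambda>k. (cmod (x k))\<^sup>2)"

text \<open>Logarithm of a nonnegative real with \<open>log 0 = -\<infinity>\<close>, whereas \<open>ln 0 = 0\<close> in the library.
  The convention \<open>0 \<cdot> (-\<infinity>) = 0\<close> is that of the type \<^typ>\<open>ereal\<close>.\<close>

definition elog :: "real \<Rightarrow> ereal" where
  "elog x = (if x = 0 then -\<infinity> else ereal (ln x))"

definition L1_ereal :: "'a measure \<Rightarrow> ('a \<Rightarrow> ereal) \<Rightarrow> bool" where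
  "L1_ereal M f \<longleftrightarrow> f \<in> borel_measurable M \<and> (\<integral>\<^sup>+ x. e2ennreal \<bar>f x\<bar> \<partial>M) < \<infinity>"

end

theory Submission
  imports Defs "HOL-Complex_Analysis.Complex_Analysis" "HOL-Library.Landau_Symbols"
begin

text \<open>
  Let \<open>P n\<close> be the monic orthogonal polynomials, \<open>R n\<close> their reversals and
  \<open>\<kappa> n = (\<Prod>j<n. 1 - \<bar>\<alpha> j\<bar>\<^sup>2)\<close> the squared norm of \<open>P n\<close>. The Bernstein-Szego weight
  \<open>\<kappa> n / \<bar>R n\<bar>\<^sup>2\<close> has the same moments as \<open>\<mu>\<close> up to order \<open>n\<close> (\<open>bs_moments\<close>). With \<open>J n\<close> the
  integral over the circle of \<open>\<bar>Q\<bar>\<^sup>2\<close> times the logarithm of this weight, both sides of the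
  equivalence turn out to say that the sequence \<open>J n\<close> is bounded below.

  The coefficient side (\<open>square_summable_iff_bs_entropy\<close>). Since \<open>R n\<close> has no zeros in the closed
  disc and \<open>R n 0 = 1\<close>, the number \<open>J n\<close> is a finite combination of \<open>ln (\<kappa> n)\<close> and of the Taylor
  coefficients of \<open>log (R n)\<close> of order at most \<open>N\<close>. The ratios \<open>f n = P n / R n\<close> satisfy
  \<open>f (n+1) (1 - \<alpha> n z f n) = z f n - cnj (\<alpha> n)\<close>, and
  \<open>log (R (n+1)) = log (R n) + log (1 - \<alpha> n z f n)\<close>. Hence the \<open>l\<close>-th Taylor coefficient of
  \<open>log (R n)\<close> grows by \<open>\<alpha> n cnj (\<alpha> (n-l))\<close> in the \<open>n\<close>-th step, up to terms of order four in the
  nearby coefficients: there is no cubic term. These errors are summable because \<open>\<alpha>\<close> lies in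
  \<open>\<ell>\<^sup>4\<close> (\<open>log_coeff_bounded\<close>), and so \<open>J n / (2\<pi>)\<close> differs by a bounded sequence from the
  negative of the \<open>n\<close>-th partial sum of the squared moduli of the shifted combination
  (\<open>bs_entropy_asymp\<close>).

  The measure side. If \<open>\<bar>Q\<bar>\<^sup>2 log w\<close> is integrable, then \<open>ln x \<le> x\<close> applied to the quotient of
  \<open>w\<close> by the Bernstein-Szego weight, together with \<open>\<integral>\<bar>P n\<bar>\<^sup>2 d\<mu> = \<kappa> n\<close>, bounds \<open>J n\<close> below
  (\<open>L1_imp_entropy_bounded\<close>). The converse is the upper semicontinuity of entropy
  (\<open>entropy_bounded_imp_L1\<close>): applying \<open>ln x \<le> x\<close> to the product of the weight with a
  trigonometric polynomial \<open>p \<ge> 1\<close> gives, as the moments agree for large \<open>n\<close>, an upper bound for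
  the integral of \<open>\<bar>Q\<bar>\<^sup>2 ln p\<close> in terms of that of \<open>\<bar>Q\<bar>\<^sup>2 p\<close> with respect to \<open>\<mu>\<close>. Approximation
  in mean extends it to bounded Borel functions; the choice \<open>max 1 (1 / (w + \<epsilon>))\<close> off the singular
  set, and \<open>1\<close> on it, followed by \<open>\<epsilon> \<rightarrow> 0\<close>, bounds the integral of \<open>\<bar>Q\<bar>\<^sup>2\<close> times the negative
  part of \<open>log w\<close>. The positive part is controlled by \<open>w\<close>.
\<close>

section \<open>Fourier integrals over the circle and logarithms of zero-free polynomials\<close>

lemma finite_measure_dtheta: "finite_measure d\<theta>"
  by (rule finite_measure_lebesgue_on, rule bounded_set_imp_lmeasurable) auto

lemma borel_measurable_dtheta: "f \<in> borel_measurable borel \<Longrightarrow> f \<in> borel_measurable d\<theta>"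
  by (simp add: measurable_completion measurable_restrict_space1)

lemma borel_measurable_dtheta_continuous:
  "continuous_on UNIV f \<Longrightarrow> (f :: real \<Rightarrow> 'b::topological_space) \<in> borel_measurable d\<theta>"
  by (intro borel_measurable_dtheta borel_measurable_continuous_onI)

lemma cis_measurable [measurable]: "cis \<in> borel_measurable d\<theta>"
  by (rule borel_measurable_dtheta_continuous) (simp add: continuous_on_cis)

lemma integrable_dtheta_bounded:
  fixes f :: "real \<Rightarrow> 'b::{banach, second_countable_topology}"
  assumes "f \<in> borel_measurable d\<theta>" "\<And>x. norm (f x) \<le> B"
  shows "integrable d\<theta> f"
  using finite_measure.integrable_const_bound[OF finite_measure_dtheta, of f B] assms by simp

lemma bounded_on_circle:
  fixes \<phi> :: "complex \<Rightarrow> 'b::real_normed_vector"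
  assumes "continuous_on (sphere 0 1) \<phi>"
  obtains B where "\<And>z. cmod z = 1 \<Longrightarrow> norm (\<phi> z) \<le> B"
proof -
  have "compact (\<phi> ` sphere 0 1)" using assms by (intro compact_continuous_image) auto
  then have "bounded (\<phi> ` sphere 0 1)" by (rule compact_imp_bounded)
  then obtain B where "\<forall>x \<in> \<phi> ` sphere 0 1. norm x \<le> B" unfolding bounded_iff by blast
  then show ?thesis by (intro that[of B]) auto
qed

lemma integrable_dtheta_circle:
  fixes \<phi> :: "complex \<Rightarrow> real"
  assumes "continuous_on (sphere 0 1) \<phi>"
  shows "integrable d\<theta> (\<lambda>\<theta>. \<phi> (cis \<theta>))"
proof -
  obtain B where B: "\<And>z. cmod z = 1 \<Longrightarrow> norm (\<phi> z) \<le> B"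
    using bounded_on_circle[OF assms] by blast
  have "continuous_on UNIV (\<lambda>\<theta>. \<phi> (cis \<theta>))"
    by (rule continuous_on_compose2[OF assms]) (auto intro!: continuous_intros)
  then show ?thesis
    using B by (intro integrable_dtheta_bounded[where B = B] borel_measurable_dtheta_continuous) auto
qed

lemma integral_cis_int:
  "(\<integral>\<theta>. cis (of_int k * \<theta>) \<partial>d\<theta>) = (if k = 0 then of_real (2 * pi) else 0)"
proof -
  have int: "integrable d\<theta> (\<lambda>\<theta>. cis (of_int k * \<theta>))"
    by (rule integrable_dtheta_bounded[where B = 1])
      (auto intro!: borel_measurable_dtheta_continuous continuous_intros)
  have "(\<integral>\<theta>. cis (of_int k * \<theta>) \<partial>d\<theta>) = integral {0..<2*pi} (\<lambda>\<theta>. cis (of_int k * \<theta>))"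
    using int by (rule lebesgue_integral_eq_integral) simp
  also have "\<dots> = integral {0..2*pi} (\<lambda>\<theta>. cis (of_int k * \<theta>))"
  proof (rule integral_subset_negligible)
    show "negligible ({0..2*pi} - {0..<2*pi})"
      by (rule negligible_subset[of "{2*pi}"]) auto
  qed auto
  also have "\<dots> = (if k = 0 then of_real (2 * pi) else 0)"
  proof (cases "k = 0")
    case True
    then show ?thesis by (simp add: scaleR_conv_of_real)
  next
    case False
    let ?F = "\<lambda>\<theta>. cis (of_int k * \<theta>) / (\<i> * of_int k)"
    have "((\<lambda>\<theta>. cis (of_int k * \<theta>)) has_integral (?F (2 * pi) - ?F 0)) {0..2*pi}"
    proof (rule fundamental_theorem_of_calculus)
      fix x :: real
      have "((\<lambda>\<theta>. cis (of_int k * \<theta>)) has_vector_derivative (of_int k *\<^sub>R (\<i> * cis (of_int k * x))))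
        (at x within {0..2*pi})"
      proof -
        have "((\<lambda>z. exp (\<i> * (of_int k * z))) has_field_derivative
          of_int k * (\<i> * exp (\<i> * (of_int k * of_real x)))) (at (of_real x))"
          by (auto intro!: derivative_eq_intros)
        from has_vector_derivative_real_field[OF this] show ?thesis
          by (simp add: cis_conv_exp scaleR_conv_of_real)
      qed
      then have "(?F has_vector_derivative (of_int k *\<^sub>R (\<i> * cis (of_int k * x)) / (\<i> * of_int k)))
        (at x within {0..2*pi})"
        by (rule has_vector_derivative_divide)
      then show "(?F has_vector_derivative cis (of_int k * x)) (at x within {0..2*pi})"
        using False by (simp add: scaleR_conv_of_real)
    qed auto
    moreover have "cis (of_int k * (2 * pi)) = 1"
      using cis_multiple_2pi[of "of_int k"] by (simp add: mult_ac)
    ultimately show ?thesis using False by (simp add: integral_unique)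
  qed
  finally show ?thesis .
qed

lemma integral_cis_power_series:
  fixes \<beta> :: "nat \<Rightarrow> complex"
  assumes "summable (\<lambda>k. norm (\<beta> k))"
  shows "(\<integral>\<theta>. cis (of_int j * \<theta>) * (\<Sum>k. \<beta> k * cis \<theta> ^ k) \<partial>d\<theta>)
      = (if j \<le> 0 then of_real (2 * pi) * \<beta> (nat (- j)) else 0)"
    and "integrable d\<theta> (\<lambda>\<theta>. cis (of_int j * \<theta>) * (\<Sum>k. \<beta> k * cis \<theta> ^ k))"
proof -
  let ?f = "\<lambda>k \<theta>. \<beta> k * cis (of_int (j + int k) * \<theta>)"
  have [measurable]: "(\<lambda>\<theta>. cis (of_int i * \<theta>)) \<in> borel_measurable d\<theta>" for i
    by (auto intro!: borel_measurable_dtheta_continuous continuous_intros)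
  have int: "integrable d\<theta> (?f k)" for k
    by (rule integrable_dtheta_bounded[where B = "norm (\<beta> k)"])
      (auto intro!: borel_measurable_dtheta_continuous continuous_intros simp: norm_mult)
  have norm_int: "(\<integral>\<theta>. norm (?f k \<theta>) \<partial>d\<theta>) = 2 * pi * norm (\<beta> k)" for k
    by (simp add: norm_mult measure_restrict_space)
  have summ: "AE \<theta> in d\<theta>. summable (\<lambda>k. norm (?f k \<theta>))"
    "summable (\<lambda>k. \<integral>\<theta>. norm (?f k \<theta>) \<partial>d\<theta>)"
    using assms by (auto simp: norm_int norm_mult)
  have eq: "cis (of_int j * \<theta>) * (\<Sum>k. \<beta> k * cis \<theta> ^ k) = (\<Sum>k. ?f k \<theta>)" for \<theta>
  proof -
    have "summable (\<lambda>k. \<beta> k * cis \<theta> ^ k)"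
      using assms by (intro summable_norm_cancel[of "\<lambda>k. \<beta> k * cis \<theta> ^ k"]) (simp add: norm_mult norm_power)
    then show ?thesis
      by (simp add: suminf_mult[symmetric] Complex.DeMoivre cis_mult mult.left_commute ring_distribs)
  qed
  show "integrable d\<theta> (\<lambda>\<theta>. cis (of_int j * \<theta>) * (\<Sum>k. \<beta> k * cis \<theta> ^ k))"
    unfolding eq by (rule integrable_suminf[OF int summ])
  have "(\<integral>\<theta>. cis (of_int j * \<theta>) * (\<Sum>k. \<beta> k * cis \<theta> ^ k) \<partial>d\<theta>) = (\<Sum>k. integral\<^sup>L d\<theta> (?f k))"
    unfolding eq by (rule integral_suminf[OF int summ])
  also have "\<dots> = (\<Sum>k. if k = nat (-j) then (if j \<le> 0 then of_real (2 * pi) * \<beta> (nat (- j)) else 0) else 0)"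
  proof (intro suminf_cong)
    fix k
    have "integral\<^sup>L d\<theta> (?f k) = \<beta> k * (if j + int k = 0 then of_real (2 * pi) else 0)"
      by (simp only: integral_mult_right_zero integral_cis_int)
    then show "integral\<^sup>L d\<theta> (?f k)
      = (if k = nat (-j) then (if j \<le> 0 then of_real (2 * pi) * \<beta> (nat (- j)) else 0) else 0)"
      by (cases "j + int k = 0") (auto simp del: of_int_add)
  qed
  also have "\<dots> = (if j \<le> 0 then of_real (2 * pi) * \<beta> (nat (- j)) else 0)"
    by (subst suminf_finite[where N = "{nat (-j)}"]) auto
  finally show "(\<integral>\<theta>. cis (of_int j * \<theta>) * (\<Sum>k. \<beta> k * cis \<theta> ^ k) \<partial>d\<theta>)
      = (if j \<le> 0 then of_real (2 * pi) * \<beta> (nat (- j)) else 0)" .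
qed

lemma holomorphic_circle_power_series:
  assumes f: "f holomorphic_on ball 0 r" and r: "1 < r"
  shows "summable (\<lambda>k. norm ((deriv ^^ k) f 0 / fact k))"
    and "(\<lambda>k. (deriv ^^ k) f 0 / fact k * cis \<theta> ^ k) sums f (cis \<theta>)"
proof -
  let ?\<beta> = "\<lambda>k. (deriv ^^ k) f 0 / fact k"
  have sums: "(\<lambda>k. ?\<beta> k * z ^ k) sums f z" if "z \<in> ball 0 r" for z
    using holomorphic_power_series[OF f that] by simp
  show "(\<lambda>k. ?\<beta> k * cis \<theta> ^ k) sums f (cis \<theta>)"
    using r by (intro sums) simp
  have "summable (\<lambda>k. norm (?\<beta> k * 1 ^ k))"
  proof (rule powser_insidea)
    have "cmod (of_real ((1 + r) / 2)) = (1 + r) / 2"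
      using r by (subst norm_of_real) simp
    then show "cmod 1 < cmod (of_real ((1 + r) / 2))"
      and "summable (\<lambda>k. ?\<beta> k * of_real ((1 + r) / 2) ^ k)"
      using r sums[of "of_real ((1 + r) / 2)", THEN sums_summable] by simp_all
  qed
  then show "summable (\<lambda>k. norm (?\<beta> k))" by simp
qed

lemma mean_value_circle:
  assumes f: "f holomorphic_on ball 0 r" and r: "1 < r"
  shows "(\<integral>\<theta>. f (cis \<theta>) \<partial>d\<theta>) = of_real (2 * pi) * f 0"
proof -
  note power_series = holomorphic_circle_power_series[OF f r]
  have "(\<integral>\<theta>. f (cis \<theta>) \<partial>d\<theta>) = of_real (2 * pi) * ((deriv ^^ 0) f 0 / fact 0)"
    using integral_cis_power_series(1)[OF power_series(1), of 0]
    by (simp add: sums_unique[OF power_series(2)])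
  then show ?thesis by simp
qed

lemma has_fps_expansion_poly: "poly p has_fps_expansion fps_of_poly p" for p :: "complex poly"
proof (induction p)
  case 0
  then show ?case by (simp add: has_fps_expansion_0 poly_0[abs_def])
next
  case (pCons a p)
  have "(\<lambda>x. a + x * poly p x) has_fps_expansion fps_const a + fps_X * fps_of_poly p"
    by (intro fps_expansion_intros pCons)
  then show ?case by (simp add: fps_of_poly_pCons mult.commute)
qed

lemma zero_free_ball:
  fixes p :: "complex poly"
  assumes "\<And>z. cmod z \<le> 1 \<Longrightarrow> poly p z \<noteq> 0"
  obtains r where "1 < r" "\<And>z. z \<in> ball 0 r \<Longrightarrow> poly p z \<noteq> 0"
proof (cases "{z. poly p z = 0} = {}")
  case True
  then show ?thesis by (intro that[of 2]) auto
next
  case False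
  have "p \<noteq> 0" using assms[of 0] by auto
  then have fin: "finite (cmod ` {z. poly p z = 0})"
    by (simp add: poly_roots_finite)
  show ?thesis
  proof (rule that[of "Min (cmod ` {z. poly p z = 0})"])
    show "1 < Min (cmod ` {z. poly p z = 0})"
      using fin False assms by (subst Min_gr_iff) (auto simp: not_le[symmetric])
    show "poly p z \<noteq> 0" if "z \<in> ball 0 (Min (cmod ` {z. poly p z = 0}))" for z
      using that fin False Min_le[OF fin, of "cmod z"] by (auto simp: not_le[symmetric])
  qed
qed

text \<open>For \<open>l > 0\<close> and \<open>poly p 0 \<noteq> 0\<close>, the \<open>l\<close>-th Taylor coefficient at \<open>0\<close> of \<open>log p\<close>, read off
  the logarithmic derivative. For \<open>l = 0\<close> division by zero gives \<open>0\<close>, which is the correct value when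
  \<open>poly p 0 = 1\<close>.\<close>

definition log_coeff :: "complex poly \<Rightarrow> nat \<Rightarrow> complex" where
  "log_coeff p l = fps_nth (fps_of_poly (pderiv p) / fps_of_poly p) (l - 1) / of_nat l"

lemma log_poly_expansion:
  fixes p :: "complex poly"
  assumes nz: "\<And>z. cmod z \<le> 1 \<Longrightarrow> poly p z \<noteq> 0" and p0: "poly p 0 = 1"
  shows "summable (\<lambda>k. norm (log_coeff p k))"
    and "ln (cmod (poly p (cis \<theta>))) = Re (\<Sum>k. log_coeff p k * cis \<theta> ^ k)"
proof -
  obtain r where r: "1 < r" and nzr: "\<And>z. z \<in> ball 0 r \<Longrightarrow> poly p z \<noteq> 0"
    using zero_free_ball[OF nz] by blast
  \<comment> \<open>A holomorphic logarithm on a disc of radius larger than 1 makes its Taylor series absolutely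
    convergent on the circle.\<close>
  obtain g where g: "g holomorphic_on ball 0 r" "\<And>z. z \<in> ball 0 r \<Longrightarrow> exp (g z) = poly p z"
    by (rule holomorphic_logarithm_exists[of "ball 0 r" "poly p" 0])
      (use nzr r in \<open>auto intro!: holomorphic_intros\<close>)
  define G where "G = fps_expansion g 0"
  have Gexp: "g has_fps_expansion G"
    unfolding G_def using r by (intro has_fps_expansion_fps_expansion[OF open_ball _ g(1)]) auto
  have dexp: "deriv g has_fps_expansion fps_deriv G"
    by (rule has_fps_expansion_deriv[OF Gexp])
  have "(\<lambda>z. deriv g z * poly p z) has_fps_expansion fps_deriv G * fps_of_poly p"
    by (intro has_fps_expansion_mult dexp has_fps_expansion_poly)
  moreover have "deriv g z * poly p z = poly (pderiv p) z" if "z \<in> ball 0 r" for z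
  proof -
    have "(g has_field_derivative deriv g z) (at z)"
      using g(1) that by (intro holomorphic_derivI[of g "ball 0 r"]) auto
    then have "((\<lambda>z. exp (g z)) has_field_derivative exp (g z) * deriv g z) (at z)"
      by (auto intro!: derivative_eq_intros)
    moreover have "eventually (\<lambda>w. exp (g w) = poly p w) (nhds z)"
      using eventually_nhds_in_open[OF open_ball that] by eventually_elim (rule g(2))
    ultimately have "(poly p has_field_derivative exp (g z) * deriv g z) (at z)"
      by (subst (asm) DERIV_cong_ev[OF refl _ refl])
    then show ?thesis
      using DERIV_unique[OF poly_DERIV] g(2)[OF that] by (metis mult.commute)
  qed
  then have "eventually (\<lambda>z. deriv g z * poly p z = poly (pderiv p) z) (nhds 0)"
    using eventually_nhds_in_open[OF open_ball, of 0 0 r] r by (auto elim!: eventually_mono)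
  ultimately have "poly (pderiv p) has_fps_expansion fps_deriv G * fps_of_poly p"
    by (subst (asm) has_fps_expansion_cong[OF _ refl])
  then have "fps_deriv G * fps_of_poly p = fps_of_poly (pderiv p)"
    using fps_expansion_unique_complex has_fps_expansion_poly by blast
  then have dG: "fps_deriv G = fps_of_poly (pderiv p) / fps_of_poly p"
  proof -
    have "fps_nth (fps_of_poly p) 0 = 1"
      using p0 by (simp add: poly_0_coeff_0)
    then have "fps_of_poly p \<noteq> 0" by auto
    then show ?thesis
      using \<open>fps_deriv G * fps_of_poly p = fps_of_poly (pderiv p)\<close>
      by (metis nonzero_mult_div_cancel_right)
  qed
  have coeff: "log_coeff p k = fps_nth G k" if "k > 0" for k
    using that by (cases k) (simp_all add: log_coeff_def dG[symmetric] del: of_nat_Suc)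
  have G_nth: "fps_nth G k = (deriv ^^ k) g 0 / fact k" for k
    by (simp add: G_def fps_expansion_def)
  note power_series = holomorphic_circle_power_series[OF g(1) r(1), folded G_nth]
  have G0: "exp (fps_nth G 0) = 1"
    using g(2)[of 0] r p0 by (simp add: G_nth)
  then have ReG0: "Re (fps_nth G 0) = 0"
    by (auto simp: exp_eq_1)
  show "summable (\<lambda>k. norm (log_coeff p k))"
    by (rule summable_comparison_test'[OF power_series(1), of 1]) (simp add: coeff)
  have sl: "(\<lambda>k. log_coeff p k * cis \<theta> ^ k) sums (g (cis \<theta>) - fps_nth G 0)"
  proof -
    have "(\<lambda>k. fps_nth G k * cis \<theta> ^ k - (if k = 0 then fps_nth G 0 else 0)) sums (g (cis \<theta>) - fps_nth G 0)"
      by (intro sums_diff power_series(2) sums_single[of 0 "\<lambda>_. fps_nth G 0"])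
    moreover have "fps_nth G k * cis \<theta> ^ k - (if k = 0 then fps_nth G 0 else 0) = log_coeff p k * cis \<theta> ^ k" for k
      by (cases "k = 0") (simp_all add: coeff log_coeff_def[of p 0])
    ultimately show ?thesis by simp
  qed
  have "cmod (poly p (cis \<theta>)) = exp (Re (g (cis \<theta>)))"
  proof -
    have "cis \<theta> \<in> ball 0 r" using r by simp
    from g(2)[OF this, symmetric] show ?thesis by (simp add: norm_exp_eq_Re)
  qed
  then show "ln (cmod (poly p (cis \<theta>))) = Re (\<Sum>k. log_coeff p k * cis \<theta> ^ k)"
    using ReG0 by (simp flip: sums_unique[OF sl])
qed

lemma norm_trig_poly_square:
  "complex_of_real ((cmod (\<Sum>m\<le>N. q m * cis \<theta> ^ m))\<^sup>2)
     = (\<Sum>m\<le>N. \<Sum>m'\<le>N. q m * cnj (q m') * cis (of_int (int m - int m') * \<theta>))"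
proof -
  have "q m * cis \<theta> ^ m * cnj (q m' * cis \<theta> ^ m') = q m * cnj (q m') * cis (of_int (int m - int m') * \<theta>)" for m m'
  proof -
    have "cis \<theta> ^ m * cnj (cis \<theta> ^ m') = cis (of_int (int m - int m') * \<theta>)"
      by (simp only: Complex.DeMoivre cis_cnj cis_mult) (simp add: algebra_simps)
    then show ?thesis by (simp add: mult_ac)
  qed
  then show ?thesis
    unfolding complex_norm_square cnj_sum sum_product by (simp only:)
qed

text \<open>No diagonal terms occur because the constant Taylor coefficient of \<open>log p\<close> vanishes; the terms
  with \<open>m > m'\<close> are accounted for by the real part.\<close>

lemma integral_trig_poly_ln:
  fixes p :: "complex poly"
  assumes nz: "\<And>z. cmod z \<le> 1 \<Longrightarrow> poly p z \<noteq> 0" and p0: "poly p 0 = 1"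
  shows "(\<integral>\<theta>. (cmod (\<Sum>m\<le>N. q m * cis \<theta> ^ m))\<^sup>2 * ln (cmod (poly p (cis \<theta>))) \<partial>d\<theta>)
    = 2 * pi * Re (\<Sum>m\<le>N. \<Sum>m'\<le>N. if m < m' then q m * cnj (q m') * log_coeff p (m' - m) else 0)"
proof -
  let ?F = "\<lambda>\<theta>. \<Sum>k. log_coeff p k * cis \<theta> ^ k"
  note s = log_poly_expansion(1)[OF nz p0]
  have eq: "complex_of_real ((cmod (\<Sum>m\<le>N. q m * cis \<theta> ^ m))\<^sup>2) * ?F \<theta>
    = (\<Sum>m\<le>N. \<Sum>m'\<le>N. (q m * cnj (q m')) * (cis (of_int (int m - int m') * \<theta>) * ?F \<theta>))" for \<theta>
    unfolding norm_trig_poly_square sum_distrib_right by (simp add: mult_ac)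
  have "has_bochner_integral d\<theta> (\<lambda>\<theta>. complex_of_real ((cmod (\<Sum>m\<le>N. q m * cis \<theta> ^ m))\<^sup>2) * ?F \<theta>)
    (\<Sum>m\<le>N. \<Sum>m'\<le>N. (q m * cnj (q m')) * (if int m - int m' \<le> 0 then
         of_real (2 * pi) * log_coeff p (nat (- (int m - int m'))) else 0))"
    unfolding eq
  proof (intro has_bochner_integral_sum has_bochner_integral_mult_right)
    fix m m' :: nat
    show "has_bochner_integral d\<theta> (\<lambda>\<theta>. cis (of_int (int m - int m') * \<theta>) * ?F \<theta>)
      (if int m - int m' \<le> 0 then of_real (2 * pi) * log_coeff p (nat (- (int m - int m'))) else 0)"
      using integral_cis_power_series[OF s, of "int m - int m'"]
      by (simp only: has_bochner_integral_iff)
  qed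
  then have int: "integrable d\<theta> (\<lambda>\<theta>. complex_of_real ((cmod (\<Sum>m\<le>N. q m * cis \<theta> ^ m))\<^sup>2) * ?F \<theta>)"
    and "(\<integral>\<theta>. complex_of_real ((cmod (\<Sum>m\<le>N. q m * cis \<theta> ^ m))\<^sup>2) * ?F \<theta> \<partial>d\<theta>)
    = (\<Sum>m\<le>N. \<Sum>m'\<le>N. (q m * cnj (q m')) * (if int m - int m' \<le> 0 then
         of_real (2 * pi) * log_coeff p (nat (- (int m - int m'))) else 0))"
    by (auto simp only: has_bochner_integral_iff)
  note this(2)
  also have "\<dots> = (\<Sum>m\<le>N. \<Sum>m'\<le>N. of_real (2 * pi) *
      (if m < m' then q m * cnj (q m') * log_coeff p (m' - m) else 0))"
  proof (intro sum.cong refl)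
    fix m m' :: nat
    consider "m < m'" | "m = m'" | "m > m'" by linarith
    then show "(q m * cnj (q m')) * (if int m - int m' \<le> 0 then
         of_real (2 * pi) * log_coeff p (nat (- (int m - int m'))) else 0)
       = of_real (2 * pi) * (if m < m' then q m * cnj (q m') * log_coeff p (m' - m) else 0)"
    proof cases
      case 1
      then have "nat (- (int m - int m')) = m' - m" by simp
      with 1 show ?thesis by simp
    qed (simp_all add: log_coeff_def)
  qed
  finally have "(\<integral>\<theta>. complex_of_real ((cmod (\<Sum>m\<le>N. q m * cis \<theta> ^ m))\<^sup>2) * ?F \<theta> \<partial>d\<theta>)
    = of_real (2 * pi) * (\<Sum>m\<le>N. \<Sum>m'\<le>N. (if m < m' then q m * cnj (q m') * log_coeff p (m' - m) else 0))"
    by (simp only: sum_distrib_left)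
  then have "Re (\<integral>\<theta>. complex_of_real ((cmod (\<Sum>m\<le>N. q m * cis \<theta> ^ m))\<^sup>2) * ?F \<theta> \<partial>d\<theta>)
    = 2 * pi * Re (\<Sum>m\<le>N. \<Sum>m'\<le>N. (if m < m' then q m * cnj (q m') * log_coeff p (m' - m) else 0))"
    by (simp only: Re_complex_of_real Im_complex_of_real times_complex.simps)
  also have "Re (\<integral>\<theta>. complex_of_real ((cmod (\<Sum>m\<le>N. q m * cis \<theta> ^ m))\<^sup>2) * ?F \<theta> \<partial>d\<theta>)
    = (\<integral>\<theta>. Re (complex_of_real ((cmod (\<Sum>m\<le>N. q m * cis \<theta> ^ m))\<^sup>2) * ?F \<theta>) \<partial>d\<theta>)"
    by (rule integral_Re[symmetric, OF int])
  also have "\<dots> = (\<integral>\<theta>. (cmod (\<Sum>m\<le>N. q m * cis \<theta> ^ m))\<^sup>2 * ln (cmod (poly p (cis \<theta>))) \<partial>d\<theta>)"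
    by (simp add: log_poly_expansion(2)[OF nz p0] flip: of_real_power)
  finally show ?thesis .
qed

section \<open>The Szego recursion under fourth-power summability\<close>

lemma norm_diff_identity:
  fixes x y c :: complex
  shows "(cmod (x - c * y))\<^sup>2 - (cmod (y - cnj c * x))\<^sup>2
    = (1 - (cmod c)\<^sup>2) * ((cmod x)\<^sup>2 - (cmod y)\<^sup>2)"
proof -
  have "complex_of_real ((cmod (x - c * y))\<^sup>2 - (cmod (y - cnj c * x))\<^sup>2)
    = complex_of_real ((1 - (cmod c)\<^sup>2) * ((cmod x)\<^sup>2 - (cmod y)\<^sup>2))"
    unfolding of_real_diff of_real_mult complex_norm_square of_real_1
    by (simp add: algebra_simps)
  then show ?thesis by (simp only: of_real_eq_iff)
qed

lemma fps_nth_mult_X: "fps_nth (f * (fps_X * g)) k = (\<Sum>i<k. fps_nth f i * fps_nth g (k - 1 - i))"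
  for f g :: "complex fps"
proof -
  have "f * (fps_X * g) = fps_X * (f * g)" by (simp add: mult_ac)
  also have "fps_nth \<dots> k = (\<Sum>i<k. fps_nth f i * fps_nth g (k - 1 - i))"
    by (cases k) (simp_all add: fps_mult_nth[of f g] atLeast0AtMost lessThan_Suc_atMost)
  finally show ?thesis .
qed

lemma power4_convex: "(x / 2 + y) ^ 4 \<le> x ^ 4 / 2 + 8 * y ^ 4" for x y :: real
proof -
  have "(x / 2 + y)\<^sup>2 \<le> x\<^sup>2 / 2 + 2 * y\<^sup>2"
    using zero_le_power2[of "x / 2 - y"] by (simp add: power2_eq_square algebra_simps)
  then have "((x / 2 + y)\<^sup>2)\<^sup>2 \<le> (x\<^sup>2 / 2 + 2 * y\<^sup>2)\<^sup>2"
    by (intro power_mono) auto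
  also have "\<dots> \<le> (x\<^sup>2)\<^sup>2 / 2 + 8 * (y\<^sup>2)\<^sup>2"
    using zero_le_power2[of "x\<^sup>2 / 2 - 2 * y\<^sup>2"] by (simp add: power2_eq_square algebra_simps)
  finally show ?thesis by (simp flip: power_mult)
qed

text \<open>The Szego recursion on its own, for arbitrary coefficients in the open unit disc; \<open>R n\<close> plays
  the role of the reversed polynomial of \<open>P n\<close>.\<close>

locale szego_recursion =
  fixes a :: "nat \<Rightarrow> complex" and P R :: "nat \<Rightarrow> complex poly"
  assumes norm_a: "cmod (a n) < 1"
    and P_0: "P 0 = 1" and R_0: "R 0 = 1"
    and P_Suc: "P (Suc n) = pCons 0 (P n) - smult (cnj (a n)) (R n)"
    and R_Suc: "R (Suc n) = R n - smult (a n) (pCons 0 (P n))"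
begin

lemma poly_R_0: "poly (R n) 0 = 1"
  by (induction n) (simp_all add: R_0 R_Suc)

lemma R_zero_free:
  assumes "cmod z \<le> 1"
  shows "poly (R n) z \<noteq> 0 \<and> cmod (poly (P n) z) \<le> cmod (poly (R n) z)"
proof (induction n)
  case 0
  then show ?case by (simp add: P_0 R_0)
next
  case (Suc n)
  let ?x = "poly (R n) z" and ?y = "z * poly (P n) z"
  have y: "cmod ?y \<le> cmod ?x"
    using mult_mono[OF assms Suc.IH[THEN conjunct2]] by (simp add: norm_mult)
  have "cmod (a n * ?y) \<le> cmod (a n) * cmod ?x"
    using mult_left_mono[OF y, of "cmod (a n)"] by (simp add: norm_mult)
  also have "\<dots> < 1 * cmod ?x"
    using Suc.IH norm_a[of n] by (intro mult_strict_right_mono) auto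
  finally have "?x - a n * ?y \<noteq> 0" by auto
  moreover have "(cmod (?y - cnj (a n) * ?x))\<^sup>2 \<le> (cmod (?x - a n * ?y))\<^sup>2"
  proof -
    have "0 \<le> (1 - (cmod (a n))\<^sup>2) * ((cmod ?x)\<^sup>2 - (cmod ?y)\<^sup>2)"
      using norm_a[of n] y by (intro mult_nonneg_nonneg) (auto simp: power_le_one power_mono)
    then show ?thesis using norm_diff_identity[of ?x "a n" ?y] by linarith
  qed
  ultimately show ?case
    by (simp add: P_Suc R_Suc power2_le_iff_abs_le mult.left_commute)
qed

text \<open>The Taylor series at \<open>0\<close> of the finite Blaschke product \<open>P n / R n\<close>.\<close>

definition schur :: "nat \<Rightarrow> complex fps" where
  "schur n = fps_of_poly (P n) / fps_of_poly (R n)"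

text \<open>The Taylor series at \<open>0\<close> of the logarithmic derivative of \<open>R n\<close>.\<close>

definition log_deriv :: "nat \<Rightarrow> complex fps" where
  "log_deriv n = fps_of_poly (pderiv (R n)) / fps_of_poly (R n)"

lemma fps_R_unit: "fps_nth (fps_of_poly (R n)) 0 \<noteq> 0"
  using poly_R_0[of n] by (simp add: poly_0_coeff_0)

lemma fps_R_nz: "fps_of_poly (R n) \<noteq> 0"
  using fps_R_unit[of n] by auto

lemma schur_mult: "schur n * fps_of_poly (R n) = fps_of_poly (P n)"
  unfolding schur_def using fps_R_unit[of n]
  by (simp add: fps_divide_unit mult.assoc inverse_mult_eq_1)

lemma log_deriv_mult: "log_deriv n * fps_of_poly (R n) = fps_of_poly (pderiv (R n))"
  unfolding log_deriv_def using fps_R_unit[of n]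
  by (simp add: fps_divide_unit mult.assoc inverse_mult_eq_1)

lemma fps_R_Suc:
  "fps_of_poly (R (Suc n)) = fps_of_poly (R n) * (1 - fps_const (a n) * (fps_X * schur n))"
  by (simp add: R_Suc fps_of_poly_simps algebra_simps flip: schur_mult)

text \<open>The Schur recursion, cleared of denominators so that it can be compared coefficientwise.\<close>

lemma schur_Suc:
  "schur (Suc n) = fps_X * schur n - fps_const (cnj (a n))
     + fps_const (a n) * (schur (Suc n) * (fps_X * schur n))"
proof -
  have "fps_of_poly (R n) * (schur (Suc n) * (1 - fps_const (a n) * (fps_X * schur n)))
    = schur (Suc n) * fps_of_poly (R (Suc n))"
    by (simp add: fps_R_Suc mult_ac)
  also have "\<dots> = fps_of_poly (P (Suc n))"
    by (rule schur_mult)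
  also have "\<dots> = fps_of_poly (R n) * (fps_X * schur n - fps_const (cnj (a n)))"
    by (simp add: P_Suc fps_of_poly_simps algebra_simps flip: schur_mult)
  finally have "schur (Suc n) * (1 - fps_const (a n) * (fps_X * schur n))
    = fps_X * schur n - fps_const (cnj (a n))"
    using fps_R_nz[of n] by simp
  then show ?thesis by (simp add: algebra_simps)
qed

text \<open>The derivative of \<open>log (R (n+1)) - log (R n) = log (1 - a n z f n)\<close> with \<open>f n = P n / R n\<close>,
  again cleared of denominators.\<close>

lemma log_deriv_Suc:
  "log_deriv (Suc n) - log_deriv n = - (fps_const (a n) * fps_deriv (fps_X * schur n))
     + fps_const (a n) * ((log_deriv (Suc n) - log_deriv n) * (fps_X * schur n))"
proof -
  let ?T = "1 - fps_const (a n) * (fps_X * schur n)"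
  have "fps_of_poly (R n) * (log_deriv (Suc n) * ?T) = log_deriv (Suc n) * fps_of_poly (R (Suc n))"
    by (simp add: fps_R_Suc mult_ac)
  also have "\<dots> = fps_deriv (fps_of_poly (R n) * ?T)"
    by (simp add: log_deriv_mult fps_of_poly_pderiv flip: fps_R_Suc)
  also have "\<dots> = fps_of_poly (R n) * (log_deriv n * ?T - fps_const (a n) * fps_deriv (fps_X * schur n))"
    by (simp add: fps_of_poly_pderiv [symmetric] algebra_simps flip: log_deriv_mult)
  finally have "log_deriv (Suc n) * ?T
    = log_deriv n * ?T - fps_const (a n) * fps_deriv (fps_X * schur n)"
    using fps_R_nz[of n] by simp
  then show ?thesis by (simp add: algebra_simps)
qed

abbreviation schur_coeff :: "nat \<Rightarrow> nat \<Rightarrow> complex" where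
  "schur_coeff k n \<equiv> fps_nth (schur n) k"

lemma schur_coeff_0: "schur_coeff 0 (Suc n) = - cnj (a n)"
  by (subst schur_Suc) simp

lemma schur_coeff_Suc: "schur_coeff (Suc k) (Suc n) = schur_coeff k n + a n * (\<Sum>i\<le>k. schur_coeff i (Suc n) * schur_coeff (k - i) n)"
proof -
  have "fps_nth (schur (Suc n)) (Suc k) = fps_nth (fps_X * schur n - fps_const (cnj (a n))
     + fps_const (a n) * (schur (Suc n) * (fps_X * schur n))) (Suc k)"
    by (subst schur_Suc) simp
  also have "\<dots> = schur_coeff k n + a n * (\<Sum>i\<le>k. schur_coeff i (Suc n) * schur_coeff (k - i) n)"
    by (simp add: fps_nth_mult_X lessThan_Suc_atMost del: fps_mult_fps_X_commute)
  finally show ?thesis .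
qed

text \<open>The \<open>k\<close>-th coefficient gained by the logarithmic derivative in step \<open>n\<close>, which is \<open>k + 1\<close>
  times the gain of the \<open>(k + 1)\<close>-st Taylor coefficient of \<open>log (R n)\<close>.\<close>

definition log_incr :: "nat \<Rightarrow> nat \<Rightarrow> complex" where
  "log_incr k n = fps_nth (log_deriv (Suc n) - log_deriv n) k"

lemma log_incr_eq:
  "log_incr k n = - (of_nat (Suc k) * a n * schur_coeff k n) + a n * (\<Sum>i<k. log_incr i n * schur_coeff (k - 1 - i) n)"
proof -
  have "log_incr k n = fps_nth (- (fps_const (a n) * fps_deriv (fps_X * schur n))
     + fps_const (a n) * ((log_deriv (Suc n) - log_deriv n) * (fps_X * schur n))) k"
    unfolding log_incr_def by (subst log_deriv_Suc) simp
  also have "\<dots> = - (a n * (of_nat (Suc k) * schur_coeff k n)) + a n * (\<Sum>i<k. log_incr i n * schur_coeff (k - 1 - i) n)"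
    unfolding log_incr_def
    by (simp only: fps_add_nth fps_neg_nth fps_mult_left_const_nth fps_nth_mult_X
          fps_deriv_nth fps_mult_fps_X_commute[symmetric]) (simp add: fps_mult_fps_X_commute)
  finally show ?thesis by (simp add: mult_ac)
qed

text \<open>A positive sequence that dominates each \<open>\<bar>a n\<bar>\<close> and all earlier ones with geometrically
  decaying weights. Its value at \<open>n\<close> is at most twice that at \<open>n + 1\<close> (\<open>majorant_le_Suc\<close>), so the
  Taylor coefficients below can be compared with it without tracking which of the previous
  coefficients they involve; and it inherits fourth-power summability. The initial value \<open>1\<close> keeps it
  positive.\<close>

primrec majorant :: "nat \<Rightarrow> real" where
  "majorant 0 = 1"
| "majorant (Suc n) = majorant n / 2 + cmod (a n)"

declare majorant.simps(2) [simp del]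

lemma majorant_pos: "0 < majorant n"
  by (induction n) (auto intro: add_pos_nonneg simp: majorant.simps(2))

text \<open>Sequences of the order of the \<open>p\<close>-th power of the majorant, at the same index and at the next
  index. The second class is the one that contains \<open>a\<close>.\<close>

definition maj_order :: "nat \<Rightarrow> (nat \<Rightarrow> complex) set" where
  "maj_order p = O(\<lambda>n. complex_of_real (majorant n ^ p))"

definition maj_order_Suc :: "nat \<Rightarrow> (nat \<Rightarrow> complex) set" where
  "maj_order_Suc p = O(\<lambda>n. complex_of_real (majorant (Suc n) ^ p))"

lemma abs_majorant [simp]: "\<bar>majorant n\<bar> = majorant n"
  using majorant_pos[of n] by simp

lemma majorant_le_Suc: "majorant n \<le> 2 * majorant (Suc n)"
  by (simp add: majorant.simps(2))

lemma norm_coeff_le_majorant: "cmod (a n) \<le> majorant (Suc n)"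
  using majorant_pos[of n] by (simp add: majorant.simps(2))

lemma maj_order_imp_Suc: "f \<in> maj_order p \<Longrightarrow> f \<in> maj_order_Suc p"
  unfolding maj_order_def maj_order_Suc_def
proof (erule landau_o.big_trans, rule bigoI[where c = "2 ^ p"], intro always_eventually allI)
  fix n
  have "majorant n ^ p \<le> (2 * majorant (Suc n)) ^ p"
    using majorant_pos[of n] by (intro power_mono majorant_le_Suc) simp
  then show "norm (complex_of_real (majorant n ^ p)) \<le> 2 ^ p * norm (complex_of_real (majorant (Suc n) ^ p))"
    using majorant_pos[of n] majorant_pos[of "Suc n"] by (simp add: norm_power power_mult_distrib)
qed

lemma coeff_order_Suc: "a \<in> maj_order_Suc 1"
  unfolding maj_order_Suc_def using norm_coeff_le_majorant
  by (intro bigoI[where c = 1] always_eventually allI) simp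

lemma maj_order_Suc_mult: "f \<in> maj_order_Suc p \<Longrightarrow> g \<in> maj_order_Suc q \<Longrightarrow> (\<lambda>n. f n * g n) \<in> maj_order_Suc (p + q)"
  unfolding maj_order_Suc_def power_add of_real_mult by (rule landau_o.big.mult)

lemma maj_order_Suc_add: "f \<in> maj_order_Suc p \<Longrightarrow> g \<in> maj_order_Suc p \<Longrightarrow> (\<lambda>n. f n + g n) \<in> maj_order_Suc p"
  unfolding maj_order_Suc_def by (rule sum_in_bigo)

lemma maj_order_Suc_sum: "(\<And>i. i \<in> I \<Longrightarrow> f i \<in> maj_order_Suc p) \<Longrightarrow> (\<lambda>n. \<Sum>i\<in>I. f i n) \<in> maj_order_Suc p"
  unfolding maj_order_Suc_def by (rule big_sum_in_bigo)

lemma maj_order_Suc_minus_iff: "(\<lambda>n. - f n) \<in> maj_order_Suc p \<longleftrightarrow> f \<in> maj_order_Suc p"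
  unfolding maj_order_Suc_def by simp

lemma maj_order_shift: "(\<lambda>n. f (Suc n)) \<in> maj_order_Suc p \<Longrightarrow> f \<in> maj_order p"
  unfolding maj_order_def maj_order_Suc_def bigo_def
  using eventually_sequentially_Suc[of "\<lambda>n. norm (f n) \<le> C * norm (complex_of_real (majorant n ^ p))" for C]
  by auto

lemma majorant_le_2: "majorant n \<le> 2"
proof (induction n)
  case (Suc n)
  then show ?case using norm_a[of n] by (simp add: majorant.simps(2))
qed simp

lemma maj_order_Suc_mono: "q \<le> p \<Longrightarrow> f \<in> maj_order_Suc p \<Longrightarrow> f \<in> maj_order_Suc q"
  unfolding maj_order_Suc_def
proof (erule landau_o.big_trans, rule bigoI[where c = "2 ^ (p - q)"], intro always_eventually allI)
  fix n assume "q \<le> p"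
  have "majorant (Suc n) ^ p = majorant (Suc n) ^ (p - q) * majorant (Suc n) ^ q"
    using \<open>q \<le> p\<close> by (simp flip: power_add)
  also have "\<dots> \<le> 2 ^ (p - q) * majorant (Suc n) ^ q"
    using majorant_pos[of "Suc n"] majorant_le_2[of "Suc n"]
    by (intro mult_right_mono power_mono) simp_all
  finally show "norm (complex_of_real (majorant (Suc n) ^ p)) \<le> 2 ^ (p - q) * norm (complex_of_real (majorant (Suc n) ^ q))"
    using majorant_pos[of "Suc n"] by (simp add: norm_power)
qed

text \<open>By the recursion each coefficient is a previous one plus products of at least three small
  quantities.\<close>

lemma schur_coeff_order: "schur_coeff k \<in> maj_order 1"
proof (induction k rule: less_induct)
  case (less k)
  have "(\<lambda>n. schur_coeff k (Suc n)) \<in> maj_order_Suc 1"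
  proof (cases k)
    case 0
    have "(\<lambda>n. cnj (a n)) \<in> maj_order_Suc 1"
      using coeff_order_Suc by (simp add: maj_order_Suc_def bigo_def)
    then show ?thesis using 0 by (simp add: schur_coeff_0 maj_order_Suc_minus_iff)
  next
    case (Suc j)
    have prev: "schur_coeff i \<in> maj_order_Suc 1" "(\<lambda>n. schur_coeff i (Suc n)) \<in> maj_order_Suc 1" if "i \<le> j" for i
      using less.IH[of i] that Suc maj_order_imp_Suc[of "schur_coeff i" 1]
      by (auto intro!: landau_o.big.compose[OF _ filterlim_Suc] simp: maj_order_def maj_order_Suc_def)
    have "(\<lambda>n. schur_coeff i (Suc n) * schur_coeff (j - i) n) \<in> maj_order_Suc 1" if "i \<le> j" for i
      using maj_order_Suc_mult[OF prev(2)[of i] prev(1)[of "j - i"]] that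
      by (intro maj_order_Suc_mono[of 1 2]) (simp_all add: numeral_2_eq_2)
    then have "(\<lambda>n. \<Sum>i\<le>j. schur_coeff i (Suc n) * schur_coeff (j - i) n) \<in> maj_order_Suc 1"
      by (intro maj_order_Suc_sum) simp
    then have "(\<lambda>n. a n * (\<Sum>i\<le>j. schur_coeff i (Suc n) * schur_coeff (j - i) n)) \<in> maj_order_Suc 1"
      using maj_order_Suc_mult[OF coeff_order_Suc] by (intro maj_order_Suc_mono[of 1 2]) (simp_all add: numeral_2_eq_2)
    then show ?thesis unfolding Suc schur_coeff_Suc using prev(1)[of j] by (intro maj_order_Suc_add) simp_all
  qed
  then show ?case by (rule maj_order_shift)
qed

lemma schur_coeff_order_Suc: "schur_coeff i \<in> maj_order_Suc 1" "(\<lambda>n. schur_coeff i (Suc n)) \<in> maj_order_Suc 1"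
  using schur_coeff_order[of i] maj_order_imp_Suc[of "schur_coeff i" 1] by (auto intro!: landau_o.big.compose[OF _ filterlim_Suc] simp: maj_order_def maj_order_Suc_def)

text \<open>The coefficient of \<open>z\<^sup>k\<close> in \<open>P n / R n\<close> is \<open>- cnj (a (n-1-k))\<close> up to a cubic error: the
  recursion moves coefficients up by one and adds only products of three small quantities. The
  truncated subtraction is harmless, as the statement concerns large \<open>n\<close> only.\<close>

lemma schur_coeff_asymp: "(\<lambda>n. schur_coeff k n + cnj (a (n - Suc k))) \<in> maj_order 3"
proof (induction k)
  case 0
  have "(\<lambda>n. schur_coeff 0 (Suc n) + cnj (a (Suc n - Suc 0))) \<in> maj_order_Suc 3"
    by (simp add: schur_coeff_0 maj_order_Suc_def)
  then show ?case by (rule maj_order_shift)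
next
  case (Suc k)
  have "(\<lambda>n. schur_coeff i (Suc n) * schur_coeff (k - i) n) \<in> maj_order_Suc 2" for i
    using maj_order_Suc_mult[OF schur_coeff_order_Suc(2) schur_coeff_order_Suc(1)] by (simp add: numeral_2_eq_2)
  then have "(\<lambda>n. a n * (\<Sum>i\<le>k. schur_coeff i (Suc n) * schur_coeff (k - i) n)) \<in> maj_order_Suc (1 + 2)"
    by (intro maj_order_Suc_mult coeff_order_Suc maj_order_Suc_sum)
  then have "(\<lambda>n. (schur_coeff k n + cnj (a (n - Suc k))) + a n * (\<Sum>i\<le>k. schur_coeff i (Suc n) * schur_coeff (k - i) n)) \<in> maj_order_Suc 3"
    using maj_order_Suc_add[OF maj_order_imp_Suc[OF Suc.IH]] by (simp add: numeral_3_eq_3)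
  then have "(\<lambda>n. schur_coeff (Suc k) (Suc n) + cnj (a (Suc n - Suc (Suc k)))) \<in> maj_order_Suc 3"
    by (simp add: schur_coeff_Suc algebra_simps)
  then show ?case by (rule maj_order_shift)
qed

lemma log_incr_order: "log_incr k \<in> maj_order_Suc 2"
proof (induction k rule: less_induct)
  case (less k)
  have main: "(\<lambda>n. - (of_nat (Suc k) * a n * schur_coeff k n)) \<in> maj_order_Suc 2"
  proof -
    have "(\<lambda>n. of_nat (Suc k) * (a n * schur_coeff k n)) \<in> maj_order_Suc 2"
      using maj_order_Suc_mult[OF coeff_order_Suc schur_coeff_order_Suc(1)[of k]]
      by (simp add: maj_order_Suc_def numeral_2_eq_2 del: of_nat_Suc)
    then show ?thesis by (simp only: maj_order_Suc_minus_iff mult.assoc)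
  qed
  have "(\<lambda>n. log_incr i n * schur_coeff (k - 1 - i) n) \<in> maj_order_Suc 3" if "i < k" for i
    using maj_order_Suc_mult[OF less.IH[OF that] schur_coeff_order_Suc(1)] by (simp add: numeral_3_eq_3)
  then have "(\<lambda>n. a n * (\<Sum>i<k. log_incr i n * schur_coeff (k - 1 - i) n)) \<in> maj_order_Suc (1 + 3)"
    by (intro maj_order_Suc_mult coeff_order_Suc maj_order_Suc_sum) simp
  then have "(\<lambda>n. a n * (\<Sum>i<k. log_incr i n * schur_coeff (k - 1 - i) n)) \<in> maj_order_Suc 2"
    by (rule maj_order_Suc_mono[rotated]) simp
  from maj_order_Suc_add[OF main this] show ?case by (simp only: log_incr_eq [of k, symmetric])
qed

lemma log_incr_asymp: "(\<lambda>n. log_incr k n - of_nat (Suc k) * (a n * cnj (a (n - Suc k)))) \<in> maj_order_Suc 4"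
proof -
  have "(\<lambda>n. log_incr i n * schur_coeff (k - 1 - i) n) \<in> maj_order_Suc 3" for i
    using maj_order_Suc_mult[OF log_incr_order schur_coeff_order_Suc(1)] by (simp add: numeral_3_eq_3)
  then have 1: "(\<lambda>n. a n * (\<Sum>i<k. log_incr i n * schur_coeff (k - 1 - i) n)) \<in> maj_order_Suc (1 + 3)"
    by (intro maj_order_Suc_mult coeff_order_Suc maj_order_Suc_sum)
  have "(\<lambda>n. - of_nat (Suc k) * (a n * (schur_coeff k n + cnj (a (n - Suc k))))) \<in> maj_order_Suc (1 + 3)"
    using maj_order_Suc_mult[OF coeff_order_Suc maj_order_imp_Suc[OF schur_coeff_asymp]] by (simp add: maj_order_Suc_def)
  from maj_order_Suc_add[OF this 1] show ?thesis
    by (simp add: log_incr_eq [of k] algebra_simps)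
qed

lemma summable_majorant_power4:
  assumes "summable (\<lambda>n. cmod (a n) ^ 4)"
  shows "summable (\<lambda>n. majorant (Suc n) ^ 4)"
proof -
  have step: "(\<Sum>k<n. majorant k ^ 4) + 2 * majorant n ^ 4 \<le> 2 + 16 * (\<Sum>k<n. cmod (a k) ^ 4)" for n
  proof (induction n)
    case (Suc n)
    then show ?case using power4_convex[of "majorant n" "cmod (a n)"] by (simp add: majorant.simps(2))
  qed simp
  have partial: "(\<Sum>k<n. cmod (a k) ^ 4) \<le> (\<Sum>k. cmod (a k) ^ 4)" for n
    by (rule sum_le_suminf[OF assms]) simp_all
  have nonneg: "0 \<le> majorant n ^ 4" for n
    using majorant_pos[of n] by simp
  have "(\<Sum>k<n. majorant k ^ 4) \<le> 2 + 16 * (\<Sum>k. cmod (a k) ^ 4)" for n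
    using step[of n] partial[of n] nonneg[of n] by linarith
  then have "summable (\<lambda>n. majorant n ^ 4)"
    by (rule summableI_nonneg_bounded[OF nonneg])
  then show ?thesis using summable_Suc_iff[of "\<lambda>n. majorant n ^ 4"] by blast
qed

text \<open>This is where fourth-power summability enters: the increments of the Taylor coefficients of
  \<open>log (R n)\<close> are quadratic up to a summable error.\<close>

lemma log_coeff_bounded:
  assumes "summable (\<lambda>n. cmod (a n) ^ 4)" "0 < l"
  shows "Bseq (\<lambda>n. log_coeff (R n) l - (\<Sum>j<n. a j * cnj (a (j - l))))"
proof -
  define e where "e n = log_coeff (R (Suc n)) l - log_coeff (R n) l - a n * cnj (a (n - l))" for n
  obtain k where k: "l = Suc k" using \<open>0 < l\<close> by (cases l) auto
  have "e = (\<lambda>n. (1 / of_nat l) * (log_incr k n - of_nat (Suc k) * (a n * cnj (a (n - Suc k)))))"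
    unfolding e_def log_coeff_def log_deriv_def[symmetric] log_incr_def k by (auto simp: fun_eq_iff field_simps simp del: of_nat_Suc)
  then have "e \<in> maj_order_Suc 4"
    using log_incr_asymp[of k] unfolding maj_order_Suc_def by (simp del: of_nat_Suc add: k)
  then have "(\<lambda>n. norm (e n)) \<in> O(\<lambda>n. majorant (Suc n) ^ 4)"
    unfolding maj_order_Suc_def bigo_def by (simp add: norm_power)
  then have "summable (\<lambda>n. norm (e n))"
  proof (rule summable_comparison_test_bigo[rotated])
    have "norm (majorant (Suc n) ^ 4) = majorant (Suc n) ^ 4" for n
      using majorant_pos[of "Suc n"] by (simp add: norm_power)
    then show "summable (\<lambda>n. norm (majorant (Suc n) ^ 4))"
      using summable_majorant_power4[OF assms(1)] by (simp only:)
  qed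
  then have "summable e"
    by (rule summable_norm_cancel)
  then have "convergent (\<lambda>n. log_coeff (R 0) l + (\<Sum>j<n. e j))"
    unfolding summable_iff_convergent by (rule convergent_add[OF convergent_const])
  moreover have "log_coeff (R 0) l + (\<Sum>j<n. e j) = log_coeff (R n) l - (\<Sum>j<n. a j * cnj (a (j - l)))" for n
  proof (induction n)
    case (Suc n)
    then show ?case unfolding e_def[of n] sum.lessThan_Suc by (simp add: algebra_simps)
  qed simp
  ultimately have "convergent (\<lambda>n. log_coeff (R n) l - (\<Sum>j<n. a j * cnj (a (j - l))))"
    by (simp only:)
  then show ?thesis by (rule convergent_imp_Bseq)
qed

end

section \<open>Orthogonal polynomials for measures on the circle\<close>

text \<open>Finite Borel measures carried by the unit circle.\<close>

locale circle_measure = finite_measure M for M :: "complex measure" +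
  assumes sets_eq [measurable_cong]: "sets M = sets borel"
    and null_off_circle: "emeasure M (- sphere 0 1) = 0"
begin

lemma AE_circle: "AE z in M. cmod z = 1"
  by (rule AE_I[where N = "- sphere 0 1"])
    (auto simp: null_off_circle sets_eq sets_eq_imp_space_eq[OF sets_eq])

lemma integrable_continuous:
  fixes f :: "complex \<Rightarrow> 'b::{banach, second_countable_topology}"
  assumes "continuous_on UNIV f"
  shows "integrable M f"
proof -
  have "continuous_on (sphere 0 1) f"
    using assms by (rule continuous_on_subset) simp
  then obtain B where "\<And>z. cmod z = 1 \<Longrightarrow> norm (f z) \<le> B"
    using bounded_on_circle by blast
  then have "AE z in M. norm (f z) \<le> B"
    by (intro eventually_mono[OF AE_circle]) auto
  then show ?thesis
    using borel_measurable_continuous_onI[OF assms] measurable_cong_sets[OF sets_eq refl]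
    by (intro integrable_const_bound) blast+
qed

text \<open>The \<open>L\<^sup>2(M)\<close> inner product of polynomials, conjugate-linear in the first argument.\<close>

definition ip :: "complex poly \<Rightarrow> complex poly \<Rightarrow> complex" where
  "ip p q = (\<integral>z. cnj (poly p z) * poly q z \<partial>M)"

lemma integrable_poly: "integrable M (\<lambda>z. cnj (poly p z) * poly q z)"
  by (intro integrable_continuous continuous_intros)

lemma ip_cong:
  assumes "\<And>z. cmod z = 1 \<Longrightarrow> cnj (poly p z) * poly q z = cnj (poly p' z) * poly q' z"
  shows "ip p q = ip p' q'"
  unfolding ip_def using AE_circle
  by (intro integral_cong_AE borel_measurable_integrable integrable_poly) (auto elim!: eventually_mono assms)

lemma ip_add_right: "ip p (q + r) = ip p q + ip p r"
  unfolding ip_def by (simp add: ring_distribs integrable_poly)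

lemma ip_diff_right: "ip p (q - r) = ip p q - ip p r"
  unfolding ip_def by (simp add: ring_distribs integrable_poly)

lemma ip_smult_right: "ip p (smult c q) = c * ip p q"
  unfolding ip_def by (simp add: mult.left_commute[of _ c] integrable_poly)

lemma ip_commute: "ip p q = cnj (ip q p)"
  unfolding ip_def by (subst Bochner_Integration.integral_cnj[symmetric]) (simp add: mult.commute)

lemma ip_add_left: "ip (p + q) r = ip p r + ip q r"
  by (metis ip_commute ip_add_right complex_cnj_add)

lemma ip_smult_left: "ip (smult c p) q = cnj c * ip p q"
  by (metis ip_commute ip_smult_right complex_cnj_mult)

lemma ip_zero_left [simp]: "ip 0 q = 0" and ip_zero_right [simp]: "ip p 0 = 0"
  by (simp_all add: ip_def)

lemma ip_sum_left: "ip (\<Sum>i\<in>I. f i) q = (\<Sum>i\<in>I. ip (f i) q)"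
  by (induction I rule: infinite_finite_induct) (simp_all add: ip_add_left)

lemma ip_sum_right: "ip q (\<Sum>i\<in>I. f i) = (\<Sum>i\<in>I. ip q (f i))"
  by (induction I rule: infinite_finite_induct) (simp_all add: ip_add_right)

lemma ip_shift: "ip (pCons 0 p) (pCons 0 q) = ip p q"
proof (rule ip_cong)
  fix z :: complex assume "cmod z = 1"
  then have "cnj z * z = 1" by (simp add: complex_norm_square[symmetric] mult.commute)
  then show "cnj (poly (pCons 0 p) z) * poly (pCons 0 q) z = cnj (poly p z) * poly q z"
    by (simp add: mult_ac)
qed

text \<open>On the circle, reversal is \<open>p \<mapsto> z\<^sup>n cnj p\<close>; it is an anti-unitary map.\<close>

lemma ip_reversed:
  assumes "degree p \<le> n" "degree q \<le> n"
  shows "ip (reversed_poly n p) (reversed_poly n q) = ip q p"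
proof (rule ip_cong)
  fix z :: complex assume z: "cmod z = 1"
  then have zz: "cnj z * z = 1" by (simp add: complex_norm_square[symmetric] mult.commute)
  then have "cnj z \<noteq> 0" by auto
  with zz have "1 / cnj z = z" by (simp add: field_simps)
  moreover have "cnj z ^ n * z ^ n = 1" using zz by (simp flip: power_mult_distrib)
  ultimately show "cnj (poly (reversed_poly n p) z) * poly (reversed_poly n q) z = cnj (poly q z) * poly p z"
    using z assms by (subst (1 2) poly_reversed_poly) (auto simp: mult_ac)
qed

lemma ip_self: "ip p p = of_real (\<integral>z. (cmod (poly p z))\<^sup>2 \<partial>M)"
  unfolding ip_def by (subst integral_complex_of_real[symmetric]) (simp add: complex_norm_square mult.commute flip: of_real_power)

end

lemma coeff_reversed_poly: "coeff (reversed_poly n p) i = (if i \<le> n then cnj (coeff p (n - i)) else 0)"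
proof -
  have "coeff (reversed_poly n p) i = (\<Sum>j\<le>n. if j = n - i \<and> i \<le> n then cnj (coeff p j) else 0)"
    unfolding reversed_poly_def coeff_sum by (intro sum.cong) auto
  also have "\<dots> = (if i \<le> n then cnj (coeff p (n - i)) else 0)"
    by (auto simp: sum.delta)
  finally show ?thesis .
qed

lemma degree_reversed_poly: "degree (reversed_poly n p) \<le> n"
  by (rule degree_le) (simp add: coeff_reversed_poly)

lemma reversed_poly_monom: "k \<le> n \<Longrightarrow> reversed_poly n (monom 1 k) = monom 1 (n - k)"
  by (rule poly_eqI) (auto simp: coeff_reversed_poly)

lemma reversed_szego_step:
  assumes "degree p \<le> n"
  shows "reversed_poly (Suc n) (pCons 0 p - smult (cnj a) (reversed_poly n p))
    = reversed_poly n p - smult a (pCons 0 p)"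
proof (rule poly_eqI)
  fix i
  consider "i = 0" | j where "i = Suc j" "j \<le> n" | j where "i = Suc j" "n < j"
    using not_le by (cases i) blast+
  then show "coeff (reversed_poly (Suc n) (pCons 0 p - smult (cnj a) (reversed_poly n p))) i
    = coeff (reversed_poly n p - smult a (pCons 0 p)) i"
  proof cases
    case 1
    then show ?thesis by (simp add: coeff_reversed_poly)
  next
    case 2
    then show ?thesis
    proof (cases "j = n")
      case False
      then obtain m where "n - j = Suc m" using 2 by (metis Suc_diff_Suc le_neq_implies_less)
      moreover from this have "n - Suc j = m" by simp
      ultimately show ?thesis using 2 by (auto simp: coeff_reversed_poly)
    qed (simp_all add: coeff_reversed_poly)
  next
    case 3
    then have "coeff p j = 0" using assms by (intro coeff_eq_0) simp
    with 3 show ?thesis by (auto simp: coeff_reversed_poly coeff_pCons split: nat.splits)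
  qed
qed

context circle_measure
begin

text \<open>\<open>p\<close> is the monic orthogonal polynomial of degree \<open>n\<close>, in terms of the inner product.\<close>

definition is_OP :: "nat \<Rightarrow> complex poly \<Rightarrow> bool" where
  "is_OP n p \<longleftrightarrow> degree p = n \<and> lead_coeff p = 1 \<and> (\<forall>k<n. ip (monom 1 k) p = 0)"

lemma is_OP_alt: "is_OP n p \<longleftrightarrow> degree p = n \<and> lead_coeff p = 1 \<and>
    (\<forall>k<n. (\<integral>z. cnj (z ^ k) * poly p z \<partial>M) = 0)"
  by (simp add: is_OP_def ip_def poly_monom)

lemma ip_orthogonal:
  assumes "\<forall>k<n. ip (monom 1 k) p = 0" "\<And>k. k \<ge> n \<Longrightarrow> coeff r k = 0"
  shows "ip r p = 0"
proof -
  have "r = (\<Sum>i\<le>degree r. smult (coeff r i) (monom 1 i))"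
    by (simp add: smult_monom poly_as_sum_of_monoms)
  then have "ip r p = (\<Sum>i\<le>degree r. cnj (coeff r i) * ip (monom 1 i) p)"
    by (metis (no_types, lifting) ip_sum_left ip_smult_left sum.cong)
  also have "\<dots> = 0"
    using assms by (intro sum.neutral ballI) (metis complex_cnj_zero mult_eq_0_iff not_le)
  finally show ?thesis .
qed

lemma ip_monom_OP:
  assumes "is_OP n p"
  shows "ip (monom 1 n) p = ip p p"
proof -
  have "ip (monom 1 n - p) p = 0"
    using assms unfolding is_OP_def
    by (intro ip_orthogonal[of n]) (auto simp: coeff_eq_0 le_less)
  then show ?thesis
    using ip_add_left[of "monom 1 n - p" p p] by simp
qed

lemma ip_monom_reversed:
  assumes "degree p \<le> n" "k \<le> n"
  shows "ip (monom 1 k) (reversed_poly n p) = cnj (ip (monom 1 (n - k)) p)"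
proof -
  have "ip (monom 1 k) (reversed_poly n p) = ip (reversed_poly n (monom 1 (n - k))) (reversed_poly n p)"
    using assms by (simp add: reversed_poly_monom)
  also have "\<dots> = ip p (monom 1 (n - k))"
    using assms by (intro ip_reversed) (auto intro: order.trans[OF degree_monom_le])
  finally show ?thesis using ip_commute by metis
qed

lemma ip_monom_Suc: "ip (monom 1 (Suc k)) (pCons 0 q) = ip (monom 1 k) q"
  using ip_shift[of "monom 1 k" q] by (simp add: monom_Suc)

text \<open>\<open>z p\<close> and the reversal of \<open>p\<close> are both orthogonal to \<open>z, \<dots>, z\<^sup>n\<close>; the coefficient \<open>a\<close> is
  chosen so that the combination is also orthogonal to \<open>1\<close>. This yields existence of the orthogonal
  polynomials and the recursion at once.\<close>

lemma szego_step_is_OP: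
  assumes p: "is_OP n p" and a: "cnj a * ip p p = ip 1 (pCons 0 p)"
  shows "is_OP (Suc n) (pCons 0 p - smult (cnj a) (reversed_poly n p))"
proof -
  let ?r = "pCons 0 p - smult (cnj a) (reversed_poly n p)"
  have deg: "degree p = n" "coeff p n = 1" using p by (auto simp: is_OP_def)
  then have "p \<noteq> 0" by auto
  have c: "coeff ?r (Suc n) = 1" using deg by (simp add: coeff_reversed_poly)
  have "degree ?r \<le> Suc n"
    using deg \<open>p \<noteq> 0\<close> degree_reversed_poly[of n p]
    by (intro degree_diff_le) (auto intro: order.trans[OF degree_smult_le])
  with c have d: "degree ?r = Suc n" by (metis le_antisym le_degree zero_neq_one)
  have "ip (monom 1 k) ?r = 0" if "k < Suc n" for k
  proof (cases k)
    case 0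
    have "ip 1 (reversed_poly n p) = cnj (ip p p)"
      using ip_monom_reversed[of p n 0] ip_monom_OP[OF p] deg by (simp add: monom_0 one_pCons)
    also have "cnj (ip p p) = ip p p" by (simp add: ip_self)
    finally show ?thesis using 0 a by (simp add: monom_0 one_pCons[symmetric] ip_diff_right ip_smult_right)
  next
    case (Suc j)
    then have "ip (monom 1 k) (reversed_poly n p) = cnj (ip (monom 1 (n - k)) p)"
      using that deg by (intro ip_monom_reversed) auto
    also have "\<dots> = 0" using p that Suc by (auto simp: is_OP_def)
    finally have 1: "ip (monom 1 k) (reversed_poly n p) = 0" .
    have "ip (monom 1 k) (pCons 0 p) = 0"
      unfolding Suc ip_monom_Suc using p that Suc by (auto simp: is_OP_def)
    with 1 show ?thesis by (simp add: ip_diff_right ip_smult_right)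
  qed
  with c d show ?thesis by (simp add: is_OP_def)
qed

lemma ip_monom_monom:
  "ip (monom 1 i) (monom 1 j) = (if i \<le> j then ip 1 (monom 1 (j - i)) else cnj (ip 1 (monom 1 (i - j))))"
proof -
  have *: "ip (monom 1 i) (monom 1 (i + k)) = ip 1 (monom 1 k)" for i k
    by (induction i) (simp_all add: monom_0 one_pCons ip_monom_Suc monom_Suc[of 1 "_ + _"])
  show ?thesis
  proof (cases "i \<le> j")
    case True
    then show ?thesis using *[of i "j - i"] by simp
  next
    case False
    then show ?thesis using *[of j "i - j"] ip_commute[of "monom 1 i"] by simp
  qed
qed

end

text \<open>The relations \<open>\<integral> P j dM = 0\<close> express each moment through the earlier ones.\<close>

lemma moments_determined:
  fixes P :: "nat \<Rightarrow> complex poly"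
  assumes M: "circle_measure M" and M': "circle_measure M'"
    and deg: "\<And>j. degree (P j) = j" "\<And>j. lead_coeff (P j) = 1"
    and ip: "\<And>j. 0 < j \<Longrightarrow> j \<le> n \<Longrightarrow> circle_measure.ip M 1 (P j) = 0"
      "\<And>j. 0 < j \<Longrightarrow> j \<le> n \<Longrightarrow> circle_measure.ip M' 1 (P j) = 0"
    and ip_1: "circle_measure.ip M 1 1 = circle_measure.ip M' 1 1"
    and "i \<le> n" "j \<le> n"
  shows "circle_measure.ip M (monom 1 i) (monom 1 j) = circle_measure.ip M' (monom 1 i) (monom 1 j)"
proof -
  interpret M: circle_measure M by fact
  interpret M': circle_measure M' by fact
  have "M.ip 1 (monom 1 j) = M'.ip 1 (monom 1 j)" if "j \<le> n" for j
    using that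
  proof (induction j rule: less_induct)
    case (less j)
    show ?case
    proof (cases "j = 0")
      case True
      then show ?thesis using ip_1 by (simp add: monom_0 one_pCons)
    next
      case False
      let ?r = "\<Sum>i<j. smult (coeff (P j) i) (monom 1 i)"
      have "P j = (\<Sum>i\<le>j. smult (coeff (P j) i) (monom 1 i))"
        using poly_as_sum_of_monoms[of "P j"] deg by (simp add: smult_monom)
      also have "\<dots> = ?r + monom 1 j"
        using deg[of j] by (simp add: lessThan_Suc_atMost[symmetric])
      finally have P: "P j = ?r + monom 1 j" .
      have "M.ip 1 ?r = M'.ip 1 ?r"
        unfolding M.ip_sum_right M'.ip_sum_right M.ip_smult_right M'.ip_smult_right
        using less by (intro sum.cong) auto
      moreover have "M.ip 1 ?r + M.ip 1 (monom 1 j) = 0" "M'.ip 1 ?r + M'.ip 1 (monom 1 j) = 0"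
        using ip[of j] False less.prems by (simp_all add: M.ip_add_right[symmetric] M'.ip_add_right[symmetric] P[symmetric])
      ultimately show ?thesis by (metis add_left_cancel)
    qed
  qed
  then show ?thesis
    using assms(8,9) by (simp add: M.ip_monom_monom M'.ip_monom_monom)
qed

section \<open>Bernstein-Szego approximation\<close>

lemma (in szego_recursion) shifted_P_eq:
  "smult (1 - of_real ((cmod (a n))\<^sup>2)) (pCons 0 (P n)) = P (Suc n) + smult (cnj (a n)) (R (Suc n))"
  unfolding P_Suc R_Suc complex_norm_square
  by (simp add: smult_diff_right smult_diff_left algebra_simps)

text \<open>The squared \<open>L\<^sup>2\<close> norm of the \<open>n\<close>-th monic orthogonal polynomial, see \<open>ip_P_P\<close> below.\<close>

definition (in szego_recursion) \<kappa> :: "nat \<Rightarrow> real" where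
  "\<kappa> n = (\<Prod>j<n. 1 - (cmod (a j))\<^sup>2)"

lemma (in szego_recursion) \<kappa>_pos: "0 < \<kappa> n"
  unfolding \<kappa>_def using norm_a by (intro prod_pos) (simp add: abs_square_less_1)

text \<open>The recursion can be run backwards: a measure for which \<open>P n\<close> is orthogonal to the lower
  powers, with the right norm, has all of \<open>P 0, \<dots>, P n\<close> as orthogonal polynomials.\<close>

lemma (in circle_measure) OP_downward:
  assumes S: "szego_recursion a P R"
    and R: "\<And>n. R n = reversed_poly n (P n)" and deg: "\<And>n. degree (P n) \<le> n"
    and top: "\<forall>k<n. ip (monom 1 k) (P n) = 0" "ip (monom 1 n) (P n) = of_real (szego_recursion.\<kappa> a n)"
    and "j \<le> n"
  shows "(\<forall>k<j. ip (monom 1 k) (P j) = 0) \<and> ip (monom 1 j) (P j) = of_real (szego_recursion.\<kappa> a j)"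
  using \<open>j \<le> n\<close>
proof (induction rule: inc_induct)
  case base
  then show ?case using top by simp
next
  case (step j)
  interpret szego_recursion a P R by fact
  let ?c = "1 - of_real ((cmod (a j))\<^sup>2) :: complex"
  have "(cmod (a j))\<^sup>2 < 1" using norm_a[of j] by (simp add: abs_square_less_1)
  then have c: "?c \<noteq> 0" by (metis eq_iff_diff_eq_0 less_irrefl of_real_1 of_real_eq_iff)
  have *: "?c * ip (monom 1 k) (P j) = ip (monom 1 (Suc k)) (P (Suc j))" if "k \<le> j" for k
  proof -
    have "?c * ip (monom 1 k) (P j) = ip (monom 1 (Suc k)) (smult ?c (pCons 0 (P j)))"
      by (simp only: ip_smult_right ip_monom_Suc)
    also have "\<dots> = ip (monom 1 (Suc k)) (P (Suc j))
       + cnj (a j) * cnj (ip (monom 1 (Suc j - Suc k)) (P (Suc j)))"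
      unfolding shifted_P_eq ip_add_right ip_smult_right R
      using that deg[of "Suc j"] by (subst ip_monom_reversed) auto
    also have "ip (monom 1 (Suc j - Suc k)) (P (Suc j)) = 0"
      using step.IH that by auto
    finally show ?thesis by simp
  qed
  have "ip (monom 1 k) (P j) = 0" if "k < j" for k
  proof -
    have "?c * ip (monom 1 k) (P j) = 0"
      using *[of k] that step.IH by simp
    then show ?thesis using c by (simp only: mult_eq_0_iff) simp
  qed
  moreover have "?c * ip (monom 1 j) (P j) = ?c * of_real (\<kappa> j)"
    using *[of j] step.IH by (simp add: \<kappa>_def mult.commute)
  ultimately show ?case using c by simp
qed

text \<open>Integration with respect to absolutely continuous measures on the circle.\<close>

lemma sets_ac [simp]: "sets (ac_circle_measure w) = sets borel"
  and space_ac [simp]: "space (ac_circle_measure w) = UNIV"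
  by (simp_all add: ac_circle_measure_def)

lemma nn_integral_ac:
  assumes [measurable]: "w \<in> borel_measurable d\<theta>" "f \<in> borel_measurable borel"
  shows "(\<integral>\<^sup>+z. f z \<partial>ac_circle_measure w) = (\<integral>\<^sup>+\<theta>. ennreal (w \<theta> / (2 * pi)) * f (cis \<theta>) \<partial>d\<theta>)"
  unfolding ac_circle_measure_def by (subst nn_integral_distr, simp, simp, subst nn_integral_density) simp_all

lemma integral_ac:
  fixes f :: "complex \<Rightarrow> 'b::{banach, second_countable_topology}"
  assumes [measurable]: "w \<in> borel_measurable d\<theta>" "f \<in> borel_measurable borel"
    and "\<And>\<theta>. \<theta> \<in> {0..<2*pi} \<Longrightarrow> 0 \<le> w \<theta>"
  shows "(\<integral>z. f z \<partial>ac_circle_measure w) = (\<integral>\<theta>. (w \<theta> / (2 * pi)) *\<^sub>R f (cis \<theta>) \<partial>d\<theta>)"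
    and "integrable (ac_circle_measure w) f \<longleftrightarrow> integrable d\<theta> (\<lambda>\<theta>. (w \<theta> / (2 * pi)) *\<^sub>R f (cis \<theta>))"
proof -
  have nn: "AE \<theta> in d\<theta>. 0 \<le> w \<theta> / (2 * pi)"
    using assms(3) by (intro AE_I2) auto
  show "(\<integral>z. f z \<partial>ac_circle_measure w) = (\<integral>\<theta>. (w \<theta> / (2 * pi)) *\<^sub>R f (cis \<theta>) \<partial>d\<theta>)"
    unfolding ac_circle_measure_def
    by (subst integral_distr, simp, simp, subst integral_density) (use nn in simp_all)
  show "integrable (ac_circle_measure w) f \<longleftrightarrow> integrable d\<theta> (\<lambda>\<theta>. (w \<theta> / (2 * pi)) *\<^sub>R f (cis \<theta>))"
    unfolding ac_circle_measure_def
    by (subst integrable_distr_eq, simp, simp, subst integrable_density) (use nn in simp_all)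
qed

lemma circle_measure_ac:
  assumes w: "w \<in> borel_measurable d\<theta>" and B: "\<And>\<theta>. w \<theta> \<le> B"
  shows "circle_measure (ac_circle_measure w)"
proof (intro circle_measure.intro finite_measureI circle_measure_axioms.intro)
  have "emeasure (ac_circle_measure w) (space (ac_circle_measure w)) = (\<integral>\<^sup>+z. 1 \<partial>ac_circle_measure w)"
    by simp
  also have "\<dots> = (\<integral>\<^sup>+\<theta>. ennreal (w \<theta> / (2 * pi)) * 1 \<partial>d\<theta>)"
    by (rule nn_integral_ac[OF w]) simp
  also have "\<dots> \<le> (\<integral>\<^sup>+\<theta>. ennreal (B / (2 * pi)) \<partial>d\<theta>)"
    using B by (intro nn_integral_mono) (auto intro!: ennreal_leI divide_right_mono)
  also have "\<dots> < \<infinity>"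
    by (simp add: emeasure_restrict_space ennreal_mult_less_top)
  finally show "emeasure (ac_circle_measure w) (space (ac_circle_measure w)) \<noteq> \<infinity>" by simp
  show "emeasure (ac_circle_measure w) (- sphere 0 1) = 0"
  proof -
    have "emeasure (ac_circle_measure w) (- sphere 0 1) = (\<integral>\<^sup>+z. indicator (- sphere 0 1) z \<partial>ac_circle_measure w)"
      by simp
    also have "\<dots> = (\<integral>\<^sup>+\<theta>. ennreal (w \<theta> / (2 * pi)) * indicator (- sphere 0 1) (cis \<theta>) \<partial>d\<theta>)"
      by (rule nn_integral_ac[OF w]) simp
    also have "\<dots> = 0" by simp
    finally show ?thesis .
  qed
qed simp

text \<open>A non-trivial probability measure on the circle, together with its orthogonal polynomials.\<close>

locale nontrivial_circle =
  fixes \<mu> :: "complex measure"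
  assumes nontrivial: "nontrivial_circle_measure \<mu>"

sublocale nontrivial_circle \<subseteq> circle_measure \<mu>
proof -
  have "prob_space \<mu>" and *: "sets \<mu> = sets borel" "emeasure \<mu> (- sphere 0 1) = 0"
    using nontrivial by (auto simp: nontrivial_circle_measure_def circle_prob_measure_def)
  then interpret prob_space \<mu> by simp
  show "circle_measure \<mu>" by unfold_locales (use * in auto)
qed

context nontrivial_circle
begin

lemma prob_space_mu: "prob_space \<mu>"
  using nontrivial by (auto simp: nontrivial_circle_measure_def circle_prob_measure_def)

lemma ip_1_1: "ip 1 1 = 1"
proof -
  interpret prob_space \<mu> by (rule prob_space_mu)
  show ?thesis by (simp add: ip_def prob_space)
qed

text \<open>If the integral vanished, \<open>\<mu>\<close> would be carried by the finite zero set of \<open>p\<close>.\<close>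

lemma ip_self_pos:
  assumes "p \<noteq> 0"
  shows "0 < (\<integral>z. (cmod (poly p z))\<^sup>2 \<partial>\<mu>)"
proof (rule ccontr)
  assume "\<not> ?thesis"
  moreover have "0 \<le> (\<integral>z. (cmod (poly p z))\<^sup>2 \<partial>\<mu>)" by simp
  ultimately have "(\<integral>z. (cmod (poly p z))\<^sup>2 \<partial>\<mu>) = 0" by linarith
  moreover have "integrable \<mu> (\<lambda>z. (cmod (poly p z))\<^sup>2)"
    by (intro integrable_continuous continuous_intros)
  ultimately have "AE z in \<mu>. (cmod (poly p z))\<^sup>2 = 0"
    by (subst (asm) integral_nonneg_eq_0_iff_AE) auto
  then have AE: "AE z in \<mu>. poly p z = 0" by simp
  have fin: "finite {z. poly p z = 0}" by (rule poly_roots_finite[OF assms])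
  then have op: "open (- {z. poly p z = 0})"
    by (simp add: finite_imp_closed open_Compl)
  have "emeasure \<mu> (- {z. poly p z = 0}) = 0"
    using emeasure_eq_0_AE[of "\<lambda>z. poly p z \<noteq> 0" \<mu>] AE sets_eq_imp_space_eq[OF sets_eq]
    by (simp add: Compl_eq)
  then have "measure_support \<mu> \<subseteq> {z. poly p z = 0}"
    unfolding measure_support_def using op by force
  then have "finite (measure_support \<mu>)" using fin by (rule finite_subset)
  then show False using nontrivial by (simp add: nontrivial_circle_measure_def)
qed

lemma ip_self_nz: "p \<noteq> 0 \<Longrightarrow> ip p p \<noteq> 0"
  using ip_self_pos[of p] by (simp add: ip_self)

lemma OP_exists: "\<exists>p. is_OP n p"
proof (induction n)
  case 0
  show ?case by (intro exI[of _ 1]) (simp add: is_OP_def)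
next
  case (Suc n)
  then obtain p where p: "is_OP n p" by blast
  then have "p \<noteq> 0" by (auto simp: is_OP_def)
  then have "cnj (cnj (ip 1 (pCons 0 p) / ip p p)) * ip p p = ip 1 (pCons 0 p)"
    using ip_self_nz by simp
  from szego_step_is_OP[OF p this] show ?case by blast
qed

lemma OP_unique:
  assumes "is_OP n p" "is_OP n r"
  shows "p = r"
proof (rule ccontr)
  assume "p \<noteq> r"
  have "\<forall>k<n. ip (monom 1 k) (p - r) = 0"
    using assms by (auto simp: is_OP_def ip_diff_right)
  moreover have "coeff (p - r) k = 0" if "k \<ge> n" for k
    using assms that by (cases "k = n") (auto simp: is_OP_def coeff_eq_0)
  ultimately have "ip (p - r) (p - r) = 0" by (rule ip_orthogonal)
  with \<open>p \<noteq> r\<close> show False using ip_self_nz[of "p - r"] by simp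
qed

lemma is_OP_monic_OP: "is_OP n (monic_OP \<mu> n)"
proof -
  have "\<exists>!p. is_OP n p" using OP_exists OP_unique by blast
  from theI'[OF this] show ?thesis
    unfolding monic_OP_def is_OP_alt .
qed

abbreviation P :: "nat \<Rightarrow> complex poly" where "P \<equiv> monic_OP \<mu>"
abbreviation R :: "nat \<Rightarrow> complex poly" where "R n \<equiv> reversed_poly n (P n)"

lemma P_0: "P 0 = 1"
  by (rule OP_unique[OF is_OP_monic_OP]) (simp add: is_OP_def)

lemma degree_P: "degree (P n) = n" and lead_coeff_P: "lead_coeff (P n) = 1"
  using is_OP_monic_OP[of n] unfolding is_OP_def by blast+

lemma P_nz: "P n \<noteq> 0"
  using lead_coeff_P[of n] by auto

lemma poly_R_0: "poly (R n) 0 = 1"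
  using lead_coeff_P[of n] by (simp add: poly_0_coeff_0 coeff_reversed_poly degree_P)

lemma verblunsky_eqI:
  assumes "\<And>z. poly (P (Suc n)) z = z * poly (P n) z - cnj a * poly (R n) z"
  shows "verblunsky \<mu> n = a"
  unfolding verblunsky_def
proof (rule the_equality)
  fix a'
  assume "\<forall>z. poly (P (Suc n)) z = z * poly (P n) z - cnj a' * poly (R n) z"
  from this[rule_format, of 0] assms[of 0] show "a' = a"
    by (simp add: poly_R_0)
qed (use assms in blast)

lemma P_Suc: "P (Suc n) = pCons 0 (P n) - smult (cnj (verblunsky \<mu> n)) (R n)"
proof -
  define a where "a = cnj (ip 1 (pCons 0 (P n)) / ip (P n) (P n))"
  have "cnj a * ip (P n) (P n) = ip 1 (pCons 0 (P n))"
    using ip_self_nz[OF P_nz] by (simp add: a_def)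
  from szego_step_is_OP[OF is_OP_monic_OP this]
  have eq: "P (Suc n) = pCons 0 (P n) - smult (cnj a) (R n)"
    by (rule OP_unique[OF is_OP_monic_OP])
  have "verblunsky \<mu> n = a"
    by (rule verblunsky_eqI) (simp add: eq)
  with eq show ?thesis by simp
qed

lemma ip_P_Suc: "ip (P (Suc n)) (P (Suc n)) = (1 - of_real ((cmod (verblunsky \<mu> n))\<^sup>2)) * ip (P n) (P n)"
proof -
  let ?a = "verblunsky \<mu> n"
  have orth: "ip (R n) (P (Suc n)) = 0"
    using is_OP_monic_OP[of "Suc n"] degree_reversed_poly[of n "P n"]
    by (intro ip_orthogonal[of "Suc n"]) (auto simp: is_OP_def coeff_eq_0)
  then have orth': "ip (P (Suc n)) (R n) = 0"
    by (subst ip_commute) simp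
  have "ip (P n) (P n) = ip (pCons 0 (P n)) (pCons 0 (P n))"
    by (simp add: ip_shift)
  also have "pCons 0 (P n) = P (Suc n) + smult (cnj ?a) (R n)"
    by (simp add: P_Suc)
  also have "ip \<dots> \<dots> = ip (P (Suc n)) (P (Suc n)) + ?a * cnj ?a * ip (R n) (R n)"
    by (simp add: ip_add_left ip_add_right ip_smult_left ip_smult_right orth orth')
  also have "ip (R n) (R n) = ip (P n) (P n)"
    by (simp add: ip_reversed degree_P)
  finally show ?thesis
    by (simp add: complex_norm_square algebra_simps flip: of_real_power)
qed

lemma norm_verblunsky: "cmod (verblunsky \<mu> n) < 1"
proof -
  let ?I = "\<lambda>n. \<integral>z. (cmod (poly (P n) z))\<^sup>2 \<partial>\<mu>"
  have "complex_of_real (?I (Suc n)) = complex_of_real ((1 - (cmod (verblunsky \<mu> n))\<^sup>2) * ?I n)"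
    using ip_P_Suc[of n] by (simp add: ip_self)
  then have "?I (Suc n) = (1 - (cmod (verblunsky \<mu> n))\<^sup>2) * ?I n"
    by (simp only: of_real_eq_iff)
  moreover have "0 < ?I (Suc n)" "0 < ?I n"
    by (simp_all only: ip_self_pos[OF P_nz])
  ultimately have "0 < 1 - (cmod (verblunsky \<mu> n))\<^sup>2"
    by (simp add: zero_less_mult_iff)
  then show ?thesis by (simp add: abs_square_less_1)
qed

sublocale szego_recursion "verblunsky \<mu>" P R
proof
  show "R 0 = 1" by (simp add: P_0 reversed_poly_def monom_0 one_pCons)
  show "R (Suc n) = R n - smult (verblunsky \<mu> n) (pCons 0 (P n))" for n
    unfolding P_Suc by (rule reversed_szego_step) (simp add: degree_P)
qed (fact norm_verblunsky P_0 P_Suc)+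

lemma ip_P_P: "ip (P n) (P n) = of_real (\<kappa> n)"
  by (induction n) (simp_all add: P_0 ip_1_1 \<kappa>_def ip_P_Suc mult.commute)

lemma norm_P_eq_norm_R: "cmod z = 1 \<Longrightarrow> cmod (poly (P n) z) = cmod (poly (R n) z)"
proof -
  assume z: "cmod z = 1"
  then have "z \<noteq> 0" and zz: "z * cnj z = 1" by (auto simp: complex_norm_square[symmetric])
  then have "1 / cnj z = z" by (simp add: field_simps)
  then show ?thesis
    using z \<open>z \<noteq> 0\<close> by (subst poly_reversed_poly) (simp_all add: degree_P norm_mult norm_power)
qed

text \<open>The Bernstein-Szego weight, normalised so that the associated measure, with respect to
  \<open>d\<theta>/2\<pi>\<close>, has mass \<open>1\<close>.\<close>

definition bs_weight :: "nat \<Rightarrow> real \<Rightarrow> real" where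
  "bs_weight n \<theta> = \<kappa> n / (cmod (poly (R n) (cis \<theta>)))\<^sup>2"

lemma poly_R_cis_nz: "poly (R n) (cis \<theta>) \<noteq> 0"
  using R_zero_free[of "cis \<theta>" n] by simp

lemma continuous_bs_weight: "continuous_on UNIV (bs_weight n)"
  unfolding bs_weight_def
  by (intro continuous_intros) (simp add: poly_R_cis_nz)

lemma bs_weight_pos: "0 < bs_weight n \<theta>"
  unfolding bs_weight_def using \<kappa>_pos poly_R_cis_nz by simp

lemma bs_weight_measurable [measurable]: "bs_weight n \<in> borel_measurable d\<theta>"
  by (rule borel_measurable_dtheta_continuous[OF continuous_bs_weight])

lemma bs_weight_bounded: "\<exists>B. \<forall>\<theta>. bs_weight n \<theta> \<le> B"
proof -
  have "continuous_on (sphere 0 1) (\<lambda>z. \<kappa> n / (cmod (poly (R n) z))\<^sup>2)"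
    using R_zero_free by (intro continuous_intros) auto
  then obtain B where "\<And>z. cmod z = 1 \<Longrightarrow> norm (\<kappa> n / (cmod (poly (R n) z))\<^sup>2) \<le> B"
    using bounded_on_circle by blast
  then have "norm (bs_weight n \<theta>) \<le> B" for \<theta>
    unfolding bs_weight_def by simp
  then show ?thesis by (intro exI[of _ B] allI) (metis abs_le_D1 real_norm_def)
qed

text \<open>The \<open>n\<close>-th Bernstein-Szego measure.\<close>

definition bs_measure :: "nat \<Rightarrow> complex measure" where
  "bs_measure n = ac_circle_measure (bs_weight n)"

lemma circle_measure_bs: "circle_measure (bs_measure n)"
  unfolding bs_measure_def using bs_weight_bounded[of n]
  by (auto intro: circle_measure_ac)

text \<open>On the circle \<open>P n = z\<^sup>n cnj (R n)\<close>, so the integrand is a constant times \<open>z\<^sup>n\<^sup>-\<^sup>k / R n\<close>, which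
  is holomorphic near the closed disc; the mean value property evaluates the integral.\<close>

lemma bs_ip_monom_P:
  assumes "k \<le> n"
  shows "circle_measure.ip (bs_measure n) (monom 1 k) (P n) = (if k = n then of_real (\<kappa> n) else 0)"
proof -
  interpret bs: circle_measure "bs_measure n" by (rule circle_measure_bs)
  obtain r where r: "1 < r" and nz: "\<And>z. z \<in> ball 0 r \<Longrightarrow> poly (R n) z \<noteq> 0"
    using zero_free_ball[of "R n"] R_zero_free by blast
  have "bs.ip (monom 1 k) (P n) = (\<integral>\<theta>. (bs_weight n \<theta> / (2 * pi)) *\<^sub>R (cnj (cis \<theta> ^ k) * poly (P n) (cis \<theta>)) \<partial>d\<theta>)"
    unfolding bs.ip_def unfolding bs_measure_def
    by (subst integral_ac(1))
      (auto simp: poly_monom less_imp_le[OF bs_weight_pos] intro!: borel_measurable_continuous_onI continuous_intros)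
  also have "\<dots> = (\<integral>\<theta>. of_real (\<kappa> n / (2 * pi)) * (cis \<theta> ^ (n - k) / poly (R n) (cis \<theta>)) \<partial>d\<theta>)"
  proof (intro Bochner_Integration.integral_cong refl)
    fix \<theta> :: real
    let ?z = "cis \<theta>" and ?r = "poly (R n) (cis \<theta>)"
    have zz: "?z * cnj ?z = 1" by (simp add: complex_norm_square[symmetric])
    then have "1 / cnj ?z = ?z" by (simp add: field_simps)
    then have rz: "?r = ?z ^ n * cnj (poly (P n) ?z)"
      by (subst poly_reversed_poly) (simp_all add: degree_P)
    have zn: "?z ^ m * cnj ?z ^ m = 1" for m
      using zz by (simp flip: power_mult_distrib)
    have "?z ^ n * cnj ?r = poly (P n) ?z"
      unfolding rz using zn[of n] by (simp add: mult_ac)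
    then have "cnj (?z ^ k) * poly (P n) ?z = cnj ?z ^ k * ?z ^ n * cnj ?r"
      by simp
    also have "?z ^ n = ?z ^ k * ?z ^ (n - k)"
      using assms by (simp flip: power_add)
    also have "cnj ?z ^ k * (?z ^ k * ?z ^ (n - k)) * cnj ?r = ?z ^ (n - k) * cnj ?r"
      using zn[of k] by (metis mult.assoc mult.commute mult_1)
    finally have "(bs_weight n \<theta> / (2 * pi)) *\<^sub>R (cnj (?z ^ k) * poly (P n) ?z)
      = of_real (\<kappa> n / (2 * pi)) * (?z ^ (n - k) * (cnj ?r / of_real ((cmod ?r)\<^sup>2)))"
      by (simp add: bs_weight_def scaleR_conv_of_real)
    also have "cnj ?r / of_real ((cmod ?r)\<^sup>2) = 1 / ?r"
      unfolding complex_norm_square using poly_R_cis_nz[of n \<theta>] by simp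
    finally show "(bs_weight n \<theta> / (2 * pi)) *\<^sub>R (cnj (?z ^ k) * poly (P n) ?z)
      = of_real (\<kappa> n / (2 * pi)) * (?z ^ (n - k) / ?r)" by simp
  qed
  also have "\<dots> = of_real (\<kappa> n / (2 * pi)) * (\<integral>\<theta>. cis \<theta> ^ (n - k) / poly (R n) (cis \<theta>) \<partial>d\<theta>)"
    by (rule integral_mult_right_zero)
  also have "(\<integral>\<theta>. cis \<theta> ^ (n - k) / poly (R n) (cis \<theta>) \<partial>d\<theta>) = of_real (2 * pi) * (0 ^ (n - k) / poly (R n) 0)"
    using nz by (intro mean_value_circle[OF _ r]) (auto intro!: holomorphic_intros)
  finally show ?thesis using assms by (simp add: poly_R_0)
qed

lemma bs_moments:
  assumes "i \<le> n" "j \<le> n"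
  shows "circle_measure.ip (bs_measure n) (monom 1 i) (monom 1 j) = ip (monom 1 i) (monom 1 j)"
proof -
  interpret bs: circle_measure "bs_measure n" by (rule circle_measure_bs)
  have down: "(\<forall>k<j. bs.ip (monom 1 k) (P j) = 0) \<and> bs.ip (monom 1 j) (P j) = of_real (\<kappa> j)" if "j \<le> n" for j
    by (rule bs.OP_downward[OF szego_recursion_axioms, of n])
      (use that in \<open>auto simp: degree_P bs_ip_monom_P\<close>)
  show ?thesis
  proof (rule moments_determined[where P = P and n = n])
    show "bs.ip 1 1 = ip 1 1"
      using down[of 0] by (simp add: P_0 monom_0 one_pCons[symmetric] ip_1_1 \<kappa>_def)
    show "bs.ip 1 (P j) = 0" if "0 < j" "j \<le> n" for j
      using down[OF that(2)] that by (auto simp: monom_0 one_pCons[symmetric] dest: spec[of _ 0])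
    show "ip 1 (P j) = 0" if "0 < j" for j
      using is_OP_monic_OP[of j] that by (auto simp: is_OP_def monom_0 one_pCons[symmetric] dest: spec[of _ 0])
  qed (use assms degree_P lead_coeff_P in \<open>auto intro: circle_measure_bs circle_measure_axioms\<close>)
qed

end

section \<open>Asymptotics of the weighted entropy of the approximants\<close>

lemma Bseq_plus:
  fixes f g :: "nat \<Rightarrow> 'a::real_normed_vector"
  assumes "Bseq f" "Bseq g"
  shows "Bseq (\<lambda>n. f n + g n)"
proof -
  obtain K L where "\<And>n. norm (f n) \<le> K" "\<And>n. norm (g n) \<le> L"
    using assms unfolding Bseq_def by blast
  then show ?thesis by (intro BseqI'[of _ "K + L"] norm_triangle_mono)
qed

lemma Bseq_cmult: "Bseq f \<Longrightarrow> Bseq (\<lambda>n. c * f n)" for f :: "nat \<Rightarrow> 'a::real_normed_field"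
  by (rule Bseq_mult) simp_all

lemma Bseq_sum:
  fixes f :: "'i \<Rightarrow> nat \<Rightarrow> 'a::real_normed_vector"
  assumes "\<And>i. i \<in> I \<Longrightarrow> Bseq (f i)"
  shows "Bseq (\<lambda>n. \<Sum>i\<in>I. f i n)"
  using assms by (induction I rule: infinite_finite_induct) (simp_all add: Bseq_plus)

lemma Bseq_Re: "Bseq f \<Longrightarrow> Bseq (\<lambda>n. Re (f n))"
  unfolding Bseq_def by (metis abs_Re_le_cmod order_trans real_norm_def)

text \<open>Shifting the summation index of a bounded sequence changes its partial sums only by boundary
  terms.\<close>

lemma Bseq_shift_sums:
  fixes y :: "nat \<Rightarrow> 'a::real_normed_vector"
  assumes "\<And>k. norm (y k) \<le> B"
  shows "Bseq (\<lambda>n. (\<Sum>k<n. y (k + m)) - (\<Sum>k<n. y k))"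
proof (rule BseqI')
  fix n
  have eq: "(\<Sum>k<n. y (k + m)) - (\<Sum>k<n. y k) = (\<Sum>i<m. y (n + i) - y i)"
  proof (induction n)
    case (Suc n)
    have "(\<Sum>i<m. y (Suc n + i) - y i) = (\<Sum>i<m. (y (n + Suc i) - y (n + i)) + (y (n + i) - y i))"
      by (intro sum.cong) simp_all
    also have "\<dots> = (y (n + m) - y n) + (\<Sum>i<m. y (n + i) - y i)"
      unfolding sum.distrib using sum_lessThan_telescope[of "\<lambda>i. y (n + i)" m] by simp
    finally show ?case using Suc by (simp add: algebra_simps)
  qed simp
  have "norm (y (n + i) - y i) \<le> B + B" for i
    using norm_triangle_ineq4[of "y (n + i)" "y i"] assms[of "n + i"] assms[of i] by linarith
  then have "norm (\<Sum>i<m. y (n + i) - y i) \<le> of_nat (card {..<m}) * (B + B)"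
    by (intro sum_norm_bound) auto
  then show "norm ((\<Sum>k<n. y (k + m)) - (\<Sum>k<n. y k)) \<le> of_nat m * (B + B)"
    unfolding eq by simp
qed

lemma norm_sum_square:
  fixes z :: "nat \<Rightarrow> complex"
  shows "(cmod (\<Sum>m\<le>N. z m))\<^sup>2
    = (\<Sum>m\<le>N. (cmod (z m))\<^sup>2) + 2 * Re (\<Sum>m\<le>N. \<Sum>m'\<le>N. if m < m' then cnj (z m) * z m' else 0)"
proof -
  have *: "(cmod (\<Sum>m<n. z m))\<^sup>2
    = (\<Sum>m<n. (cmod (z m))\<^sup>2) + 2 * Re (\<Sum>m<n. \<Sum>m'<n. if m < m' then cnj (z m) * z m' else 0)" for n
  proof (induction n)
    case (Suc n)
    let ?S = "\<Sum>m<n. z m"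
    have "(cmod (?S + z n))\<^sup>2 = (cmod ?S)\<^sup>2 + (cmod (z n))\<^sup>2 + 2 * Re (cnj ?S * z n)"
    proof -
      have "complex_of_real ((cmod (?S + z n))\<^sup>2)
        = complex_of_real ((cmod ?S)\<^sup>2 + (cmod (z n))\<^sup>2 + 2 * Re (cnj ?S * z n))"
        unfolding of_real_add complex_norm_square complex_add_cnj[symmetric]
        by (simp add: algebra_simps)
      then show ?thesis by (simp only: of_real_eq_iff)
    qed
    also have "cnj ?S * z n = (\<Sum>m<n. cnj (z m) * z n)"
      by (simp add: sum_distrib_right)
    finally show ?case using Suc by (simp add: sum.distrib)
  qed simp
  show ?thesis using *[of "Suc N"] by (simp only: lessThan_Suc_atMost)
qed

context nontrivial_circle
begin

abbreviation \<alpha> :: "nat \<Rightarrow> complex" where "\<alpha> \<equiv> verblunsky \<mu>"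

text \<open>The integral over the circle of \<open>\<bar>Q\<bar>\<^sup>2\<close> times the logarithm of the \<open>n\<close>-th Bernstein-Szego
  weight, where \<open>Q\<close> has the coefficients \<open>q 0, \<dots>, q N\<close>.\<close>

definition bs_entropy :: "nat \<Rightarrow> (nat \<Rightarrow> complex) \<Rightarrow> nat \<Rightarrow> real" where
  "bs_entropy N q n = (\<integral>\<theta>. (cmod (\<Sum>m\<le>N. q m * cis \<theta> ^ m))\<^sup>2 * ln (bs_weight n \<theta>) \<partial>d\<theta>)"

lemma integral_trig_poly_square:
  "(\<integral>\<theta>. (cmod (\<Sum>m\<le>N. q m * cis \<theta> ^ m))\<^sup>2 \<partial>d\<theta>) = 2 * pi * (\<Sum>m\<le>N. (cmod (q m))\<^sup>2)"
proof -
  have int: "integrable d\<theta> (\<lambda>\<theta>. cis (of_int k * \<theta>))" for k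
    by (rule integrable_dtheta_bounded[where B = 1])
      (auto intro!: borel_measurable_dtheta_continuous continuous_intros)
  have "complex_of_real (\<integral>\<theta>. (cmod (\<Sum>m\<le>N. q m * cis \<theta> ^ m))\<^sup>2 \<partial>d\<theta>)
    = (\<integral>\<theta>. (\<Sum>m\<le>N. \<Sum>m'\<le>N. q m * cnj (q m') * cis (of_int (int m - int m') * \<theta>)) \<partial>d\<theta>)"
    by (simp only: norm_trig_poly_square flip: integral_complex_of_real)
  also have "\<dots> = (\<Sum>m\<le>N. \<Sum>m'\<le>N. q m * cnj (q m') * (if int m - int m' = 0 then of_real (2 * pi) else 0))"
  proof (intro has_bochner_integral_integral_eq has_bochner_integral_sum has_bochner_integral_mult_right)
    fix m m' :: nat
    show "has_bochner_integral d\<theta> (\<lambda>\<theta>. cis (of_int (int m - int m') * \<theta>))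
        (if int m - int m' = 0 then of_real (2 * pi) else 0)"
      using int integral_cis_int by (simp only: has_bochner_integral_iff)
  qed
  also have "\<dots> = (\<Sum>m\<le>N. \<Sum>m'\<le>N. if m = m' then of_real (2 * pi * (cmod (q m))\<^sup>2) else 0)"
    by (intro sum.cong refl) (simp add: complex_norm_square mult_ac del: of_real_power)
  also have "\<dots> = of_real (2 * pi * (\<Sum>m\<le>N. (cmod (q m))\<^sup>2))"
    by (simp add: sum_distrib_left)
  finally show ?thesis by (simp only: of_real_eq_iff)
qed

lemma trig_poly_bounded:
  obtains K where "\<And>\<theta>. (cmod (\<Sum>m\<le>N. q m * cis \<theta> ^ m))\<^sup>2 \<le> K" "0 \<le> K"
proof
  show "(cmod (\<Sum>m\<le>N. q m * cis \<theta> ^ m))\<^sup>2 \<le> (\<Sum>m\<le>N. cmod (q m))\<^sup>2" for \<theta>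
  proof (rule power_mono)
    show "cmod (\<Sum>m\<le>N. q m * cis \<theta> ^ m) \<le> (\<Sum>m\<le>N. cmod (q m))"
      by (rule norm_sum[THEN order_trans]) (simp add: norm_mult norm_power)
  qed simp
qed simp

lemma bs_entropy_eq:
  "bs_entropy N q n / (2 * pi) = (\<Sum>m\<le>N. (cmod (q m))\<^sup>2) * ln (\<kappa> n)
    - 2 * Re (\<Sum>m\<le>N. \<Sum>m'\<le>N. if m < m' then q m * cnj (q m') * log_coeff (R n) (m' - m) else 0)"
proof -
  let ?F = "\<lambda>\<theta>. (cmod (\<Sum>m\<le>N. q m * cis \<theta> ^ m))\<^sup>2"
  let ?L = "\<lambda>\<theta>. ln (cmod (poly (R n) (cis \<theta>)))"
  have ln: "ln (bs_weight n \<theta>) = ln (\<kappa> n) - 2 * ?L \<theta>" for \<theta>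
    unfolding bs_weight_def using \<kappa>_pos[of n] poly_R_cis_nz[of n \<theta>]
    by (simp add: ln_div ln_realpow)
  have int: "integrable d\<theta> ?F"
    by (intro integrable_dtheta_circle[where \<phi> = "\<lambda>z. (cmod (\<Sum>m\<le>N. q m * z ^ m))\<^sup>2"] continuous_intros)
  have int2: "integrable d\<theta> (\<lambda>\<theta>. ?F \<theta> * ?L \<theta>)"
    using R_zero_free
    by (intro integrable_dtheta_circle[where \<phi> = "\<lambda>z. (cmod (\<Sum>m\<le>N. q m * z ^ m))\<^sup>2 * ln (cmod (poly (R n) z))"]
        continuous_intros) auto
  have "bs_entropy N q n = (\<integral>\<theta>. ln (\<kappa> n) * ?F \<theta> - 2 * (?F \<theta> * ?L \<theta>) \<partial>d\<theta>)"
    unfolding bs_entropy_def ln by (simp add: algebra_simps)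
  also have "\<dots> = ln (\<kappa> n) * (\<integral>\<theta>. ?F \<theta> \<partial>d\<theta>) - 2 * (\<integral>\<theta>. ?F \<theta> * ?L \<theta> \<partial>d\<theta>)"
    by (subst Bochner_Integration.integral_diff) (use int int2 in auto)
  also have "(\<integral>\<theta>. ?F \<theta> * ?L \<theta> \<partial>d\<theta>) = 2 * pi * Re (\<Sum>m\<le>N. \<Sum>m'\<le>N. if m < m' then q m * cnj (q m') * log_coeff (R n) (m' - m) else 0)"
    using R_zero_free poly_R_0 by (intro integral_trig_poly_ln) auto
  finally show ?thesis
    unfolding integral_trig_poly_square by (simp add: field_simps)
qed

lemma ln_\<kappa>_bounded:
  assumes "summable (\<lambda>k. (cmod (\<alpha> k)) ^ 4)"
  shows "Bseq (\<lambda>n. ln (\<kappa> n) + (\<Sum>k<n. (cmod (\<alpha> k))\<^sup>2))"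
proof -
  define e where "e k = ln (1 - (cmod (\<alpha> k))\<^sup>2) + (cmod (\<alpha> k))\<^sup>2" for k
  have pos: "0 < 1 - (cmod (\<alpha> k))\<^sup>2" for k
    using norm_a[of k] by (simp add: abs_square_less_1)
  have pos': "(cmod (\<alpha> k))\<^sup>2 \<noteq> 1" for k
    using pos[of k] by linarith
  have "(\<lambda>k. (cmod (\<alpha> k)) ^ 4) \<longlonglongrightarrow> 0"
    by (rule summable_LIMSEQ_zero[OF assms])
  then have "eventually (\<lambda>k. (cmod (\<alpha> k)) ^ 4 < 1/4) sequentially"
    by (rule order_tendstoD) simp
  then have "eventually (\<lambda>k. norm (e k) \<le> 2 * (cmod (\<alpha> k)) ^ 4) sequentially"
  proof eventually_elim
    case (elim k)
    then have "((cmod (\<alpha> k))\<^sup>2)\<^sup>2 < (1/2)\<^sup>2"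
      by (simp add: power_divide flip: power_mult)
    then have "(cmod (\<alpha> k))\<^sup>2 < 1/2"
      by (rule power_less_imp_less_base) simp
    then show ?case
      using abs_ln_one_plus_x_minus_x_bound[of "- ((cmod (\<alpha> k))\<^sup>2)"] by (simp add: e_def flip: power_mult)
  qed
  then have "summable e"
    using summable_mult[OF assms, of 2] by (rule summable_comparison_test_ev)
  then have "Bseq (\<lambda>n. \<Sum>k<n. e k)"
    unfolding summable_iff_convergent by (rule convergent_imp_Bseq)
  moreover have "(\<Sum>k<n. e k) = ln (\<kappa> n) + (\<Sum>k<n. (cmod (\<alpha> k))\<^sup>2)" for n
    unfolding e_def \<kappa>_def sum.distrib using pos'  by (subst ln_prod) auto
  ultimately show ?thesis by simp
qed

text \<open>The quadratic terms in the coefficients that make up \<open>bs_entropy\<close> and those in the partial sums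
  of squares agree up to shifts of the summation index: \<open>X\<close> collects the diagonal terms, \<open>Y\<close> those
  with \<open>m < m'\<close>.\<close>

theorem bs_entropy_asymp:
  assumes "summable (\<lambda>k. (cmod (\<alpha> k)) ^ 4)"
  shows "Bseq (\<lambda>n. bs_entropy N q n / (2 * pi) + (\<Sum>k<n. (cmod (shift_poly N (\<lambda>m. cnj (q m)) \<alpha> k))\<^sup>2))"
proof -
  define X where "X m n = ln (\<kappa> n) + (\<Sum>k<n. (cmod (\<alpha> (k + m)))\<^sup>2)" for m n
  define Y where "Y m m' n = (\<Sum>k<n. \<alpha> (k + m') * cnj (\<alpha> (k + m))) - log_coeff (R n) (m' - m)" for m m' n
  have norm_\<alpha>: "cmod (\<alpha> k) \<le> 1" for k using norm_a[of k] by simp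
  have X: "Bseq (X m)" for m
  proof -
    have "norm ((cmod (\<alpha> k))\<^sup>2) \<le> 1" for k
      using norm_\<alpha>[of k] by (simp add: power_le_one)
    from Bseq_plus[OF ln_\<kappa>_bounded[OF assms] Bseq_shift_sums[where y = "\<lambda>k. (cmod (\<alpha> k))\<^sup>2", OF this, where m = m]]
    show ?thesis unfolding X_def by (simp add: algebra_simps)
  qed
  have Y: "Bseq (Y m m')" if "m < m'" for m m'
  proof -
    define y where "y j = \<alpha> j * cnj (\<alpha> (j - (m' - m)))" for j
    have "norm (y j) \<le> 1" for j
      using mult_mono[OF norm_\<alpha>[of j] norm_\<alpha>[of "j - (m' - m)"]] by (simp add: y_def norm_mult)
    from Bseq_shift_sums[where y = y, OF this, where m = m'] Bseq_cmult[OF log_coeff_bounded[OF assms, of "m' - m"], of "-1"]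
    have "Bseq (\<lambda>n. (\<Sum>k<n. y (k + m')) - (\<Sum>k<n. y k) + - 1 * (log_coeff (R n) (m' - m) - (\<Sum>j<n. y j)))"
      unfolding y_def using that by (intro Bseq_plus) auto
    moreover have "y (k + m') = \<alpha> (k + m') * cnj (\<alpha> (k + m))" for k
      using that by (simp add: y_def)
    ultimately show ?thesis unfolding Y_def by (simp add: algebra_simps)
  qed
  define d where "d m m' = (if m < m' then q m * cnj (q m') else 0)" for m m'
  define z where "z m m' k = \<alpha> (k + m') * cnj (\<alpha> (k + m))" for m m' k
  have sq: "(cmod (shift_poly N (\<lambda>m. cnj (q m)) \<alpha> k))\<^sup>2
    = (\<Sum>m\<le>N. (cmod (q m))\<^sup>2 * (cmod (\<alpha> (k + m)))\<^sup>2) + 2 * Re (\<Sum>m\<le>N. \<Sum>m'\<le>N. d m m' * z m m' k)" for k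
  proof -
    have "(if m < m' then cnj (cnj (q m) * \<alpha> (k + m)) * (cnj (q m') * \<alpha> (k + m')) else 0) = d m m' * z m m' k" for m m'
      by (simp add: d_def z_def)
    then show ?thesis
      unfolding shift_poly_eq norm_sum_square by (simp only: norm_mult power_mult_distrib complex_mod_cnj)
  qed
  have swap: "(\<Sum>k<n. \<Sum>m\<le>N. \<Sum>m'\<le>N. d m m' * z m m' k) = (\<Sum>m\<le>N. \<Sum>m'\<le>N. d m m' * (\<Sum>k<n. z m m' k))" for n
  proof -
    have "(\<Sum>k<n. \<Sum>m\<le>N. \<Sum>m'\<le>N. d m m' * z m m' k) = (\<Sum>m\<le>N. \<Sum>k<n. \<Sum>m'\<le>N. d m m' * z m m' k)"
      by (rule sum.swap)
    also have "\<dots> = (\<Sum>m\<le>N. \<Sum>m'\<le>N. \<Sum>k<n. d m m' * z m m' k)"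
      by (intro sum.cong refl sum.swap)
    finally show ?thesis by (simp only: sum_distrib_left)
  qed
  have swap': "(\<Sum>k<n. \<Sum>m\<le>N. (cmod (q m))\<^sup>2 * (cmod (\<alpha> (k + m)))\<^sup>2)
    = (\<Sum>m\<le>N. (cmod (q m))\<^sup>2 * (\<Sum>k<n. (cmod (\<alpha> (k + m)))\<^sup>2))" for n
    by (subst sum.swap) (simp add: sum_distrib_left)
  have re2: "(\<Sum>k<n. 2 * Re (f k)) = 2 * Re (\<Sum>k<n. f k)" for f and n :: nat
    by (simp add: sum_distrib_left)
  have ent: "bs_entropy N q n / (2 * pi) = (\<Sum>m\<le>N. (cmod (q m))\<^sup>2) * ln (\<kappa> n)
    - 2 * Re (\<Sum>m\<le>N. \<Sum>m'\<le>N. d m m' * log_coeff (R n) (m' - m))" for n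
    unfolding bs_entropy_eq d_def by (intro arg_cong2[where f = minus] arg_cong[where f = "\<lambda>x. 2 * Re x"] sum.cong refl) simp
  have "bs_entropy N q n / (2 * pi) + (\<Sum>k<n. (cmod (shift_poly N (\<lambda>m. cnj (q m)) \<alpha> k))\<^sup>2)
    = (\<Sum>m\<le>N. (cmod (q m))\<^sup>2 * X m n) + 2 * Re (\<Sum>m\<le>N. \<Sum>m'\<le>N. d m m' * Y m m' n)" for n
  proof -
    have "(\<Sum>k<n. (cmod (shift_poly N (\<lambda>m. cnj (q m)) \<alpha> k))\<^sup>2)
      = (\<Sum>m\<le>N. (cmod (q m))\<^sup>2 * (\<Sum>k<n. (cmod (\<alpha> (k + m)))\<^sup>2))
        + 2 * Re (\<Sum>m\<le>N. \<Sum>m'\<le>N. d m m' * (\<Sum>k<n. z m m' k))"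
      unfolding sq sum.distrib swap' re2 swap ..
    moreover have "(\<Sum>m\<le>N. (cmod (q m))\<^sup>2 * X m n) = (\<Sum>m\<le>N. (cmod (q m))\<^sup>2) * ln (\<kappa> n)
       + (\<Sum>m\<le>N. (cmod (q m))\<^sup>2 * (\<Sum>k<n. (cmod (\<alpha> (k + m)))\<^sup>2))"
      unfolding X_def distrib_left sum.distrib sum_distrib_right ..
    moreover have "(\<Sum>m\<le>N. \<Sum>m'\<le>N. d m m' * Y m m' n) = (\<Sum>m\<le>N. \<Sum>m'\<le>N. d m m' * (\<Sum>k<n. z m m' k))
       - (\<Sum>m\<le>N. \<Sum>m'\<le>N. d m m' * log_coeff (R n) (m' - m))"
      unfolding Y_def z_def right_diff_distrib sum_subtractf ..
    ultimately show ?thesis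
      unfolding ent by simp
  qed
  moreover have "Bseq (\<lambda>n. (\<Sum>m\<le>N. (cmod (q m))\<^sup>2 * X m n) + 2 * Re (\<Sum>m\<le>N. \<Sum>m'\<le>N. d m m' * Y m m' n))"
  proof -
    have "Bseq (\<lambda>n. d m m' * Y m m' n)" for m m'
      using Y[of m m'] by (cases "m < m'") (simp_all add: d_def Bseq_cmult)
    then have "Bseq (\<lambda>n. \<Sum>m\<le>N. \<Sum>m'\<le>N. d m m' * Y m m' n)"
      by (intro Bseq_sum)
    moreover have "Bseq (\<lambda>n. \<Sum>m\<le>N. (cmod (q m))\<^sup>2 * X m n)"
      by (intro Bseq_sum Bseq_cmult X)
    ultimately show ?thesis
      by (intro Bseq_plus Bseq_cmult[of _ 2] Bseq_Re)
  qed
  ultimately show ?thesis by (simp only:)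
qed

theorem square_summable_iff_bs_entropy:
  assumes "summable (\<lambda>k. (cmod (\<alpha> k)) ^ 4)"
  shows "square_summable (shift_poly N (\<lambda>m. cnj (q m)) \<alpha>) \<longleftrightarrow> (\<exists>C. \<forall>n. C \<le> bs_entropy N q n)"
proof -
  let ?s = "\<lambda>k. (cmod (shift_poly N (\<lambda>m. cnj (q m)) \<alpha> k))\<^sup>2"
  obtain B where *: "\<And>n. norm (bs_entropy N q n / (2 * pi) + (\<Sum>k<n. ?s k)) \<le> B"
    using bs_entropy_asymp[OF assms, of N q] unfolding Bseq_def by blast
  then have B: "bs_entropy N q n / (2 * pi) + (\<Sum>k<n. ?s k) \<le> B"
     "- B \<le> bs_entropy N q n / (2 * pi) + (\<Sum>k<n. ?s k)" for n
    using *[of n] unfolding real_norm_def abs_le_iff by linarith+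
  show ?thesis
  proof
    assume "square_summable (shift_poly N (\<lambda>m. cnj (q m)) \<alpha>)"
    then have "summable ?s" by (simp add: square_summable_def)
    then have le: "(\<Sum>k<n. ?s k) \<le> suminf ?s" for n
      by (rule sum_le_suminf) simp_all
    have "- B - suminf ?s \<le> bs_entropy N q n / (2 * pi)" for n
      using B(2)[of n] le[of n] by linarith
    then have "(- B - suminf ?s) * (2 * pi) \<le> bs_entropy N q n" for n
      by (simp add: pos_le_divide_eq)
    then show "\<exists>C. \<forall>n. C \<le> bs_entropy N q n" by blast
  next
    assume "\<exists>C. \<forall>n. C \<le> bs_entropy N q n"
    then obtain C where "\<And>n. C \<le> bs_entropy N q n" by blast
    then have C: "C / (2 * pi) \<le> bs_entropy N q n / (2 * pi)" for n
      by (intro divide_right_mono) auto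
    have "(\<Sum>k<n. ?s k) \<le> B - C / (2 * pi)" for n
      using B(1)[of n] C[of n] by linarith
    then have "summable ?s" by (intro summableI_nonneg_bounded) auto
    then show "square_summable (shift_poly N (\<lambda>m. cnj (q m)) \<alpha>)"
      by (simp add: square_summable_def)
  qed
qed

end

section \<open>Continuous approximation in mean with respect to two measures\<close>

lemma outer_approx:
  fixes M :: "complex measure"
  assumes M: "finite_measure M" "sets M = sets borel" and A: "A \<in> sets borel" and e: "0 < e"
  obtains U where "open U" "A \<subseteq> U" "measure M U < measure M A + e"
proof -
  interpret finite_measure M by fact
  have "emeasure M A < ennreal (measure M A + e)"
    using e unfolding emeasure_eq_measure by (intro ennreal_lessI) (auto intro: add_nonneg_pos)
  moreover have "emeasure M A = (INF U \<in> {U. A \<subseteq> U \<and> open U}. emeasure M U)"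
    by (rule outer_regular[OF M(2) _ A]) simp
  ultimately obtain U where U: "A \<subseteq> U" "open U" "emeasure M U < ennreal (measure M A + e)"
    by (auto simp: INF_less_iff)
  from U(3) have "measure M U < measure M A + e"
    unfolding emeasure_eq_measure by (simp add: ennreal_less_iff)
  with U show ?thesis by (intro that) auto
qed

lemma regular_pair:
  fixes M :: "complex measure"
  assumes M: "finite_measure M" "sets M = sets borel" and A: "A \<in> sets borel" and e: "0 < e"
  obtains K U where "closed K" "open U" "K \<subseteq> A" "A \<subseteq> U" "emeasure M (U - K) < ennreal e"
proof -
  interpret finite_measure M by fact
  have sp: "space M = UNIV" using sets_eq_imp_space_eq[OF M(2)] by simp
  have e2: "0 < e / 2" using e by simp
  obtain U where U: "open U" "A \<subseteq> U" "measure M U < measure M A + e / 2"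
    by (rule outer_approx[OF M A e2])
  have A': "- A \<in> sets borel" using A by simp
  obtain V where V: "open V" "- A \<subseteq> V" "measure M V < measure M (- A) + e / 2"
    by (rule outer_approx[OF M A' e2])
  have sets: "U \<in> sets M" "V \<in> sets M" "A \<in> sets M" "- V \<in> sets M"
    using U V A M(2) by auto
  have "- V \<subseteq> U" using U(2) V(2) by blast
  then have "measure M (U - (- V)) = measure M U - measure M (- V)"
    using sets by (intro finite_measure_Diff)
  also have "measure M (- V) = measure M UNIV - measure M V"
    using finite_measure_compl[OF sets(2)] sp by (simp add: Compl_eq_Diff_UNIV)
  also have "measure M UNIV = measure M A + measure M (- A)"
    using finite_measure_compl[OF sets(3)] sp by (simp add: Compl_eq_Diff_UNIV)
  finally have "measure M (U - (- V)) < e"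
    using U(3) V(3) by simp
  then have "emeasure M (U - (- V)) < ennreal e"
    using e by (simp add: emeasure_eq_measure ennreal_less_iff)
  then show ?thesis using U V by (intro that[of "- V" U]) auto
qed

text \<open>\<open>g\<close> can be approximated by one continuous function simultaneously in the mean of both measures.\<close>

definition approximable :: "complex measure \<Rightarrow> complex measure \<Rightarrow> (complex \<Rightarrow> real) \<Rightarrow> bool" where
  "approximable M1 M2 g \<longleftrightarrow> (\<forall>e>0. \<exists>f. continuous_on UNIV f \<and>
     (\<integral>\<^sup>+z. ennreal \<bar>f z - g z\<bar> \<partial>M1) < ennreal e \<and> (\<integral>\<^sup>+z. ennreal \<bar>f z - g z\<bar> \<partial>M2) < ennreal e)"

lemma approximable_indicator:
  assumes M1: "finite_measure M1" "sets M1 = sets borel" and M2: "finite_measure M2" "sets M2 = sets borel"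
    and A: "A \<in> sets borel"
  shows "approximable M1 M2 (indicator A)"
  unfolding approximable_def
proof (intro allI impI)
  fix e :: real assume e: "0 < e"
  obtain K1 U1 where 1: "closed K1" "open U1" "K1 \<subseteq> A" "A \<subseteq> U1" "emeasure M1 (U1 - K1) < ennreal e"
    by (rule regular_pair[OF M1 A e])
  obtain K2 U2 where 2: "closed K2" "open U2" "K2 \<subseteq> A" "A \<subseteq> U2" "emeasure M2 (U2 - K2) < ennreal e"
    by (rule regular_pair[OF M2 A e])
  have disj: "(K1 \<union> K2) \<inter> (- (U1 \<inter> U2)) = {}" using 1 2 by blast
  obtain f :: "complex \<Rightarrow> real" where f: "continuous_on UNIV f" "\<And>x. f x \<in> closed_segment 1 0"
    "\<And>x. x \<in> K1 \<union> K2 \<Longrightarrow> f x = 1" "\<And>x. x \<in> - (U1 \<inter> U2) \<Longrightarrow> f x = 0"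
    by (rule Urysohn[of "K1 \<union> K2" "- (U1 \<inter> U2)" 1 0, OF _ _ disj]) (use 1 2 in auto)
  have f01: "0 \<le> f x" "f x \<le> 1" for x
    using f(2)[of x] by (auto simp: closed_segment_eq_real_ivl)
  have le: "ennreal \<bar>f z - indicator A z\<bar> \<le> indicator (U - K) z"
    if "K1 \<union> K2 \<supseteq> K" "U1 \<inter> U2 \<subseteq> U" "K \<subseteq> A" "A \<subseteq> U" for K U z
  proof (cases "z \<in> U - K")
    case True
    then show ?thesis using f01[of z] by (auto simp: indicator_def intro!: ennreal_leI[of _ 1, simplified])
  next
    case False
    then consider "z \<in> K" | "z \<notin> U" by blast
    then have "f z = indicator A z"
      using that f(3)[of z] f(4)[of z] by cases (auto simp: indicator_def)
    then show ?thesis by simp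
  qed
  have "(\<integral>\<^sup>+z. ennreal \<bar>f z - indicator A z\<bar> \<partial>M1) \<le> (\<integral>\<^sup>+z. indicator (U1 - K1) z \<partial>M1)"
    using 1 by (intro nn_integral_mono le) auto
  also have "\<dots> < ennreal e" using 1 M1 by simp
  finally have 3: "(\<integral>\<^sup>+z. ennreal \<bar>f z - indicator A z\<bar> \<partial>M1) < ennreal e" .
  have "(\<integral>\<^sup>+z. ennreal \<bar>f z - indicator A z\<bar> \<partial>M2) \<le> (\<integral>\<^sup>+z. indicator (U2 - K2) z \<partial>M2)"
    using 2 by (intro nn_integral_mono le) auto
  also have "\<dots> < ennreal e" using 2 M2 by simp
  finally show "\<exists>f. continuous_on UNIV f \<and>
     (\<integral>\<^sup>+z. ennreal \<bar>f z - indicator A z\<bar> \<partial>M1) < ennreal e \<and> (\<integral>\<^sup>+z. ennreal \<bar>f z - indicator A z\<bar> \<partial>M2) < ennreal e"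
    using 3 f(1) by blast
qed

lemma nn_integral_abs_triangle:
  fixes f g h :: "complex \<Rightarrow> real"
  assumes "sets M = sets borel" "f \<in> borel_measurable borel" "g \<in> borel_measurable borel" "h \<in> borel_measurable borel"
  shows "(\<integral>\<^sup>+z. ennreal \<bar>f z - h z\<bar> \<partial>M) \<le> (\<integral>\<^sup>+z. ennreal \<bar>f z - g z\<bar> \<partial>M) + (\<integral>\<^sup>+z. ennreal \<bar>g z - h z\<bar> \<partial>M)"
proof -
  have [measurable_cong]: "sets M = sets borel" by fact
  note [measurable] = assms(2-4)
  have "(\<integral>\<^sup>+z. ennreal \<bar>f z - h z\<bar> \<partial>M) \<le> (\<integral>\<^sup>+z. ennreal \<bar>f z - g z\<bar> + ennreal \<bar>g z - h z\<bar> \<partial>M)"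
    by (intro nn_integral_mono) (auto simp flip: ennreal_plus intro!: ennreal_leI)
  also have "\<dots> = (\<integral>\<^sup>+z. ennreal \<bar>f z - g z\<bar> \<partial>M) + (\<integral>\<^sup>+z. ennreal \<bar>g z - h z\<bar> \<partial>M)"
    by (rule nn_integral_add) measurable
  finally show ?thesis .
qed

lemma approximable_cmult:
  assumes "approximable M1 M2 g" and c: "0 < c" and "sets M1 = sets borel" "sets M2 = sets borel" "g \<in> borel_measurable borel"
  shows "approximable M1 M2 (\<lambda>z. c * g z)"
  unfolding approximable_def
proof (intro allI impI)
  fix e :: real assume "0 < e"
  then obtain f where f: "continuous_on UNIV f" "(\<integral>\<^sup>+z. ennreal \<bar>f z - g z\<bar> \<partial>M1) < ennreal (e / c)"
    "(\<integral>\<^sup>+z. ennreal \<bar>f z - g z\<bar> \<partial>M2) < ennreal (e / c)"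
    using assms(1) c unfolding approximable_def by (meson divide_pos_pos)
  have "(\<integral>\<^sup>+z. ennreal \<bar>c * f z - c * g z\<bar> \<partial>M) < ennreal e"
    if M: "sets M = sets borel" "(\<integral>\<^sup>+z. ennreal \<bar>f z - g z\<bar> \<partial>M) < ennreal (e / c)" for M
  proof -
    have [measurable_cong]: "sets M = sets borel" by fact
    note [measurable] = assms(5) borel_measurable_continuous_onI[OF f(1)]
    have "\<bar>c * f z - c * g z\<bar> = c * \<bar>f z - g z\<bar>" for z
      using c by (simp add: abs_mult flip: right_diff_distrib)
    then have "(\<integral>\<^sup>+z. ennreal \<bar>c * f z - c * g z\<bar> \<partial>M) = (\<integral>\<^sup>+z. ennreal c * ennreal \<bar>f z - g z\<bar> \<partial>M)"
      using c by (simp add: ennreal_mult)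
    also have "\<dots> = ennreal c * (\<integral>\<^sup>+z. ennreal \<bar>f z - g z\<bar> \<partial>M)"
      by (rule nn_integral_cmult) measurable
    also have "\<dots> < ennreal c * ennreal (e / c)"
      using M(2) c by (intro ennreal_mult_strict_left_mono) auto
    also have "\<dots> = ennreal e" using c \<open>0 < e\<close> by (simp flip: ennreal_mult)
    finally show ?thesis .
  qed
  then show "\<exists>f. continuous_on UNIV f \<and> (\<integral>\<^sup>+z. ennreal \<bar>f z - c * g z\<bar> \<partial>M1) < ennreal e \<and>
    (\<integral>\<^sup>+z. ennreal \<bar>f z - c * g z\<bar> \<partial>M2) < ennreal e"
    using f assms by (intro exI[of _ "\<lambda>z. c * f z"]) (auto intro!: continuous_intros)
qed

lemma approximable_add:
  assumes "approximable M1 M2 g" "approximable M1 M2 h" "sets M1 = sets borel" "sets M2 = sets borel"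
    "g \<in> borel_measurable borel" "h \<in> borel_measurable borel"
  shows "approximable M1 M2 (\<lambda>z. g z + h z)"
  unfolding approximable_def
proof (intro allI impI)
  fix e :: real assume e: "0 < e"
  then obtain f where f: "continuous_on UNIV f" "(\<integral>\<^sup>+z. ennreal \<bar>f z - g z\<bar> \<partial>M1) < ennreal (e / 2)"
    "(\<integral>\<^sup>+z. ennreal \<bar>f z - g z\<bar> \<partial>M2) < ennreal (e / 2)"
    using assms(1) unfolding approximable_def by (meson half_gt_zero)
  obtain f' where f': "continuous_on UNIV f'" "(\<integral>\<^sup>+z. ennreal \<bar>f' z - h z\<bar> \<partial>M1) < ennreal (e / 2)"
    "(\<integral>\<^sup>+z. ennreal \<bar>f' z - h z\<bar> \<partial>M2) < ennreal (e / 2)"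
    using assms(2) e unfolding approximable_def by (meson half_gt_zero)
  have "(\<integral>\<^sup>+z. ennreal \<bar>(f z + f' z) - (g z + h z)\<bar> \<partial>M) < ennreal e"
    if M: "sets M = sets borel" "(\<integral>\<^sup>+z. ennreal \<bar>f z - g z\<bar> \<partial>M) < ennreal (e / 2)"
       "(\<integral>\<^sup>+z. ennreal \<bar>f' z - h z\<bar> \<partial>M) < ennreal (e / 2)" for M
  proof -
    have [measurable_cong]: "sets M = sets borel" by fact
    note [measurable] = assms(5,6) borel_measurable_continuous_onI[OF f(1)] borel_measurable_continuous_onI[OF f'(1)]
    have "(\<integral>\<^sup>+z. ennreal \<bar>(f z + f' z) - (g z + h z)\<bar> \<partial>M) \<le> (\<integral>\<^sup>+z. ennreal \<bar>f z - g z\<bar> + ennreal \<bar>f' z - h z\<bar> \<partial>M)"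
      by (intro nn_integral_mono) (auto simp flip: ennreal_plus intro!: ennreal_leI)
    also have "\<dots> = (\<integral>\<^sup>+z. ennreal \<bar>f z - g z\<bar> \<partial>M) + (\<integral>\<^sup>+z. ennreal \<bar>f' z - h z\<bar> \<partial>M)"
      by (rule nn_integral_add) measurable
    also have "\<dots> < ennreal (e/2) + ennreal (e/2)"
      by (rule add_strict_mono) (fact M)+
    also have "\<dots> = ennreal e" using e by (simp flip: ennreal_plus)
    finally show ?thesis .
  qed
  then show "\<exists>f. continuous_on UNIV f \<and> (\<integral>\<^sup>+z. ennreal \<bar>f z - (g z + h z)\<bar> \<partial>M1) < ennreal e \<and>
      (\<integral>\<^sup>+z. ennreal \<bar>f z - (g z + h z)\<bar> \<partial>M2) < ennreal e"
    using f f' assms by (intro exI[of _ "\<lambda>z. f z + f' z"]) (auto intro!: continuous_intros)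
qed

lemma approximable_limit:
  assumes M1: "finite_measure M1" "sets M1 = sets borel" and M2: "finite_measure M2" "sets M2 = sets borel"
    and U: "\<And>i. approximable M1 M2 (U i)" "\<And>i. U i \<in> borel_measurable borel"
    and bounded: "\<And>i z. 0 \<le> U i z" "\<And>i z. U i z \<le> B"
    and lim: "\<And>z. (\<lambda>i. U i z) \<longlonglongrightarrow> g z"
  shows "approximable M1 M2 g"
  unfolding approximable_def
proof (intro allI impI)
  fix e :: real assume e: "0 < e"
  have g[measurable]: "g \<in> borel_measurable borel"
    by (rule borel_measurable_LIMSEQ_real[OF lim U(2)])
  have gb: "0 \<le> g z" "g z \<le> B" for z
    using bounded LIMSEQ_le_const[OF lim, of 0 z] LIMSEQ_le_const2[OF lim, of z B] by auto
  have conv: "eventually (\<lambda>i. (\<integral>\<^sup>+z. ennreal \<bar>U i z - g z\<bar> \<partial>M) < ennreal (e / 2)) sequentially"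
    if M: "finite_measure M" "sets M = sets borel" for M
  proof -
    have [measurable_cong]: "sets M = sets borel" by fact
    note [measurable] = U(2)
    interpret finite_measure M by fact
    have "(\<lambda>i. \<integral>\<^sup>+z. ennreal \<bar>U i z - g z\<bar> \<partial>M) \<longlonglongrightarrow> (\<integral>\<^sup>+z. ennreal 0 \<partial>M)"
    proof (rule nn_integral_dominated_convergence[where w = "\<lambda>_. ennreal B"])
      show "AE z in M. ennreal \<bar>U i z - g z\<bar> \<le> ennreal B" for i
      proof (intro AE_I2 ennreal_leI)
        show "\<bar>U i z - g z\<bar> \<le> B" for z
          using bounded(1)[of i z] bounded(2)[of i z] gb[of z] by linarith
      qed
      show "(\<integral>\<^sup>+z. ennreal B \<partial>M) < \<infinity>"
        by (simp add: ennreal_mult_less_top emeasure_eq_measure)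
      show "AE z in M. (\<lambda>i. ennreal \<bar>U i z - g z\<bar>) \<longlonglongrightarrow> ennreal 0"
      proof (intro AE_I2 tendsto_ennrealI)
        show "(\<lambda>i. \<bar>U i z - g z\<bar>) \<longlonglongrightarrow> 0" for z
          using lim[of z] by (simp add: LIM_zero_iff tendsto_rabs_zero_iff)
      qed
    qed measurable
    then have "(\<lambda>i. \<integral>\<^sup>+z. ennreal \<bar>U i z - g z\<bar> \<partial>M) \<longlonglongrightarrow> 0" by simp
    then show ?thesis
      using e by (intro order_tendstoD(2)[where y = 0]) auto
  qed
  obtain i where i: "(\<integral>\<^sup>+z. ennreal \<bar>U i z - g z\<bar> \<partial>M1) < ennreal (e / 2)"
    "(\<integral>\<^sup>+z. ennreal \<bar>U i z - g z\<bar> \<partial>M2) < ennreal (e / 2)"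
    using eventually_happens[OF eventually_conj[OF conv[OF M1] conv[OF M2]]] by auto
  obtain f where f: "continuous_on UNIV f" "(\<integral>\<^sup>+z. ennreal \<bar>f z - U i z\<bar> \<partial>M1) < ennreal (e / 2)"
    "(\<integral>\<^sup>+z. ennreal \<bar>f z - U i z\<bar> \<partial>M2) < ennreal (e / 2)"
    using U(1)[of i] e unfolding approximable_def by (meson half_gt_zero)
  have "(\<integral>\<^sup>+z. ennreal \<bar>f z - g z\<bar> \<partial>M) < ennreal e"
    if M: "sets M = sets borel" "(\<integral>\<^sup>+z. ennreal \<bar>f z - U i z\<bar> \<partial>M) < ennreal (e / 2)"
      "(\<integral>\<^sup>+z. ennreal \<bar>U i z - g z\<bar> \<partial>M) < ennreal (e / 2)" for M
  proof -
    have "(\<integral>\<^sup>+z. ennreal \<bar>f z - g z\<bar> \<partial>M) \<le> (\<integral>\<^sup>+z. ennreal \<bar>f z - U i z\<bar> \<partial>M) + (\<integral>\<^sup>+z. ennreal \<bar>U i z - g z\<bar> \<partial>M)"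
      by (intro nn_integral_abs_triangle M U g borel_measurable_continuous_onI f)
    also have "\<dots> < ennreal (e/2) + ennreal (e/2)"
      by (rule add_strict_mono) (fact M)+
    also have "\<dots> = ennreal e" using e by (simp flip: ennreal_plus)
    finally show ?thesis .
  qed
  then show "\<exists>f. continuous_on UNIV f \<and> (\<integral>\<^sup>+z. ennreal \<bar>f z - g z\<bar> \<partial>M1) < ennreal e \<and>
      (\<integral>\<^sup>+z. ennreal \<bar>f z - g z\<bar> \<partial>M2) < ennreal e"
    using f i M1 M2 by blast
qed

lemma approximable_bounded:
  assumes M1: "finite_measure M1" "sets M1 = sets borel" and M2: "finite_measure M2" "sets M2 = sets borel"
    and g: "g \<in> borel_measurable borel" "\<And>z. 0 \<le> g z" and B: "\<forall>z. g z \<le> B"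
  shows "approximable M1 M2 g"
proof -
  from g have "(\<exists>B. \<forall>z. g z \<le> B) \<longrightarrow> approximable M1 M2 g"
  proof (induction rule: borel_measurable_induct_real)
    case (set A)
    then show ?case using approximable_indicator[OF M1 M2] by blast
  next
    case (mult u c)
    show ?case
    proof (cases "c = 0")
      case True
      then show ?thesis unfolding approximable_def by (auto intro!: exI[of _ "\<lambda>_. 0"])
    next
      case False
      with mult have c: "0 < c" by simp
      have "(\<exists>B. \<forall>z. c * u z \<le> B) \<Longrightarrow> (\<exists>B. \<forall>z. u z \<le> B)"
        using c by (metis pos_le_divide_eq mult.commute)
      then show ?thesis using mult approximable_cmult[OF _ c M1(2) M2(2) mult(2)] by blast
    qed
  next
    case (add u v)
    show ?case
    proof
      assume "\<exists>B. \<forall>z. v z + u z \<le> B"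
      then obtain B where B: "\<And>z. v z + u z \<le> B" by blast
      have "u z \<le> B" "v z \<le> B" for z
        using B[of z] add.hyps(2)[of z] \<open>\<And>x. 0 \<le> v x\<close>[of z] by linarith+
      then have "approximable M1 M2 u" "approximable M1 M2 v"
        using add.IH by blast+
      then show "approximable M1 M2 (\<lambda>z. v z + u z)"
        using \<open>u \<in> borel_measurable borel\<close> \<open>v \<in> borel_measurable borel\<close>
        by (intro approximable_add M1 M2)
    qed
  next
    case (seq U)
    show ?case
    proof
      assume "\<exists>B. \<forall>z. g z \<le> B"
      then obtain B where B: "\<And>z. g z \<le> B" by blast
      have lim: "(\<lambda>i. U i z) \<longlonglongrightarrow> g z" for z
        using seq by simp
      have "U i z \<le> g z" for i z
        using \<open>incseq U\<close> by (intro incseq_le[OF _ lim]) (auto simp: incseq_def le_fun_def)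
      then have UB: "U i z \<le> B" for i z using B order_trans by blast
      have "approximable M1 M2 (U i)" for i
        using seq.IH[of i] UB by blast
      then show "approximable M1 M2 g"
        using seq.hyps(1,2) UB lim by (intro approximable_limit[OF M1 M2, of U B g]) auto
    qed
  qed
  with B show ?thesis by blast
qed

section \<open>Trigonometric test functions\<close>

text \<open>On the unit circle, \<open>g\<close> coincides with a Laurent polynomial. The negative powers of \<open>z\<close> are
  written as powers of \<open>cnj z\<close>, with which a single factor \<open>cnj z ^ d\<close> suffices.\<close>

definition laurent_on_circle :: "(complex \<Rightarrow> complex) \<Rightarrow> bool" where
  "laurent_on_circle g \<longleftrightarrow> (\<exists>p d. \<forall>z. cmod z = 1 \<longrightarrow> g z = poly p z * cnj z ^ d)"

lemma cnj_mult_circle: "cmod z = 1 \<Longrightarrow> z * cnj z = 1"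
  by (simp add: complex_norm_square[symmetric])

lemma laurent_poly: "laurent_on_circle (poly p)"
  unfolding laurent_on_circle_def by (intro exI[of _ p] exI[of _ 0]) simp

lemma laurent_cnj_poly: "laurent_on_circle (\<lambda>z. cnj (poly p z))"
  unfolding laurent_on_circle_def
proof (intro exI allI impI)
  fix z :: complex assume z: "cmod z = 1"
  let ?n = "degree p"
  have nz: "z \<noteq> 0" using z by auto
  have "1 / cnj z = z" using cnj_mult_circle[OF z] nz by (simp add: field_simps)
  then have "poly (reversed_poly ?n p) z = z ^ ?n * cnj (poly p z)"
    using nz by (subst poly_reversed_poly) simp_all
  then have "poly (reversed_poly ?n p) z * cnj z ^ ?n = (z * cnj z) ^ ?n * cnj (poly p z)"
    by (simp only: power_mult_distrib mult_ac)
  then show "cnj (poly p z) = poly (reversed_poly ?n p) z * cnj z ^ ?n"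
    using cnj_mult_circle[OF z] by simp
qed

lemma laurent_mult:
  assumes "laurent_on_circle f" "laurent_on_circle g"
  shows "laurent_on_circle (\<lambda>z. f z * g z)"
proof -
  obtain p d p' d' where "\<And>z. cmod z = 1 \<Longrightarrow> f z = poly p z * cnj z ^ d"
    "\<And>z. cmod z = 1 \<Longrightarrow> g z = poly p' z * cnj z ^ d'"
    using assms unfolding laurent_on_circle_def by metis
  then show ?thesis unfolding laurent_on_circle_def
    by (intro exI[of _ "p * p'"] exI[of _ "d + d'"]) (simp add: power_add mult_ac)
qed

lemma laurent_add:
  assumes "laurent_on_circle f" "laurent_on_circle g"
  shows "laurent_on_circle (\<lambda>z. f z + g z)"
proof -
  obtain p d p' d' where *: "\<And>z. cmod z = 1 \<Longrightarrow> f z = poly p z * cnj z ^ d"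
    "\<And>z. cmod z = 1 \<Longrightarrow> g z = poly p' z * cnj z ^ d'"
    using assms unfolding laurent_on_circle_def by metis
  show ?thesis unfolding laurent_on_circle_def
  proof (intro exI allI impI)
    fix z :: complex assume z: "cmod z = 1"
    have zz: "z ^ k * cnj z ^ k = 1" for k
      using cnj_mult_circle[OF z] by (simp flip: power_mult_distrib)
    have "poly (p * monom 1 d' + p' * monom 1 d) z * cnj z ^ (d + d')
      = poly p z * cnj z ^ d * (z ^ d' * cnj z ^ d') + poly p' z * cnj z ^ d' * (z ^ d * cnj z ^ d)"
      by (simp add: poly_monom power_add algebra_simps)
    then show "f z + g z = poly (p * monom 1 d' + p' * monom 1 d) z * cnj z ^ (d + d')"
      using *[OF z] by (simp add: zz)
  qed
qed

lemma laurent_real_polynomial: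
  assumes "real_polynomial_function (h :: complex \<Rightarrow> real)"
  shows "laurent_on_circle (\<lambda>z. complex_of_real (h z))"
  using assms
proof (induction h)
  case (linear f)
  interpret bounded_linear f by fact
  have f: "f z = Re z * f 1 + Im z * f \<i>" for z
  proof -
    have "f z = f (Re z *\<^sub>R 1 + Im z *\<^sub>R \<i>)"
      by (rule arg_cong[where f = f]) (simp add: complex_eq_iff)
    then show ?thesis by (simp only: add scaleR real_scaleR_def)
  qed
  let ?k = "Complex (f 1) (- f \<i>) / 2"
  have "complex_of_real (f z) = poly [:0, ?k:] z + cnj (poly [:0, ?k:] z)" for z
    by (simp add: f[of z] complex_eq_iff field_simps)
  then show ?case
    using laurent_add[OF laurent_poly[of "[:0, ?k:]"] laurent_cnj_poly[of "[:0, ?k:]"]] by simp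
next
  case (const c)
  show ?case unfolding laurent_on_circle_def
    by (intro exI[of _ "[:of_real c:]"] exI[of _ 0]) simp
next
  case (add f g)
  then show ?case using laurent_add by simp
next
  case (mult f g)
  then show ?case using laurent_mult by simp
qed

lemma (in circle_measure) integral_laurent:
  assumes g: "\<And>z. cmod z = 1 \<Longrightarrow> g z = poly p z * cnj z ^ d" and "continuous_on UNIV g"
  shows "(\<integral>z. g z \<partial>M) = (\<Sum>i\<le>degree p. coeff p i * ip (monom 1 d) (monom 1 i))"
proof -
  have "(\<integral>z. g z \<partial>M) = ip (monom 1 d) p"
    unfolding ip_def
  proof (rule integral_cong_AE)
    show "AE z in M. g z = cnj (poly (monom 1 d) z) * poly p z"
      by (rule eventually_mono[OF AE_circle]) (simp add: g poly_monom)
  qed (intro borel_measurable_integrable integrable_poly integrable_continuous assms(2))+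
  also have "p = (\<Sum>i\<le>degree p. smult (coeff p i) (monom 1 i))"
    by (simp add: smult_monom poly_as_sum_of_monoms)
  finally show ?thesis
    by (simp only: ip_sum_right ip_smult_right)
qed

text \<open>Normalised arc length on the circle.\<close>

abbreviation arc_measure :: "complex measure" where
  "arc_measure \<equiv> ac_circle_measure (\<lambda>_. 1)"

lemma circle_measure_arc: "circle_measure arc_measure"
  by (rule circle_measure_ac[where B = 1]) auto

lemma emeasure_arc_UNIV: "emeasure arc_measure UNIV = 1"
proof -
  have "emeasure arc_measure UNIV = (\<integral>\<^sup>+z. 1 \<partial>arc_measure)" by simp
  also have "\<dots> = (\<integral>\<^sup>+\<theta>. ennreal (1 / (2 * pi)) * 1 \<partial>d\<theta>)"
    by (rule nn_integral_ac) auto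
  also have "\<dots> = ennreal (1 / (2 * pi)) * ennreal (2 * pi)"
    by (simp add: emeasure_restrict_space)
  also have "\<dots> = 1" by (simp flip: ennreal_mult)
  finally show ?thesis .
qed

lemma abs_ln_diff_le:
  fixes x y :: real
  assumes "1 \<le> x" "1 \<le> y"
  shows "\<bar>ln x - ln y\<bar> \<le> \<bar>x - y\<bar>"
proof -
  have *: "ln x - ln y \<le> \<bar>x - y\<bar>" if "1 \<le> x" "1 \<le> y" for x y :: real
  proof -
    have "ln x - ln y = ln (x / y)" using that by (simp add: ln_div)
    also have "\<dots> \<le> x / y - 1" using that by (intro ln_le_minus_one) simp
    also have "\<dots> = (x - y) / y" using that by (simp add: field_simps)
    also have "\<dots> \<le> \<bar>x - y\<bar> / y" using that by (intro divide_right_mono) auto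
    also have "\<dots> \<le> \<bar>x - y\<bar> / 1" using that by (intro divide_left_mono) auto
    finally show ?thesis by simp
  qed
  show ?thesis using *[OF assms] *[OF assms(2,1)] by (simp add: abs_le_iff)
qed

context nontrivial_circle
begin

lemma space_mu: "space \<mu> = UNIV"
  using sets_eq_imp_space_eq[OF sets_eq] by simp

text \<open>Agreement of the moments means that the Bernstein-Szego measures converge to \<open>\<mu>\<close> on Laurent
  polynomials, where the sequence of integrals is even eventually constant.\<close>

lemma bs_integral_laurent:
  fixes h :: "complex \<Rightarrow> real"
  assumes "laurent_on_circle (\<lambda>z. complex_of_real (h z))" "continuous_on UNIV h"
  shows "\<exists>n0. \<forall>n\<ge>n0. (\<integral>z. h z \<partial>bs_measure n) = (\<integral>z. h z \<partial>\<mu>)"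
proof -
  obtain p d where p: "\<And>z. cmod z = 1 \<Longrightarrow> complex_of_real (h z) = poly p z * cnj z ^ d"
    using assms(1) unfolding laurent_on_circle_def by blast
  have c: "continuous_on UNIV (\<lambda>z. complex_of_real (h z))"
    using assms(2) by (intro continuous_intros)
  have "(\<integral>z. h z \<partial>bs_measure n) = (\<integral>z. h z \<partial>\<mu>)" if "n \<ge> max d (degree p)" for n
  proof -
    interpret bs: circle_measure "bs_measure n" by (rule circle_measure_bs)
    have "complex_of_real (\<integral>z. h z \<partial>bs_measure n) = complex_of_real (\<integral>z. h z \<partial>\<mu>)"
    proof -
      have "complex_of_real (\<integral>z. h z \<partial>bs_measure n) = (\<Sum>i\<le>degree p. coeff p i * bs.ip (monom 1 d) (monom 1 i))"
        unfolding integral_complex_of_real[symmetric] by (rule bs.integral_laurent[OF p c])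
      also have "\<dots> = (\<Sum>i\<le>degree p. coeff p i * ip (monom 1 d) (monom 1 i))"
        using that by (intro sum.cong refl) (simp add: bs_moments)
      also have "\<dots> = complex_of_real (\<integral>z. h z \<partial>\<mu>)"
        unfolding integral_complex_of_real[symmetric] by (rule integral_laurent[OF p c, symmetric])
      finally show ?thesis .
    qed
    then show ?thesis by (simp only: of_real_eq_iff)
  qed
  then show ?thesis by blast
qed

lemma laurent_norm_square:
  "laurent_on_circle (\<lambda>z. complex_of_real ((cmod (\<Sum>m\<le>N. q m * z ^ m))\<^sup>2))"
proof -
  have "poly (\<Sum>m\<le>N. monom (q m) m) z = (\<Sum>m\<le>N. q m * z ^ m)" for z
    by (simp add: poly_sum poly_monom)
  then show ?thesis
    using laurent_mult[OF laurent_poly[of "\<Sum>m\<le>N. monom (q m) m"] laurent_cnj_poly[of "\<Sum>m\<le>N. monom (q m) m"]]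
    by (simp only: complex_norm_square)
qed

text \<open>The inequality \<open>ln (p x) \<le> p x\<close>, with \<open>x\<close> the Bernstein-Szego weight of a sufficiently large
  index.\<close>

lemma entropy_variational:
  assumes C: "\<And>n. C \<le> bs_entropy N q n"
    and p: "laurent_on_circle (\<lambda>z. complex_of_real (p z))" "continuous_on UNIV p" "\<And>z. cmod z = 1 \<Longrightarrow> 1 \<le> p z"
  shows "(\<integral>\<theta>. (cmod (\<Sum>m\<le>N. q m * cis \<theta> ^ m))\<^sup>2 * ln (p (cis \<theta>)) \<partial>d\<theta>)
    \<le> 2 * pi * (\<integral>z. (cmod (\<Sum>m\<le>N. q m * z ^ m))\<^sup>2 * p z \<partial>\<mu>) - C"
proof -
  let ?Q = "\<lambda>z. (cmod (\<Sum>m\<le>N. q m * z ^ m))\<^sup>2"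
  have cont: "continuous_on UNIV (\<lambda>z. ?Q z * p z)"
    using p(2) by (intro continuous_intros)
  have "laurent_on_circle (\<lambda>z. complex_of_real (?Q z * p z))"
    unfolding of_real_mult by (intro laurent_mult laurent_norm_square p)
  from bs_integral_laurent[OF this cont] obtain n
    where n: "(\<integral>z. ?Q z * p z \<partial>bs_measure n) = (\<integral>z. ?Q z * p z \<partial>\<mu>)" by blast
  have bs: "bs_weight n \<theta> = \<kappa> n / (cmod (poly (R n) (cis \<theta>)))\<^sup>2" for \<theta>
    by (simp add: bs_weight_def)
  have cs: "continuous_on (sphere 0 1) (\<lambda>z. \<kappa> n / (cmod (poly (R n) z))\<^sup>2)"
    using R_zero_free by (intro continuous_intros) auto
  have p': "continuous_on (sphere 0 1) p" using p(2) by (rule continuous_on_subset) simp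
  have int1: "integrable d\<theta> (\<lambda>\<theta>. ?Q (cis \<theta>) * ln (bs_weight n \<theta>))"
    unfolding bs using R_zero_free \<kappa>_pos[of n] by (intro integrable_dtheta_circle continuous_intros) auto
  have int2: "integrable d\<theta> (\<lambda>\<theta>. bs_weight n \<theta> * (?Q (cis \<theta>) * p (cis \<theta>)))"
    unfolding bs by (intro integrable_dtheta_circle continuous_intros cs p')
  have int3: "integrable d\<theta> (\<lambda>\<theta>. ?Q (cis \<theta>) * ln (p (cis \<theta>)))"
    using p(3) by (intro integrable_dtheta_circle continuous_intros p') fastforce
  have "C \<le> (\<integral>\<theta>. ?Q (cis \<theta>) * ln (bs_weight n \<theta>) \<partial>d\<theta>)"
    using C[of n] by (simp add: bs_entropy_def)
  also have "\<dots> \<le> (\<integral>\<theta>. bs_weight n \<theta> * (?Q (cis \<theta>) * p (cis \<theta>)) - ?Q (cis \<theta>) * ln (p (cis \<theta>)) \<partial>d\<theta>)"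
  proof (intro integral_mono int1 Bochner_Integration.integrable_diff int2 int3)
    fix \<theta> :: real
    have pos: "0 < bs_weight n \<theta>" "0 < p (cis \<theta>)"
      using p(3)[of "cis \<theta>"] bs_weight_pos by auto
    then have "ln (bs_weight n \<theta>) + ln (p (cis \<theta>)) = ln (bs_weight n \<theta> * p (cis \<theta>))"
      by (simp add: ln_mult)
    also have "\<dots> \<le> bs_weight n \<theta> * p (cis \<theta>)"
      using pos ln_le_minus_one[of "bs_weight n \<theta> * p (cis \<theta>)"] by simp
    finally have "ln (bs_weight n \<theta>) \<le> bs_weight n \<theta> * p (cis \<theta>) - ln (p (cis \<theta>))" by simp
    from mult_left_mono[OF this, of "?Q (cis \<theta>)"]
    show "?Q (cis \<theta>) * ln (bs_weight n \<theta>) \<le> bs_weight n \<theta> * (?Q (cis \<theta>) * p (cis \<theta>)) - ?Q (cis \<theta>) * ln (p (cis \<theta>))"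
      by (simp add: algebra_simps)
  qed
  also have "\<dots> = (\<integral>\<theta>. bs_weight n \<theta> * (?Q (cis \<theta>) * p (cis \<theta>)) \<partial>d\<theta>) - (\<integral>\<theta>. ?Q (cis \<theta>) * ln (p (cis \<theta>)) \<partial>d\<theta>)"
    by (intro Bochner_Integration.integral_diff int2 int3)
  also have "(\<integral>\<theta>. bs_weight n \<theta> * (?Q (cis \<theta>) * p (cis \<theta>)) \<partial>d\<theta>) = 2 * pi * (\<integral>z. ?Q z * p z \<partial>bs_measure n)"
    unfolding bs_measure_def
    by (subst integral_ac(1)) (auto simp: less_imp_le[OF bs_weight_pos] intro!: borel_measurable_continuous_onI cont)
  finally show ?thesis unfolding n by simp
qed

text \<open>The distances obtained are merely bounded, which is all that is needed. The bound \<open>3\<close> is made up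
  of \<open>1\<close> for the continuous approximation, \<open>1\<close> for the uniform error of the Stone-Weierstrass
  theorem, and \<open>1\<close> for the constant added to keep the polynomial at least \<open>1\<close>.\<close>

lemma trig_poly_approx:
  fixes g :: "complex \<Rightarrow> real"
  assumes g: "g \<in> borel_measurable borel" "\<And>z. 1 \<le> g z" "\<And>z. g z \<le> B"
  obtains p where "laurent_on_circle (\<lambda>z. complex_of_real (p z))" "continuous_on UNIV p"
    "\<And>z. cmod z = 1 \<Longrightarrow> 1 \<le> p z"
    "(\<integral>\<^sup>+z. ennreal \<bar>p z - g z\<bar> \<partial>\<mu>) \<le> 3" "(\<integral>\<^sup>+z. ennreal \<bar>p z - g z\<bar> \<partial>arc_measure) \<le> 3"
proof -
  interpret arc: circle_measure arc_measure by (rule circle_measure_arc)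
  have "0 \<le> g z" for z using g(2)[of z] by linarith
  then have "approximable \<mu> arc_measure g"
    using g by (intro approximable_bounded[where B = B] finite_measure_axioms arc.finite_measure_axioms sets_eq arc.sets_eq) auto
  then obtain f where f: "continuous_on UNIV f" "(\<integral>\<^sup>+z. ennreal \<bar>f z - g z\<bar> \<partial>\<mu>) < ennreal 1"
    "(\<integral>\<^sup>+z. ennreal \<bar>f z - g z\<bar> \<partial>arc_measure) < ennreal 1"
    unfolding approximable_def by (meson zero_less_one)
  have "continuous_on (sphere 0 1) (\<lambda>z. max 1 (f z))"
    using f(1) by (intro continuous_intros) (auto intro: continuous_on_subset)
  then obtain p0 where p0: "real_polynomial_function p0" "\<And>z. z \<in> sphere 0 1 \<Longrightarrow> \<bar>max 1 (f z) - p0 z\<bar> < 1"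
    using Stone_Weierstrass_real_polynomial_function[of "sphere (0::complex) 1" "\<lambda>z. max 1 (f z)" 1] by auto
  define p where "p z = p0 z + 1" for z
  have p: "real_polynomial_function p"
    unfolding p_def by (intro real_polynomial_function.intros p0)
  have *: "(\<integral>\<^sup>+z. ennreal \<bar>p z - g z\<bar> \<partial>M) \<le> 3"
    if M: "circle_measure M" "emeasure M UNIV = 1" "(\<integral>\<^sup>+z. ennreal \<bar>f z - g z\<bar> \<partial>M) < ennreal 1" for M
  proof -
    interpret M: circle_measure M by fact
    note [measurable] = g(1) borel_measurable_continuous_onI[OF f(1)]
    have "space M = UNIV" using sets_eq_imp_space_eq[OF M.sets_eq] by simp
    have "(\<integral>\<^sup>+z. ennreal \<bar>p z - g z\<bar> \<partial>M) \<le> (\<integral>\<^sup>+z. ennreal \<bar>f z - g z\<bar> + 2 \<partial>M)"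
    proof (rule nn_integral_mono_AE, rule eventually_mono[OF M.AE_circle])
      fix z :: complex assume "cmod z = 1"
      then have "\<bar>max 1 (f z) - p0 z\<bar> < 1" by (intro p0(2)) simp
      moreover have "\<bar>max 1 (f z) - g z\<bar> \<le> \<bar>f z - g z\<bar>"
        using g(2)[of z] by (cases "1 \<le> f z") (simp_all add: max_def)
      ultimately have "\<bar>p z - g z\<bar> \<le> \<bar>f z - g z\<bar> + 2"
        unfolding p_def by linarith
      then have "ennreal \<bar>p z - g z\<bar> \<le> ennreal (\<bar>f z - g z\<bar> + 2)" by (rule ennreal_leI)
      also have "\<dots> = ennreal \<bar>f z - g z\<bar> + 2" by (subst ennreal_plus) simp_all
      finally show "ennreal \<bar>p z - g z\<bar> \<le> ennreal \<bar>f z - g z\<bar> + 2" .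
    qed
    also have "\<dots> = (\<integral>\<^sup>+z. ennreal \<bar>f z - g z\<bar> \<partial>M) + 2"
      using M(2) \<open>space M = UNIV\<close> by (subst nn_integral_add) auto
    also have "\<dots> \<le> 1 + 2" using M(3) by (intro add_right_mono) simp
    finally show ?thesis by simp
  qed
  have "emeasure \<mu> UNIV = 1"
    using prob_space.emeasure_space_1[OF prob_space_mu] by (simp add: space_mu)
  show ?thesis
  proof (rule that[of p])
    show "laurent_on_circle (\<lambda>z. complex_of_real (p z))" by (rule laurent_real_polynomial[OF p])
    show "continuous_on UNIV p"
      using p by (intro continuous_on_polymonial_function) (simp add: real_polynomial_function_eq)
    show "1 \<le> p z" if "cmod z = 1" for z
      using p0(2)[of z] that unfolding p_def by auto
    show "(\<integral>\<^sup>+z. ennreal \<bar>p z - g z\<bar> \<partial>\<mu>) \<le> 3"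
      by (rule *[OF circle_measure_axioms \<open>emeasure \<mu> UNIV = 1\<close> f(2)])
    show "(\<integral>\<^sup>+z. ennreal \<bar>p z - g z\<bar> \<partial>arc_measure) \<le> 3"
      by (rule *[OF circle_measure_arc emeasure_arc_UNIV f(3)])
  qed
qed

text \<open>The bound depends on \<open>g\<close> only through its integral, and not on the upper bound \<open>B\<close>.\<close>

lemma entropy_bound:
  assumes C: "\<And>n. C \<le> bs_entropy N q n"
    and K: "\<And>z. cmod z = 1 \<Longrightarrow> (cmod (\<Sum>m\<le>N. q m * z ^ m))\<^sup>2 \<le> K"
    and g: "g \<in> borel_measurable borel" "\<And>z. 1 \<le> g z" "\<And>z. g z \<le> B"
  shows "(\<integral>\<theta>. (cmod (\<Sum>m\<le>N. q m * cis \<theta> ^ m))\<^sup>2 * ln (g (cis \<theta>)) \<partial>d\<theta>)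
    \<le> 2 * pi * K * ((\<integral>z. g z \<partial>\<mu>) + 3) - C + 6 * pi * K"
proof -
  let ?Q = "\<lambda>z. (cmod (\<Sum>m\<le>N. q m * z ^ m))\<^sup>2"
  have K0: "0 \<le> K" using K[of 1] by (smt (verit) norm_one zero_le_power2)
  obtain p where p: "laurent_on_circle (\<lambda>z. complex_of_real (p z))" "continuous_on UNIV p"
    "\<And>z. cmod z = 1 \<Longrightarrow> 1 \<le> p z" and
    p3: "(\<integral>\<^sup>+z. ennreal \<bar>p z - g z\<bar> \<partial>\<mu>) \<le> 3" "(\<integral>\<^sup>+z. ennreal \<bar>p z - g z\<bar> \<partial>arc_measure) \<le> 3"
    using trig_poly_approx[OF g] by blast
  note [measurable] = g(1) borel_measurable_continuous_onI[OF p(2)]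
  have gb: "\<bar>g z\<bar> \<le> B" for z using g(2)[of z] g(3)[of z] by linarith
  have intg: "integrable \<mu> g"
    by (rule integrable_const_bound[where B = B]) (use gb in \<open>auto simp: measurable_cong_sets[OF sets_eq refl]\<close>)
  have intp: "integrable \<mu> p" by (rule integrable_continuous[OF p(2)])
  have "(\<integral>z. \<bar>p z - g z\<bar> \<partial>\<mu>) \<le> 3"
  proof -
    have "ennreal (\<integral>z. \<bar>p z - g z\<bar> \<partial>\<mu>) = (\<integral>\<^sup>+z. ennreal \<bar>p z - g z\<bar> \<partial>\<mu>)"
      by (rule nn_integral_eq_integral[symmetric]) (auto intro!: integrable_abs intp intg Bochner_Integration.integrable_diff)
    also have "\<dots> \<le> ennreal 3" using p3(1) by simp
    finally show ?thesis by (simp only: ennreal_le_iff)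
  qed
  moreover have "(\<integral>z. p z - g z \<partial>\<mu>) \<le> (\<integral>z. \<bar>p z - g z\<bar> \<partial>\<mu>)"
    by (intro integral_mono integrable_abs Bochner_Integration.integrable_diff intp intg) auto
  ultimately have pg: "(\<integral>z. p z \<partial>\<mu>) \<le> (\<integral>z. g z \<partial>\<mu>) + 3"
    using intp intg by simp
  have Qp: "(\<integral>z. ?Q z * p z \<partial>\<mu>) \<le> (\<integral>z. K * p z \<partial>\<mu>)"
  proof (rule integral_mono_AE)
    show "integrable \<mu> (\<lambda>z. ?Q z * p z)" using p(2) by (intro integrable_continuous continuous_intros)
    show "integrable \<mu> (\<lambda>z. K * p z)" using p(2) by (intro integrable_continuous continuous_intros)
    show "AE z in \<mu>. ?Q z * p z \<le> K * p z"
    proof (rule eventually_mono[OF AE_circle])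
      fix z :: complex assume z: "cmod z = 1"
      show "?Q z * p z \<le> K * p z" using K[OF z] p(3)[OF z] by (intro mult_right_mono) auto
    qed
  qed
  have arc: "(\<integral>\<^sup>+\<theta>. ennreal \<bar>p (cis \<theta>) - g (cis \<theta>)\<bar> \<partial>d\<theta>) \<le> ennreal (6 * pi)"
  proof -
    have "(\<integral>\<^sup>+\<theta>. ennreal \<bar>p (cis \<theta>) - g (cis \<theta>)\<bar> \<partial>d\<theta>)
      = (\<integral>\<^sup>+\<theta>. ennreal (2 * pi) * (ennreal (1 / (2 * pi)) * ennreal \<bar>p (cis \<theta>) - g (cis \<theta>)\<bar>) \<partial>d\<theta>)"
      by (simp add: mult.assoc[symmetric] flip: ennreal_mult)
    also have "\<dots> = ennreal (2 * pi) * (\<integral>\<^sup>+\<theta>. ennreal (1 / (2 * pi)) * ennreal \<bar>p (cis \<theta>) - g (cis \<theta>)\<bar> \<partial>d\<theta>)"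
      by (rule nn_integral_cmult) measurable
    also have "(\<integral>\<^sup>+\<theta>. ennreal (1 / (2 * pi)) * ennreal \<bar>p (cis \<theta>) - g (cis \<theta>)\<bar> \<partial>d\<theta>)
        = (\<integral>\<^sup>+z. ennreal \<bar>p z - g z\<bar> \<partial>arc_measure)"
      by (rule nn_integral_ac[symmetric]) auto
    also have "ennreal (2 * pi) * \<dots> \<le> ennreal (2 * pi) * ennreal 3"
      using p3(2) by (intro mult_left_mono) auto
    also have "\<dots> = ennreal (6 * pi)" by (subst ennreal_mult[symmetric]) simp_all
    finally show ?thesis .
  qed
  have intpg: "integrable d\<theta> (\<lambda>\<theta>. \<bar>p (cis \<theta>) - g (cis \<theta>)\<bar>)"
    using arc by (intro integrableI_bounded) (auto simp: le_less_trans[OF arc])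
  have "ennreal (\<integral>\<theta>. \<bar>p (cis \<theta>) - g (cis \<theta>)\<bar> \<partial>d\<theta>) \<le> ennreal (6 * pi)"
    using arc by (subst nn_integral_eq_integral[symmetric, OF intpg]) auto
  then have arc': "(\<integral>\<theta>. \<bar>p (cis \<theta>) - g (cis \<theta>)\<bar> \<partial>d\<theta>) \<le> 6 * pi"
    by (subst (asm) ennreal_le_iff) auto
  have p': "continuous_on (sphere 0 1) p" using p(2) by (rule continuous_on_subset) simp
  have intlp: "integrable d\<theta> (\<lambda>\<theta>. ?Q (cis \<theta>) * ln (p (cis \<theta>)))"
    using p(3) by (intro integrable_dtheta_circle continuous_intros p') fastforce
  have intlg: "integrable d\<theta> (\<lambda>\<theta>. ?Q (cis \<theta>) * ln (g (cis \<theta>)))"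
  proof (rule integrable_dtheta_bounded)
    show "(\<lambda>\<theta>. ?Q (cis \<theta>) * ln (g (cis \<theta>))) \<in> borel_measurable d\<theta>" by measurable
    show "norm (?Q (cis \<theta>) * ln (g (cis \<theta>))) \<le> K * B" for \<theta>
    proof -
      have "\<bar>ln (g (cis \<theta>))\<bar> \<le> B"
        using g(2,3)[of "cis \<theta>"] ln_le_minus_one[of "g (cis \<theta>)"] by (simp add: abs_if)
      then show ?thesis using K[of "cis \<theta>"] K0 by (auto simp: abs_mult intro!: mult_mono)
    qed
  qed
  have "(\<integral>\<theta>. ?Q (cis \<theta>) * ln (g (cis \<theta>)) \<partial>d\<theta>)
    \<le> (\<integral>\<theta>. ?Q (cis \<theta>) * ln (p (cis \<theta>)) + K * \<bar>p (cis \<theta>) - g (cis \<theta>)\<bar> \<partial>d\<theta>)"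
  proof (intro integral_mono intlg intlp Bochner_Integration.integrable_add integrable_mult_right intpg)
    fix \<theta> :: real
    have "ln (g (cis \<theta>)) \<le> ln (p (cis \<theta>)) + \<bar>p (cis \<theta>) - g (cis \<theta>)\<bar>"
      using abs_ln_diff_le[of "p (cis \<theta>)" "g (cis \<theta>)"] p(3)[of "cis \<theta>"] g(2)[of "cis \<theta>"] by simp
    then have "?Q (cis \<theta>) * ln (g (cis \<theta>)) \<le> ?Q (cis \<theta>) * (ln (p (cis \<theta>)) + \<bar>p (cis \<theta>) - g (cis \<theta>)\<bar>)"
      by (rule mult_left_mono) simp
    also have "\<dots> \<le> ?Q (cis \<theta>) * ln (p (cis \<theta>)) + K * \<bar>p (cis \<theta>) - g (cis \<theta>)\<bar>"
      using K[of "cis \<theta>"] by (simp add: distrib_left mult_right_mono)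
    finally show "?Q (cis \<theta>) * ln (g (cis \<theta>)) \<le> ?Q (cis \<theta>) * ln (p (cis \<theta>)) + K * \<bar>p (cis \<theta>) - g (cis \<theta>)\<bar>" .
  qed
  also have "\<dots> = (\<integral>\<theta>. ?Q (cis \<theta>) * ln (p (cis \<theta>)) \<partial>d\<theta>) + K * (\<integral>\<theta>. \<bar>p (cis \<theta>) - g (cis \<theta>)\<bar> \<partial>d\<theta>)"
    using intlp intpg by (subst Bochner_Integration.integral_add) auto
  also have "\<dots> \<le> (2 * pi * (K * ((\<integral>z. g z \<partial>\<mu>) + 3)) - C) + K * (6 * pi)"
  proof (intro add_mono mult_left_mono arc' K0)
    have "(\<integral>z. ?Q z * p z \<partial>\<mu>) \<le> K * (\<integral>z. p z \<partial>\<mu>)" using Qp by simp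
    also have "\<dots> \<le> K * ((\<integral>z. g z \<partial>\<mu>) + 3)" using pg K0 by (intro mult_left_mono)
    finally have "2 * pi * (\<integral>z. ?Q z * p z \<partial>\<mu>) \<le> 2 * pi * (K * ((\<integral>z. g z \<partial>\<mu>) + 3))"
      by (intro mult_left_mono) auto
    then show "(\<integral>\<theta>. ?Q (cis \<theta>) * ln (p (cis \<theta>)) \<partial>d\<theta>) \<le> 2 * pi * (K * ((\<integral>z. g z \<partial>\<mu>) + 3)) - C"
      using entropy_variational[OF C p] by linarith
  qed
  finally show ?thesis by (simp add: mult_ac)
qed

end

section \<open>The entropy of the measure and of its approximants\<close>

text \<open>A non-trivial measure on the circle with a version \<open>w\<close> of its density.\<close>

locale circle_density = nontrivial_circle +
  fixes w :: "real \<Rightarrow> real"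
  assumes ac: "ac_density \<mu> w"
begin

lemma w_measurable [measurable]: "w \<in> borel_measurable d\<theta>"
  and w_nonneg: "\<theta> \<in> {0..<2 * pi} \<Longrightarrow> 0 \<le> w \<theta>"
  using ac by (auto simp: ac_density_def)

text \<open>The singular part lives on a set \<open>E\<close> of arc length zero, off which \<open>\<mu>\<close> coincides with its
  absolutely continuous part.\<close>

lemma singular_set:
  obtains E where "E \<in> sets borel" "AE \<theta> in d\<theta>. cis \<theta> \<notin> E"
    "\<And>B. B \<in> sets borel \<Longrightarrow> emeasure \<mu> (B - E) = emeasure (ac_circle_measure w) (B - E)"
proof -
  obtain \<nu> E where \<nu>: "sets \<nu> = sets borel"
    "\<forall>B \<in> sets borel. emeasure \<mu> B = emeasure (ac_circle_measure w) B + emeasure \<nu> B"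
    and E: "E \<in> sets borel" "emeasure \<nu> (- E) = 0" "emeasure d\<theta> {\<theta> \<in> {0..<2 * pi}. cis \<theta> \<in> E} = 0"
    using ac unfolding ac_density_def singular_circle_measure_def by blast
  show ?thesis
  proof (rule that[OF E(1)])
    have "{\<theta> \<in> space d\<theta>. cis \<theta> \<in> E} \<in> sets d\<theta>"
      using E(1) by measurable
    then show "AE \<theta> in d\<theta>. cis \<theta> \<notin> E"
      using E(3) by (intro AE_I[where N = "{\<theta> \<in> {0..<2 * pi}. cis \<theta> \<in> E}"]) auto
    fix B :: "complex set" assume B: "B \<in> sets borel"
    have "emeasure \<nu> (B - E) \<le> emeasure \<nu> (- E)"
      using E(1) \<nu>(1) by (intro emeasure_mono) auto
    then have "emeasure \<nu> (B - E) = 0" using E(2) by simp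
    then show "emeasure \<mu> (B - E) = emeasure (ac_circle_measure w) (B - E)"
      using \<nu>(2) E(1) B by simp
  qed
qed

lemma ac_le_mu: "ac_circle_measure w \<le> \<mu>"
proof -
  have "emeasure (ac_circle_measure w) B \<le> emeasure \<mu> B" if "B \<in> sets borel" for B
    using ac that unfolding ac_density_def by (metis le_iff_add)
  then show ?thesis by (subst le_measure) (auto simp: sets_eq)
qed

lemma nn_integral_ac_le:
  assumes "f \<in> borel_measurable borel"
  shows "(\<integral>\<^sup>+\<theta>. ennreal (w \<theta> / (2 * pi)) * f (cis \<theta>) \<partial>d\<theta>) \<le> (\<integral>\<^sup>+z. f z \<partial>\<mu>)"
  unfolding nn_integral_ac[OF w_measurable assms, symmetric]
  by (rule nn_integral_mono_measure[OF _ ac_le_mu]) (simp add: sets_eq)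

lemma w_integral_le: "(\<integral>\<^sup>+\<theta>. ennreal (w \<theta> / (2 * pi)) \<partial>d\<theta>) \<le> 1"
  using nn_integral_ac_le[of "\<lambda>_. 1"] prob_space.emeasure_space_1[OF prob_space_mu] by simp

text \<open>Where \<open>w\<close> vanishes, \<open>ln w\<close> is \<open>0\<close> here whereas the extended logarithm is \<open>-\<infinity>\<close>; integrability
  forces \<open>Q\<close> to vanish almost everywhere on that set, so the difference does not matter.\<close>

theorem L1_imp_entropy_bounded:
  assumes L1: "L1_ereal d\<theta> (\<lambda>\<theta>. ereal ((cmod (\<Sum>m\<le>N. q m * cis \<theta> ^ m))\<^sup>2) * elog (w \<theta>))"
  shows "\<exists>C. \<forall>n. C \<le> bs_entropy N q n"
proof -
  define F where "F \<theta> = (cmod (\<Sum>m\<le>N. q m * cis \<theta> ^ m))\<^sup>2" for \<theta>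
  have F0: "0 \<le> F \<theta>" for \<theta> by (simp add: F_def)
  obtain K where K: "\<And>\<theta>. F \<theta> \<le> K" "0 \<le> K"
    unfolding F_def using trig_poly_bounded[where N = N and q = q] by blast
  have [measurable]: "F \<in> borel_measurable d\<theta>"
    unfolding F_def by measurable
  let ?G = "\<lambda>\<theta>. ereal (F \<theta>) * elog (w \<theta>)"
  have G: "?G \<in> borel_measurable d\<theta>" "(\<integral>\<^sup>+\<theta>. e2ennreal \<bar>?G \<theta>\<bar> \<partial>d\<theta>) < \<infinity>"
    using L1 by (auto simp: L1_ereal_def F_def)
  have "AE \<theta> in d\<theta>. e2ennreal \<bar>?G \<theta>\<bar> \<noteq> \<infinity>"
    using G by (intro nn_integral_noteq_infinite) auto
  then have AE_pos: "AE \<theta> in d\<theta>. F \<theta> = 0 \<or> 0 < w \<theta>"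
  proof (rule AE_mp, intro AE_I2 impI)
    fix \<theta> assume "\<theta> \<in> space d\<theta>" and fin: "e2ennreal \<bar>?G \<theta>\<bar> \<noteq> \<infinity>"
    show "F \<theta> = 0 \<or> 0 < w \<theta>"
    proof (rule ccontr)
      assume "\<not> ?thesis"
      then have "w \<theta> = 0" "0 < F \<theta>" using w_nonneg[of \<theta>] F0[of \<theta>] \<open>\<theta> \<in> space d\<theta>\<close> by auto
      then have "\<bar>?G \<theta>\<bar> = \<infinity>" by (simp add: elog_def)
      with fin show False by simp
    qed
  qed
  have intFw: "integrable d\<theta> (\<lambda>\<theta>. F \<theta> * ln (w \<theta>))"
  proof (rule integrableI_bounded)
    have "(\<integral>\<^sup>+\<theta>. ennreal (norm (F \<theta> * ln (w \<theta>))) \<partial>d\<theta>) \<le> (\<integral>\<^sup>+\<theta>. e2ennreal \<bar>?G \<theta>\<bar> \<partial>d\<theta>)"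
    proof (rule nn_integral_mono)
      fix \<theta>
      show "ennreal (norm (F \<theta> * ln (w \<theta>))) \<le> e2ennreal \<bar>?G \<theta>\<bar>"
        by (cases "w \<theta> = 0") (simp_all add: elog_def e2ennreal_ereal)
    qed
    also note G(2)
    finally show "(\<integral>\<^sup>+\<theta>. ennreal (norm (F \<theta> * ln (w \<theta>))) \<partial>d\<theta>) < \<infinity>" .
  qed measurable
  have "(\<integral>\<theta>. F \<theta> * ln (w \<theta>) \<partial>d\<theta>) - 2 * pi * K \<le> bs_entropy N q n" for n
  proof -
    define D where "D \<theta> = w \<theta> / (2 * pi) * (cmod (poly (R n) (cis \<theta>)))\<^sup>2" for \<theta>
    have [measurable]: "(\<lambda>\<theta>. cmod (poly (R n) (cis \<theta>))) \<in> borel_measurable d\<theta>"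
      by (intro borel_measurable_dtheta_continuous continuous_intros)
    have Dm: "D \<in> borel_measurable d\<theta>" unfolding D_def by measurable
    have D0: "0 \<le> D \<theta>" if "\<theta> \<in> {0..<2*pi}" for \<theta> using w_nonneg[OF that] by (simp add: D_def)
    have "(\<integral>\<^sup>+\<theta>. ennreal (D \<theta>) \<partial>d\<theta>)
      = (\<integral>\<^sup>+\<theta>. ennreal (w \<theta> / (2 * pi)) * ennreal ((cmod (poly (P n) (cis \<theta>)))\<^sup>2) \<partial>d\<theta>)"
    proof (rule nn_integral_cong)
      fix \<theta> assume "\<theta> \<in> space d\<theta>"
      then have "0 \<le> w \<theta> / (2 * pi)" using w_nonneg[of \<theta>] by simp
      moreover have "cmod (poly (P n) (cis \<theta>)) = cmod (poly (R n) (cis \<theta>))"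
        by (rule norm_P_eq_norm_R) simp
      ultimately show "ennreal (D \<theta>) = ennreal (w \<theta> / (2 * pi)) * ennreal ((cmod (poly (P n) (cis \<theta>)))\<^sup>2)"
        unfolding D_def by (simp only: ennreal_mult zero_le_power2)
    qed
    also have "\<dots> \<le> (\<integral>\<^sup>+z. ennreal ((cmod (poly (P n) z))\<^sup>2) \<partial>\<mu>)"
      by (rule nn_integral_ac_le) (auto intro!: borel_measurable_continuous_onI continuous_intros)
    also have "\<dots> = ennreal (\<integral>z. (cmod (poly (P n) z))\<^sup>2 \<partial>\<mu>)"
      by (rule nn_integral_eq_integral) (auto intro!: integrable_continuous continuous_intros)
    also have "(\<integral>z. (cmod (poly (P n) z))\<^sup>2 \<partial>\<mu>) = \<kappa> n"
      using ip_P_P[of n] unfolding ip_self of_real_eq_iff .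
    finally have nnD: "(\<integral>\<^sup>+\<theta>. ennreal (D \<theta>) \<partial>d\<theta>) \<le> ennreal (\<kappa> n)" .
    have AED: "AE \<theta> in d\<theta>. 0 \<le> D \<theta>" using D0 by (intro AE_I2) simp
    have intD: "integrable d\<theta> D"
      by (rule integrableI_nonneg[OF Dm AED]) (rule le_less_trans[OF nnD], simp)
    have "ennreal (\<integral>\<theta>. D \<theta> \<partial>d\<theta>) \<le> ennreal (\<kappa> n)"
      using nnD by (simp only: nn_integral_eq_integral[OF intD AED])
    then have D_le: "(\<integral>\<theta>. D \<theta> \<partial>d\<theta>) \<le> \<kappa> n"
      using \<kappa>_pos[of n] by (simp add: ennreal_le_iff)
    have intB: "integrable d\<theta> (\<lambda>\<theta>. F \<theta> * ln (bs_weight n \<theta>))"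
      unfolding bs_weight_def F_def using R_zero_free \<kappa>_pos[of n]
      by (intro integrable_dtheta_circle[where \<phi> = "\<lambda>z. (cmod (\<Sum>m\<le>N. q m * z ^ m))\<^sup>2 * ln (\<kappa> n / (cmod (poly (R n) z))\<^sup>2)"]
          continuous_intros) auto
    have "(\<integral>\<theta>. F \<theta> * ln (w \<theta>) \<partial>d\<theta>) \<le> (\<integral>\<theta>. F \<theta> * ln (bs_weight n \<theta>) + (2 * pi * K / \<kappa> n) * D \<theta> \<partial>d\<theta>)"
    proof (intro integral_mono_AE intFw Bochner_Integration.integrable_add intB integrable_mult_right intD)
      show "AE \<theta> in d\<theta>. F \<theta> * ln (w \<theta>) \<le> F \<theta> * ln (bs_weight n \<theta>) + (2 * pi * K / \<kappa> n) * D \<theta>"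
        using AE_pos
      proof (rule AE_mp, intro AE_I2 impI)
        fix \<theta> assume \<theta>: "\<theta> \<in> space d\<theta>" and "F \<theta> = 0 \<or> 0 < w \<theta>"
        then have D\<theta>: "0 \<le> D \<theta>" using D0 by simp
        have nn: "0 \<le> (2 * pi * K / \<kappa> n) * D \<theta>" using D\<theta> K(2) \<kappa>_pos[of n] by simp
        show "F \<theta> * ln (w \<theta>) \<le> F \<theta> * ln (bs_weight n \<theta>) + (2 * pi * K / \<kappa> n) * D \<theta>"
        proof (cases "F \<theta> = 0")
          case True
          then show ?thesis using nn by simp
        next
          case False
          then have w: "0 < w \<theta>" using \<open>F \<theta> = 0 \<or> 0 < w \<theta>\<close> by simp
          have "ln (w \<theta>) - ln (bs_weight n \<theta>) = ln (w \<theta> / bs_weight n \<theta>)"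
            using w bs_weight_pos[of n \<theta>] by (simp add: ln_div)
          also have "\<dots> \<le> w \<theta> / bs_weight n \<theta>"
            using ln_le_minus_one[of "w \<theta> / bs_weight n \<theta>"] w bs_weight_pos[of n \<theta>] by simp
          finally have "F \<theta> * (ln (w \<theta>) - ln (bs_weight n \<theta>)) \<le> F \<theta> * (w \<theta> / bs_weight n \<theta>)"
            using F0 by (intro mult_left_mono)
          also have "\<dots> \<le> K * (w \<theta> / bs_weight n \<theta>)"
            using K(1) w bs_weight_pos[of n \<theta>] by (intro mult_right_mono) auto
          also have "\<dots> = (2 * pi * K / \<kappa> n) * D \<theta>"
            using \<kappa>_pos[of n] by (simp add: D_def bs_weight_def)
          finally show ?thesis by (simp add: algebra_simps)
        qed
      qed
    qed
    also have "\<dots> = bs_entropy N q n + (2 * pi * K / \<kappa> n) * (\<integral>\<theta>. D \<theta> \<partial>d\<theta>)"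
      using intB intD by (subst Bochner_Integration.integral_add) (auto simp: bs_entropy_def F_def)
    also have "(2 * pi * K / \<kappa> n) * (\<integral>\<theta>. D \<theta> \<partial>d\<theta>) \<le> (2 * pi * K / \<kappa> n) * \<kappa> n"
      using D_le K(2) \<kappa>_pos[of n] by (intro mult_left_mono) auto
    also have "(2 * pi * K / \<kappa> n) * \<kappa> n = 2 * pi * K" using \<kappa>_pos[of n] by simp
    finally show ?thesis by simp
  qed
  then show ?thesis by blast
qed

lemma borel_measurable_Arg2pi: "Arg2pi \<in> borel_measurable borel"
proof -
  have cl: "closed (\<real>\<^sub>\<ge>\<^sub>0 :: complex set)" by (rule closed_nonneg_Reals_complex)
  have "(\<lambda>z. if z \<in> \<real>\<^sub>\<ge>\<^sub>0 then 0 else Arg2pi z) \<in> borel_measurable borel"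
  proof (rule borel_measurable_continuous_on_if)
    show "continuous_on (- \<real>\<^sub>\<ge>\<^sub>0) Arg2pi"
      by (intro continuous_at_imp_continuous_on ballI continuous_at_Arg2pi) simp
  qed (use cl in \<open>auto intro: continuous_intros\<close>)
  moreover have "(\<lambda>z. if z \<in> \<real>\<^sub>\<ge>\<^sub>0 then 0 else Arg2pi z) = Arg2pi"
    by (auto simp: fun_eq_iff Arg2pi_eq_0 complex_nonneg_Reals_iff complex_is_Real_iff)
  ultimately show ?thesis by simp
qed

text \<open>A Borel function on the plane that represents the density, which is only given as a Lebesgue
  measurable function of the angle.\<close>

lemma density_on_circle:
  obtains W :: "complex \<Rightarrow> real" where "W \<in> borel_measurable borel" "\<And>z. 0 \<le> W z"
    "AE \<theta> in d\<theta>. W (cis \<theta>) = w \<theta>"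
proof -
  have "(\<lambda>\<theta>. indicator {0..<2*pi} \<theta> *\<^sub>R w \<theta>) \<in> borel_measurable lebesgue"
    using w_measurable by (subst (asm) borel_measurable_restrict_space_iff) auto
  then obtain v where v: "v \<in> borel_measurable lborel"
    "AE \<theta> in lborel. indicator {0..<2*pi} \<theta> *\<^sub>R w \<theta> = v \<theta>"
    using completion_ex_borel_measurable_real by blast
  have "AE \<theta> in lebesgue. indicator {0..<2*pi} \<theta> *\<^sub>R w \<theta> = v \<theta>"
    using v(2) by (rule AE_completion)
  then have "AE \<theta> in d\<theta>. w \<theta> = v \<theta>"
    by (subst AE_restrict_space_iff) (auto elim!: eventually_mono)
  then have AEv: "AE \<theta> in d\<theta>. w \<theta> = v \<theta>" .
  have eq: "max 0 (v (Arg2pi (cis \<theta>))) = w \<theta>" if "\<theta> \<in> {0..<2*pi}" "w \<theta> = v \<theta>" for \<theta>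
  proof -
    have "Arg2pi (cis \<theta>) = \<theta>"
      using that(1) by (intro Arg2pi_unique[of 1]) (auto simp: cis_conv_exp)
    then show ?thesis using that w_nonneg[of \<theta>] by simp
  qed
  have "AE \<theta> in d\<theta>. max 0 (v (Arg2pi (cis \<theta>))) = w \<theta>"
    by (rule AE_mp[OF AEv], intro AE_I2 impI eq) simp_all
  moreover have "(\<lambda>z. max 0 (v (Arg2pi z))) \<in> borel_measurable borel"
    using v(1) borel_measurable_Arg2pi by simp
  ultimately show ?thesis by (intro that[of "\<lambda>z. max 0 (v (Arg2pi z))"]) auto
qed

text \<open>The test functions approximate the larger of \<open>1\<close> and the reciprocal of the density off the
  singular set; their integrals are bounded uniformly in \<open>e\<close>.\<close>

lemma test_function_integral:
  assumes E: "E \<in> sets borel" "\<And>B. B \<in> sets borel \<Longrightarrow> emeasure \<mu> (B - E) = emeasure (ac_circle_measure w) (B - E)"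
    and W: "W \<in> borel_measurable borel" "\<And>z. 0 \<le> W z" "AE \<theta> in d\<theta>. W (cis \<theta>) = w \<theta>"
    and e: "0 < e"
  shows "(\<integral>\<^sup>+z. ennreal (if z \<in> E then 1 else max 1 (1 / (W z + e))) \<partial>\<mu>) \<le> 2"
proof -
  let ?h = "\<lambda>z. ennreal (1 / (W z + e))"
  note [measurable] = E(1) W(1)
  have [measurable_cong]: "sets (ac_circle_measure w) = sets borel" by simp
  have dens: "density \<mu> (indicator (- E)) = density (ac_circle_measure w) (indicator (- E))"
  proof (rule measure_eqI)
    fix X assume "X \<in> sets (density \<mu> (indicator (- E)))"
    then have X: "X \<in> sets borel" by (simp add: sets_eq)
    have "- E \<inter> X = X - E" by blast
    then show "emeasure (density \<mu> (indicator (- E))) X = emeasure (density (ac_circle_measure w) (indicator (- E))) X"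
      using X E by (simp add: emeasure_restricted sets_eq)
  qed (simp add: sets_eq)
  have "(\<integral>\<^sup>+z. ennreal (if z \<in> E then 1 else max 1 (1 / (W z + e))) \<partial>\<mu>)
    \<le> (\<integral>\<^sup>+z. 1 + indicator (- E) z * ?h z \<partial>\<mu>)"
  proof (rule nn_integral_mono)
    fix z
    have h0: "0 \<le> 1 / (W z + e)" using W(2)[of z] e by simp
    then have "ennreal (max 1 (1 / (W z + e))) \<le> ennreal (1 + 1 / (W z + e))"
      by (intro ennreal_leI) auto
    also have "\<dots> = 1 + ennreal (1 / (W z + e))"
      using h0 by (subst ennreal_plus) auto
    finally show "ennreal (if z \<in> E then 1 else max 1 (1 / (W z + e))) \<le> 1 + indicator (- E) z * ?h z"
      by (auto simp: indicator_def)
  qed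
  also have "\<dots> = 1 + (\<integral>\<^sup>+z. indicator (- E) z * ?h z \<partial>\<mu>)"
    using prob_space.emeasure_space_1[OF prob_space_mu]
    by (subst nn_integral_add) auto
  also have "(\<integral>\<^sup>+z. indicator (- E) z * ?h z \<partial>\<mu>) = (\<integral>\<^sup>+z. ?h z \<partial>density \<mu> (indicator (- E)))"
    by (subst nn_integral_density) auto
  also have "\<dots> = (\<integral>\<^sup>+z. indicator (- E) z * ?h z \<partial>ac_circle_measure w)"
    unfolding dens by (subst nn_integral_density) auto
  also have "\<dots> \<le> (\<integral>\<^sup>+z. ?h z \<partial>ac_circle_measure w)"
    by (intro nn_integral_mono) (auto simp: indicator_def)
  also have "\<dots> = (\<integral>\<^sup>+\<theta>. ennreal (w \<theta> / (2 * pi)) * ?h (cis \<theta>) \<partial>d\<theta>)"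
    by (rule nn_integral_ac) auto
  also have "\<dots> \<le> (\<integral>\<^sup>+\<theta>. ennreal (1 / (2 * pi)) \<partial>d\<theta>)"
    using W(3)
  proof (intro nn_integral_mono_AE, elim AE_mp, intro AE_I2 impI)
    fix \<theta> assume "\<theta> \<in> space d\<theta>" "W (cis \<theta>) = w \<theta>"
    then have w: "0 \<le> w \<theta>" "W (cis \<theta>) = w \<theta>" using w_nonneg by auto
    have "w \<theta> / (2 * pi) * (1 / (w \<theta> + e)) \<le> 1 / (2 * pi)"
    proof -
      have "w \<theta> / (w \<theta> + e) \<le> 1" using w e by simp
      then have "w \<theta> / (w \<theta> + e) * (1 / (2 * pi)) \<le> 1 * (1 / (2 * pi))"
        by (rule mult_right_mono) simp
      then show ?thesis by (simp add: mult.commute)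
    qed
    then show "ennreal (w \<theta> / (2 * pi)) * ?h (cis \<theta>) \<le> ennreal (1 / (2 * pi))"
      using w e by (simp add: ennreal_leI flip: ennreal_mult)
  qed
  also have "\<dots> = 1"
    by (simp add: emeasure_restrict_space flip: ennreal_mult)
  finally show ?thesis by (simp add: add_left_mono)
qed

theorem entropy_bounded_imp_L1:
  assumes C: "\<And>n. C \<le> bs_entropy N q n"
  shows "L1_ereal d\<theta> (\<lambda>\<theta>. ereal ((cmod (\<Sum>m\<le>N. q m * cis \<theta> ^ m))\<^sup>2) * elog (w \<theta>))"
proof -
  define F where "F \<theta> = (cmod (\<Sum>m\<le>N. q m * cis \<theta> ^ m))\<^sup>2" for \<theta>
  have F0: "0 \<le> F \<theta>" for \<theta> by (simp add: F_def)
  obtain K where K: "\<And>\<theta>. F \<theta> \<le> K" "0 \<le> K"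
    unfolding F_def using trig_poly_bounded[where N = N and q = q] by blast
  have K': "(cmod (\<Sum>m\<le>N. q m * z ^ m))\<^sup>2 \<le> K" if "cmod z = 1" for z
  proof -
    have "z \<noteq> 0" using that by auto
    then have "cis (Arg z) = z" using that by (simp add: cis_Arg sgn_div_norm)
    then show ?thesis using K(1)[of "Arg z"] by (simp add: F_def)
  qed
  have Fm [measurable]: "F \<in> borel_measurable d\<theta>"
    unfolding F_def by measurable
  let ?G = "\<lambda>\<theta>. ereal (F \<theta>) * elog (w \<theta>)"
  have Gm: "?G \<in> borel_measurable d\<theta>"
    unfolding elog_def by measurable
  obtain E where E: "E \<in> sets borel" "AE \<theta> in d\<theta>. cis \<theta> \<notin> E"
    "\<And>B. B \<in> sets borel \<Longrightarrow> emeasure \<mu> (B - E) = emeasure (ac_circle_measure w) (B - E)"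
    using singular_set by blast
  obtain W where W: "W \<in> borel_measurable borel" "\<And>z. 0 \<le> W z" "AE \<theta> in d\<theta>. W (cis \<theta>) = w \<theta>"
    using density_on_circle by blast
  note [measurable] = E(1) W(1)
  \<comment> \<open>Bounded test functions with \<open>\<epsilon> = 1 / (m + 1)\<close>.\<close>
  define g where "g m z = (if z \<in> E then 1 else max 1 (1 / (W z + 1 / real (Suc m))))" for m z
  have gm: "g m \<in> borel_measurable borel" for m unfolding g_def by measurable
  have g1: "1 \<le> g m z" for m z by (simp add: g_def)
  have gB: "g m z \<le> real (Suc m)" for m z
  proof -
    have "1 / (W z + 1 / real (Suc m)) \<le> 1 / (1 / real (Suc m))"
      using W(2)[of z] by (intro frac_le) auto
    then show ?thesis by (simp add: g_def)
  qed
  define C0 where "C0 = 2 * pi * K * (2 + 3) - C + 6 * pi * K"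
  define H where "H m \<theta> = F \<theta> * ln (max 1 (1 / (w \<theta> + 1 / real (Suc m))))" for m \<theta>
  have Hm [measurable]: "H m \<in> borel_measurable d\<theta>" for m unfolding H_def by measurable
  have Hint: "(\<integral>\<^sup>+\<theta>. ennreal (H m \<theta>) \<partial>d\<theta>) \<le> ennreal C0" for m
  proof -
    have nng: "(\<integral>\<^sup>+z. ennreal (g m z) \<partial>\<mu>) \<le> 2"
      unfolding g_def by (rule test_function_integral[OF E(1,3) W]) auto
    have intg: "integrable \<mu> (g m)"
      using g1[of m] gm[of m] order_trans[OF zero_le_one g1[of m]]
      by (intro integrableI_nonneg le_less_trans[OF nng]) (auto simp: measurable_cong_sets[OF sets_eq refl])
    have "ennreal (\<integral>z. g m z \<partial>\<mu>) \<le> ennreal 2"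
      using nng order_trans[OF zero_le_one g1[of m]] by (subst nn_integral_eq_integral[symmetric, OF intg]) auto
    then have "(\<integral>z. g m z \<partial>\<mu>) \<le> 2" by (simp only: ennreal_le_iff)
    then have "2 * pi * K * ((\<integral>z. g m z \<partial>\<mu>) + 3) \<le> 2 * pi * K * (2 + 3)"
      using K(2) by (intro mult_left_mono add_right_mono) auto
    then have le: "(\<integral>\<theta>. F \<theta> * ln (g m (cis \<theta>)) \<partial>d\<theta>) \<le> C0"
      using entropy_bound[OF C K' gm g1 gB, of m] unfolding F_def C0_def by linarith
    have nonneg: "0 \<le> F \<theta> * ln (g m (cis \<theta>))" for \<theta>
      using F0[of \<theta>] g1[of m "cis \<theta>"] by simp
    have int: "integrable d\<theta> (\<lambda>\<theta>. F \<theta> * ln (g m (cis \<theta>)))"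
    proof (rule integrable_dtheta_bounded)
      note [measurable] = gm[of m]
      show "(\<lambda>\<theta>. F \<theta> * ln (g m (cis \<theta>))) \<in> borel_measurable d\<theta>" by measurable
      show "norm (F \<theta> * ln (g m (cis \<theta>))) \<le> K * real (Suc m)" for \<theta>
      proof -
        have "\<bar>ln (g m (cis \<theta>))\<bar> \<le> real (Suc m)"
          using g1[of m "cis \<theta>"] gB[of m "cis \<theta>"] ln_le_minus_one[of "g m (cis \<theta>)"] by simp
        then show ?thesis using K(1)[of \<theta>] K(2) F0[of \<theta>] by (auto simp: abs_mult intro!: mult_mono)
      qed
    qed
    have "(\<integral>\<^sup>+\<theta>. ennreal (H m \<theta>) \<partial>d\<theta>) = (\<integral>\<^sup>+\<theta>. ennreal (F \<theta> * ln (g m (cis \<theta>))) \<partial>d\<theta>)"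
    proof (rule nn_integral_cong_AE)
      show "AE \<theta> in d\<theta>. ennreal (H m \<theta>) = ennreal (F \<theta> * ln (g m (cis \<theta>)))"
        using E(2) W(3) by eventually_elim (simp add: H_def g_def)
    qed
    also have "\<dots> = ennreal (\<integral>\<theta>. F \<theta> * ln (g m (cis \<theta>)) \<partial>d\<theta>)"
      by (rule nn_integral_eq_integral[OF int]) (simp add: nonneg)
    also have "\<dots> \<le> ennreal C0" by (rule ennreal_leI[OF le])
    finally show ?thesis .
  qed
  \<comment> \<open>Fatou's lemma for \<open>m \<rightarrow> \<infinity>\<close>; the limit of \<open>H m\<close> is \<open>F\<close> times the negative part of \<open>log w\<close>.\<close>
  have "(\<integral>\<^sup>+\<theta>. liminf (\<lambda>m. ennreal (H m \<theta>)) \<partial>d\<theta>) \<le> liminf (\<lambda>m. \<integral>\<^sup>+\<theta>. ennreal (H m \<theta>) \<partial>d\<theta>)"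
    by (rule nn_integral_liminf) measurable
  also have "\<dots> \<le> ennreal C0"
    using Hint by (intro Liminf_le) auto
  finally have lim: "(\<integral>\<^sup>+\<theta>. liminf (\<lambda>m. ennreal (H m \<theta>)) \<partial>d\<theta>) \<le> ennreal C0" .
  have pointwise: "e2ennreal \<bar>?G \<theta>\<bar> \<le> liminf (\<lambda>m. ennreal (H m \<theta>)) + ennreal (2 * pi * K) * ennreal (w \<theta> / (2 * pi))"
    if "\<theta> \<in> {0..<2*pi}" for \<theta>
  proof -
    have seq: "(\<lambda>m. 1 / real (Suc m)) \<longlonglongrightarrow> 0" by (rule LIMSEQ_Suc[OF lim_1_over_n])
    have w0: "0 \<le> w \<theta>" by (rule w_nonneg[OF that])
    consider "F \<theta> = 0" | "F \<theta> > 0" "w \<theta> = 0" | "F \<theta> > 0" "w \<theta> > 0" using F0[of \<theta>] w0 by linarith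
    then show ?thesis
    proof cases
      case 1
      then have "?G \<theta> = 0" by (simp flip: zero_ereal_def)
      then have "e2ennreal \<bar>?G \<theta>\<bar> = 0" by (simp only: abs_zero e2ennreal_ereal zero_ereal_def abs_ereal.simps ennreal_0)
      then show ?thesis by (simp only: zero_le)
    next
      case 2
      have "filterlim (\<lambda>m. ln (real (Suc m))) at_top sequentially"
        by (intro filterlim_compose[OF ln_at_top] filterlim_compose[OF filterlim_real_sequentially filterlim_Suc])
      then have "filterlim (\<lambda>m. F \<theta> * ln (real (Suc m))) at_top sequentially"
        using 2(1) by (intro filterlim_tendsto_pos_mult_at_top[OF tendsto_const])
      moreover have "H m \<theta> = F \<theta> * ln (real (Suc m))" for m
        by (simp add: H_def 2 max_def)
      ultimately have "(\<lambda>m. ennreal (H m \<theta>)) \<longlonglongrightarrow> top"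
        by (simp add: ennreal_tendsto_top_eq_at_top)
      then have "liminf (\<lambda>m. ennreal (H m \<theta>)) = top" by (intro lim_imp_Liminf) auto
      then show ?thesis by simp
    next
      case 3
      have "(\<lambda>m. H m \<theta>) \<longlonglongrightarrow> F \<theta> * ln (max 1 (1 / (w \<theta> + 0)))"
        unfolding H_def using 3 seq by (intro tendsto_intros) (auto simp: max_def)
      then have "(\<lambda>m. ennreal (H m \<theta>)) \<longlonglongrightarrow> ennreal (F \<theta> * ln (max 1 (1 / w \<theta>)))"
        by (intro tendsto_ennrealI) simp
      then have l: "liminf (\<lambda>m. ennreal (H m \<theta>)) = ennreal (F \<theta> * ln (max 1 (1 / w \<theta>)))"
        by (intro lim_imp_Liminf) auto
      have "\<bar>ln (w \<theta>)\<bar> \<le> ln (max 1 (1 / w \<theta>)) + w \<theta>"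
      proof (cases "1 \<le> w \<theta>")
        case True
        then show ?thesis using ln_le_minus_one[of "w \<theta>"] by (auto simp: max_def)
      next
        case False
        then have "ln (w \<theta>) \<le> 0" "1 \<le> 1 / w \<theta>" using 3 by auto
        then show ?thesis using 3 by (simp add: ln_div max_def)
      qed
      then have "\<bar>F \<theta> * ln (w \<theta>)\<bar> \<le> F \<theta> * ln (max 1 (1 / w \<theta>)) + F \<theta> * w \<theta>"
        using 3(1) by (simp add: abs_mult distrib_left[symmetric])
      also have "F \<theta> * w \<theta> \<le> K * w \<theta>" using K(1) w0 by (intro mult_right_mono)
      finally have *: "\<bar>F \<theta> * ln (w \<theta>)\<bar> \<le> F \<theta> * ln (max 1 (1 / w \<theta>)) + K * w \<theta>" by simp
      have "e2ennreal \<bar>?G \<theta>\<bar> = ennreal \<bar>F \<theta> * ln (w \<theta>)\<bar>"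
        using 3 by (simp add: elog_def e2ennreal_ereal)
      also have "\<dots> \<le> ennreal (F \<theta> * ln (max 1 (1 / w \<theta>)) + K * w \<theta>)" by (rule ennreal_leI[OF *])
      also have "\<dots> = ennreal (F \<theta> * ln (max 1 (1 / w \<theta>))) + ennreal (K * w \<theta>)"
        using 3 K(2) by (intro ennreal_plus) auto
      also have "ennreal (K * w \<theta>) = ennreal (2 * pi * K) * ennreal (w \<theta> / (2 * pi))"
        using K(2) w0 by (subst ennreal_mult[symmetric]) auto
      finally show ?thesis unfolding l .
    qed
  qed
  have "(\<integral>\<^sup>+\<theta>. e2ennreal \<bar>?G \<theta>\<bar> \<partial>d\<theta>)
    \<le> (\<integral>\<^sup>+\<theta>. liminf (\<lambda>m. ennreal (H m \<theta>)) + ennreal (2 * pi * K) * ennreal (w \<theta> / (2 * pi)) \<partial>d\<theta>)"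
    using pointwise by (intro nn_integral_mono) simp
  also have "\<dots> = (\<integral>\<^sup>+\<theta>. liminf (\<lambda>m. ennreal (H m \<theta>)) \<partial>d\<theta>)
     + ennreal (2 * pi * K) * (\<integral>\<^sup>+\<theta>. ennreal (w \<theta> / (2 * pi)) \<partial>d\<theta>)"
    by (subst nn_integral_add, measurable, subst nn_integral_cmult) measurable
  also have "\<dots> \<le> ennreal C0 + ennreal (2 * pi * K) * 1"
    using w_integral_le lim by (intro add_mono mult_left_mono) auto
  also have "\<dots> < \<infinity>" by simp
  finally have "L1_ereal d\<theta> ?G"
    using Gm by (simp only: L1_ereal_def)
  then show ?thesis by (simp only: F_def)
qed

end

section \<open>The equivalence\<close>

theorem theorem1p4:
  fixes \<mu> :: "complex measure" and w :: "real \<Rightarrow> real" and \<alpha> :: "nat \<Rightarrow> complex"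
    and N :: nat and q :: "nat \<Rightarrow> complex" and Q :: "complex \<Rightarrow> complex"
  assumes "nontrivial_circle_measure \<mu>"
    and "ac_density \<mu> w"
    and "\<alpha> = verblunsky \<mu>"
    and "summable (\<lambda>k. (cmod (\<alpha> k)) ^ 4)"
    and "Q = (\<lambda>z. \<Sum>m\<le>N. q m * z ^ m)"
  shows "L1_ereal d\<theta> (\<lambda>\<theta>. ereal ((cmod (Q (cis \<theta>)))\<^sup>2) * elog (w \<theta>))
    \<longleftrightarrow> square_summable (shift_poly N (\<lambda>m. cnj (q m)) \<alpha>)"
proof -
  interpret circle_density \<mu> w
    by unfold_locales fact+
  have "L1_ereal d\<theta> (\<lambda>\<theta>. ereal ((cmod (Q (cis \<theta>)))\<^sup>2) * elog (w \<theta>))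
    \<longleftrightarrow> (\<exists>C. \<forall>n. C \<le> bs_entropy N q n)"
    unfolding assms(5) using L1_imp_entropy_bounded entropy_bounded_imp_L1 by blast
  also have "\<dots> \<longleftrightarrow> square_summable (shift_poly N (\<lambda>m. cnj (q m)) \<alpha>)"
    using assms(4) unfolding assms(3) by (rule square_summable_iff_bs_entropy[symmetric])
  finally show ?thesis .
qed

end
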